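(* Let $0<\epsilon<1$ be fixed and let $\gamma\in(0,1]$. Let $f$ be a convex-concave potential function with $C^f_i<\infty$ for $i=0,1,2,3$, and let $g$ be either quadratic or a convex-concave potential function with $C^g_i<\infty$ for $i=0,1,2,3$. Let $(u,v)$ be a solution on $[0,T]$ of the peridynamic equation in first order form $$\dot u(t)=v(t),\qquad \dot v(t)=\mathcal{L}^\epsilon(u(t))+b(t),$$ and assume $u,v\in C^2([0,T];C^{0,\gamma}_0(D;\mathbb{R}^d))$. Consider, for mesh size $0<h<\epsilon$ and time step $\Delta t>0$, the finite difference scheme $$\frac{\hat u_i^{k+1}-\hat u_i^k}{\Delta t}=\hat v_i^{k+1},\qquad \frac{\hat v_i^{k+1}-\hat v_i^k}{\Delta t}=\mathcal{L}^\epsilon(\hat u^k)(x_i)+b(t^k,x_i),\qquad x_i\in D,$$ with $\hat u_i^k=0$ for all $x_i\notin D$ and all $k$. Then the scheme is consistent in both time and spatial discretization and converges to the exact solution uniformly in time with respect to the $L^2(D;\mathbb{R}^d)$ norm. If the error at the initial step is zero, i.e. $\hat u^0_i=\tilde u^0_i$ and $\hat v^0_i=\tilde v^0_i$ for all $x_i\in D$, then the error $E^k=\|\hat u^k-u^k\|_{L^2(D;\mathbb{R}^d)}+\|\hat v^k-v^k\|_{L^2(D;\mathbb{R}^d)}$ at time $t^k=k\Delta t$ is bounded and satisfies $$\sup_{0\le k\le T/\Delta t}E^k\le O\!\left(C_t\,\Delta t+C_s\,\frac{h^\gamma}{\epsilon^2}\right)\qquad\text{as }\Delta t,h\to0,$$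 where the constants $C_s$ and $C_t$ are independent of $h$ and $\Delta t$, $C_s$ depends on the Hölder norm of the solution, and $C_t$ depends on the $L^2$ norms of time derivatives of the solution.
   Context: Setting. $d\in\{2,3\}$, $D\subset\mathbb{R}^d$ is the (bounded) material domain, $\epsilon$ is the horizon, $H_r(x)$ is the open ball of radius $r$ centered at $x$, and $\omega_d$ is the volume of the unit ball in $\mathbb{R}^d$. The influence function $J:[0,\infty)\to[0,\infty)$ satisfies $J(r)=0$ for $r\ge1$ and $0\le J(r)\le M<\infty$ for $r<1$. $C^{0,\gamma}_0(D)=C^{0,\gamma}(D)\cap C_0(D)$, where $C_0(D)$ is the sup-norm closure of the continuous functions with compact support in $D$; such functions are extended by zero outside $D$. The norm is $\|u\|_{C^{0,\gamma}}=\sup_{x\in D}|u(x)|+\sup_{x\ne y\in D}\frac{|u(x)-u(y)|}{|x-y|^\gamma}$. The boundary function $\omega\in C^{0,\gamma}_0(D;[0,1])$ equals $1$ at points of $D$ at distance at least $\epsilon$ from $\partial D$, decays to $0$ on $\partial D$, and is extended by zero outside $D$. $b$ is the body force. Potentials. $f:\mathbb{R}\to\mathbb{R}$ is convex-concave: $f(0)=f'(0)=0$, there are inflection points $r^-<0<r^+$ with $f$ convex on $[r^-,r^+]$ and concave on $(-\infty,r^-]$ and on $[r^+,\infty)$, and $f$ has finite limits at $\pm\infty$. $C^f_0=\sup_r|f(r)|$, $C^f_i=\sup_r|f^{(i)}(r)|$ for $i=1,2,3$. The function $g:\mathbb{R}\to\mathbb{R}$ is either quadratic with a minimum at zero, $g(r)=\beta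 r^2/2$, or convex-concave with a well at $0$ and inflection points $r^-_*<0<r^+_*$; in the latter case $C^g_0=\sup_r|g(r)|$, $C^g_i=\sup_r|g^{(i)}(r)|$ for $i=1,2,3$. Peridynamic force. For a displacement $u$ (zero outside $D$), with $e_\xi=\xi/|\xi|$, the hydrostatic strain is $$\theta(x;u)=\frac{1}{\omega_d}\int_{H_1(0)}\omega(x+\epsilon\xi)J(|\xi|)\,(u(x+\epsilon\xi)-u(x))\cdot e_\xi\,d\xi,$$ and $\mathcal{L}^\epsilon=\mathcal{L}^\epsilon_T+\mathcal{L}^\epsilon_D$ with $$\mathcal{L}^\epsilon_T(u)(x)=\frac{2}{\epsilon\omega_d}\int_{H_1(0)}\omega(x)\omega(x+\epsilon\xi)\frac{J(|\xi|)}{\sqrt{\epsilon|\xi|}}\,f'\!\left(\frac{(u(x+\epsilon\xi)-u(x))\cdot e_\xi}{\sqrt{\epsilon|\xi|}}\right)e_\xi\,d\xi,$$ $$\mathcal{L}^\epsilon_D(u)(x)=\frac{1}{\epsilon^2\omega_d}\int_{H_1(0)}\omega(x)\omega(x+\epsilon\xi)J(|\xi|)\left[g'(\theta(x+\epsilon\xi;u))+g'(\theta(x;u))\right]e_\xi\,d\xi.$$ Discretization. The grid points are $x_i=hi$, $i\in\mathbb{Z}^d$, and $U_i$ is the cell of volume $h^d$ corresponding to $x_i$ (the axis-parallel cube of side $h$ centered at $x_i$; the cells tile $\mathbb{R}^d$). The piecewise constant extension of a discrete set $\{\hat w_i\}_{i,\,x_i\in D}$ is $\hat w(x)=\sum_{i,\,x_i\in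 D}\hat w_i\,\chi_{U_i}(x)$, and $\hat u^k,\hat v^k$ are the piecewise constant extensions of $\{\hat u^k_i\},\{\hat v^k_i\}$. $u^k=u(t^k)$ and $v^k=v(t^k)$ with $t^k=k\Delta t$. The $L^2$ projection of a function $w$ onto piecewise constants is $\tilde w(x)=\sum_{i,\,x_i\in D}\tilde w_i\chi_{U_i}(x)$ with $\tilde w_i=h^{-d}\int_{U_i}w(x)\,dx$; $\tilde u^k,\tilde v^k$ are the projections of $u^k,v^k$. Consistency. Let $\tau^k_i(u)=\partial_t\tilde u_i^{k+1}-\frac{\tilde u_i^{k+1}-\tilde u_i^k}{\Delta t}$, $\tau^k_i(v)=\partial_t\tilde v_i^{k}-\frac{\tilde v_i^{k+1}-\tilde v_i^k}{\Delta t}$, $\sigma^k_i(u)=\mathcal{L}^\epsilon(\tilde u^k)(x_i)-\mathcal{L}^\epsilon(u^k)(x_i)$, $\sigma^k_i(v)=\partial_t v(t^k,x_i)-\partial_t\tilde v^k_i$, with piecewise constant extensions $\tau^k(u),\tau^k(v),\sigma^k(u),\sigma^k(v)$. Consistency in time means that the $L^2$ norms of $\tau^k(u),\tau^k(v)$ tend to $0$ uniformly in $k$ as $\Delta t\to0$; consistency in space means that the $L^2$ norms of $\sigma^k(u),\sigma^k(v)$ tend to $0$ uniformly in $k$ as $h\to0$. The constant implied by $O(\cdot)$ does not depend on $h$ and $\Delta t$ (it may depend on $T$ and on the fixed $\epsilon$). *)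

theory Defs
  imports "HOL-Analysis.Analysis"
begin

text \<open>A function on \<open>D\<close> extended by zero is represented by a total function that vanishes
  outside \<open>D\<close>; norms only look at its values on \<open>D\<close>.\<close>

definition holder_quotients :: "'a::metric_space set \<Rightarrow> real \<Rightarrow> ('a \<Rightarrow> 'b::real_normed_vector) \<Rightarrow> real set"
  where "holder_quotients D \<gamma> w =
    {norm (w x - w y) / dist x y powr \<gamma> | x y. x \<in> D \<and> y \<in> D \<and> x \<noteq> y}"

definition holder_norm :: "'a::metric_space set \<Rightarrow> real \<Rightarrow> ('a \<Rightarrow> 'b::real_normed_vector) \<Rightarrow> real"
  where "holder_norm D \<gamma> w = (SUP x\<in>D. norm (w x)) + Sup (holder_quotients D \<gamma> w)"

definition holder_space :: "'a::metric_space set \<Rightarrow> real \<Rightarrow> ('a \<Rightarrow> 'b::real_normed_vector) set"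
  where "holder_space D \<gamma> =
    {w. bdd_above ((\<lambda>x. norm (w x)) ` D) \<and> bdd_above (holder_quotients D \<gamma> w)}"

definition compactly_supported :: "'a::metric_space set \<Rightarrow> ('a \<Rightarrow> 'b::real_normed_vector) set"
  where "compactly_supported D =
    {\<phi>. continuous_on UNIV \<phi> \<and> (\<exists>K. compact K \<and> K \<subseteq> D \<and> (\<forall>x. x \<notin> K \<longrightarrow> \<phi> x = 0))}"

definition C0_space :: "'a::metric_space set \<Rightarrow> ('a \<Rightarrow> 'b::real_normed_vector) set"
  where "C0_space D =
    {w. (\<forall>x. x \<notin> D \<longrightarrow> w x = 0) \<and>
        (\<forall>\<eta>>0. \<exists>\<phi>\<in>compactly_supported D. \<forall>x\<in>D. norm (w x - \<phi> x) \<le> \<eta>)}"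

definition holder0_space :: "'a::metric_space set \<Rightarrow> real \<Rightarrow> ('a \<Rightarrow> 'b::real_normed_vector) set"
  where "holder0_space D \<gamma> = holder_space D \<gamma> \<inter> C0_space D"

definition has_holder_time_deriv ::
    "real \<Rightarrow> 'a::metric_space set \<Rightarrow> real \<Rightarrow> (real \<Rightarrow> 'a \<Rightarrow> 'b::real_normed_vector) \<Rightarrow> (real \<Rightarrow> 'a \<Rightarrow> 'b) \<Rightarrow> bool"
  where "has_holder_time_deriv T D \<gamma> w w1 \<longleftrightarrow>
    (\<forall>t\<in>{0..T}. ((\<lambda>s. holder_norm D \<gamma> (\<lambda>x. (w s x - w t x) /\<^sub>R (s - t) - w1 t x)) \<longlongrightarrow> 0)
       (at t within {0..T}))"

text \<open>\<open>w\<close> is of class \<open>C\<^sup>2\<close> on \<open>[0,T]\<close> with values in the normed space \<open>holder0_space D \<gamma>\<close>,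
  with first and second time derivatives \<open>w1\<close> and \<open>w2\<close> (one-sided at the end points).
  Continuity of \<open>w\<close> and \<open>w1\<close> is a consequence of their differentiability.\<close>

definition C2_holder0 ::
    "real \<Rightarrow> 'a::metric_space set \<Rightarrow> real \<Rightarrow> (real \<Rightarrow> 'a \<Rightarrow> 'b::real_normed_vector) \<Rightarrow>
     (real \<Rightarrow> 'a \<Rightarrow> 'b) \<Rightarrow> (real \<Rightarrow> 'a \<Rightarrow> 'b) \<Rightarrow> bool"
  where "C2_holder0 T D \<gamma> w w1 w2 \<longleftrightarrow>
    (\<forall>t\<in>{0..T}. w t \<in> holder0_space D \<gamma> \<and> w1 t \<in> holder0_space D \<gamma> \<and> w2 t \<in> holder0_space D \<gamma>) \<and>
    has_holder_time_deriv T D \<gamma> w w1 \<and> has_holder_time_deriv T D \<gamma> w1 w2 \<and>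
    (\<forall>t\<in>{0..T}. ((\<lambda>s. holder_norm D \<gamma> (\<lambda>x. w2 s x - w2 t x)) \<longlongrightarrow> 0) (at t within {0..T}))"

definition L2_norm :: "'a::euclidean_space set \<Rightarrow> ('a \<Rightarrow> 'b::euclidean_space) \<Rightarrow> real"
  where "L2_norm D w = sqrt (LINT x:D|lborel. (norm (w x))\<^sup>2)"

definition convex_concave :: "(real \<Rightarrow> real) \<Rightarrow> bool"
  where "convex_concave f \<longleftrightarrow>
    f 0 = 0 \<and> (f has_real_derivative 0) (at 0) \<and>
    (\<exists>rm rp. rm < 0 \<and> 0 < rp \<and> convex_on {rm..rp} f \<and> concave_on {..rm} f \<and> concave_on {rp..} f) \<and>
    (\<exists>l. (f \<longlongrightarrow> l) at_top) \<and> (\<exists>l. (f \<longlongrightarrow> l) at_bot)"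

definition bounded_derivs3 :: "(real \<Rightarrow> real) \<Rightarrow> bool"
  where "bounded_derivs3 f \<longleftrightarrow>
    (\<forall>i<3. \<forall>r. ((deriv ^^ i) f) differentiable (at r)) \<and>
    (\<forall>i\<le>3. bounded (range ((deriv ^^ i) f)))"

definition quadratic_potential :: "(real \<Rightarrow> real) \<Rightarrow> bool"
  where "quadratic_potential g \<longleftrightarrow> (\<exists>\<beta>>0. \<forall>r. g r = \<beta> * r\<^sup>2 / 2)"

text \<open>Only the values on \<open>[0,\<infinity>)\<close> matter. Measurability is implicit in the integrals below.\<close>

definition influence_function :: "(real \<Rightarrow> real) \<Rightarrow> bool"
  where "influence_function J \<longleftrightarrow>
    J \<in> borel_measurable (restrict_space borel {0..}) \<and>
    (\<forall>r\<ge>1. J r = 0) \<and> (\<exists>M. \<forall>r\<in>{0..<1}. 0 \<le> J r \<and> J r \<le> M)"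

definition boundary_function :: "'a::metric_space set \<Rightarrow> real \<Rightarrow> real \<Rightarrow> ('a \<Rightarrow> real) \<Rightarrow> bool"
  where "boundary_function D \<gamma> \<epsilon> \<omega> \<longleftrightarrow>
    \<omega> \<in> holder0_space D \<gamma> \<and> (\<forall>x\<in>D. 0 \<le> \<omega> x \<and> \<omega> x \<le> 1) \<and>
    (\<forall>x\<in>D. infdist x (frontier D) \<ge> \<epsilon> \<longrightarrow> \<omega> x = 1)"

definition unit_vec :: "'a::real_normed_vector \<Rightarrow> 'a"
  where "unit_vec \<xi> = \<xi> /\<^sub>R norm \<xi>"

definition ball_vol :: "'n::finite itself \<Rightarrow> real"
  where "ball_vol _ = measure lborel (ball (0::real^'n) 1)"

definition hydrostatic_strain ::
    "real \<Rightarrow> (real \<Rightarrow> real) \<Rightarrow> (real^'n \<Rightarrow> real) \<Rightarrow> (real^'n \<Rightarrow> real^'n) \<Rightarrow> real^'n \<Rightarrow> real"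
  where "hydrostatic_strain \<epsilon> J \<omega> u x =
    1 / ball_vol TYPE('n) *
    (LINT \<xi>:ball 0 1|lborel.
       \<omega> (x + \<epsilon> *\<^sub>R \<xi>) * J (norm \<xi>) * ((u (x + \<epsilon> *\<^sub>R \<xi>) - u x) \<bullet> unit_vec \<xi>))"

definition tensile_force ::
    "real \<Rightarrow> (real \<Rightarrow> real) \<Rightarrow> (real^'n \<Rightarrow> real) \<Rightarrow> (real \<Rightarrow> real) \<Rightarrow> (real^'n \<Rightarrow> real^'n) \<Rightarrow> real^'n \<Rightarrow> real^'n"
  where "tensile_force \<epsilon> J \<omega> f u x =
    (2 / (\<epsilon> * ball_vol TYPE('n))) *\<^sub>R
    (LINT \<xi>:ball 0 1|lborel.
       (\<omega> x * \<omega> (x + \<epsilon> *\<^sub>R \<xi>) * (J (norm \<xi>) / sqrt (\<epsilon> * norm \<xi>)) *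
        deriv f (((u (x + \<epsilon> *\<^sub>R \<xi>) - u x) \<bullet> unit_vec \<xi>) / sqrt (\<epsilon> * norm \<xi>))) *\<^sub>R unit_vec \<xi>)"

definition dilatational_force ::
    "real \<Rightarrow> (real \<Rightarrow> real) \<Rightarrow> (real^'n \<Rightarrow> real) \<Rightarrow> (real \<Rightarrow> real) \<Rightarrow> (real^'n \<Rightarrow> real^'n) \<Rightarrow> real^'n \<Rightarrow> real^'n"
  where "dilatational_force \<epsilon> J \<omega> g u x =
    (1 / (\<epsilon>\<^sup>2 * ball_vol TYPE('n))) *\<^sub>R
    (LINT \<xi>:ball 0 1|lborel.
       (\<omega> x * \<omega> (x + \<epsilon> *\<^sub>R \<xi>) * J (norm \<xi>) *
        (deriv g (hydrostatic_strain \<epsilon> J \<omega> u (x + \<epsilon> *\<^sub>R \<xi>)) +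
         deriv g (hydrostatic_strain \<epsilon> J \<omega> u x))) *\<^sub>R unit_vec \<xi>)"

definition peri_force ::
    "real \<Rightarrow> (real \<Rightarrow> real) \<Rightarrow> (real^'n \<Rightarrow> real) \<Rightarrow> (real \<Rightarrow> real) \<Rightarrow> (real \<Rightarrow> real) \<Rightarrow>
     (real^'n \<Rightarrow> real^'n) \<Rightarrow> real^'n \<Rightarrow> real^'n"
  where "peri_force \<epsilon> J \<omega> f g u x = tensile_force \<epsilon> J \<omega> f u x + dilatational_force \<epsilon> J \<omega> g u x"

text \<open>In the following the force operator is a parameter \<open>L\<close>, later instantiated with
  \<open>peri_force \<epsilon> J \<omega> f g\<close>.  The functions \<open>u1, u2, v1, v2\<close> are the time derivatives of \<open>u, v\<close>.\<close>

definition peri_solution ::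
    "real \<Rightarrow> (real^'n) set \<Rightarrow> real \<Rightarrow> ((real^'n \<Rightarrow> real^'n) \<Rightarrow> real^'n \<Rightarrow> real^'n) \<Rightarrow>
     (real \<Rightarrow> real^'n \<Rightarrow> real^'n) \<Rightarrow>
     (real \<Rightarrow> real^'n \<Rightarrow> real^'n) \<Rightarrow> (real \<Rightarrow> real^'n \<Rightarrow> real^'n) \<Rightarrow> (real \<Rightarrow> real^'n \<Rightarrow> real^'n) \<Rightarrow>
     (real \<Rightarrow> real^'n \<Rightarrow> real^'n) \<Rightarrow> (real \<Rightarrow> real^'n \<Rightarrow> real^'n) \<Rightarrow> (real \<Rightarrow> real^'n \<Rightarrow> real^'n) \<Rightarrow> bool"
  where "peri_solution T D \<gamma> L b u u1 u2 v v1 v2 \<longleftrightarrow>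
    C2_holder0 T D \<gamma> u u1 u2 \<and> C2_holder0 T D \<gamma> v v1 v2 \<and>
    (\<forall>t\<in>{0..T}. \<forall>x\<in>D. u1 t x = v t x \<and> v1 t x = L (u t) x + b t x)"

definition grid :: "real \<Rightarrow> int^'n \<Rightarrow> real^'n"
  where "grid h i = (\<chi> j. h * real_of_int (i $ j))"

text \<open>Half-open cubes, so that the cells tile the space exactly.\<close>

definition cell :: "real \<Rightarrow> int^'n \<Rightarrow> (real^'n) set"
  where "cell h i = {x. \<forall>j. grid h i $ j - h / 2 \<le> x $ j \<and> x $ j < grid h i $ j + h / 2}"

definition pw_const :: "(real^'n) set \<Rightarrow> real \<Rightarrow> (int^'n \<Rightarrow> real^'n) \<Rightarrow> real^'n \<Rightarrow> real^'n"
  where "pw_const D h w x = (\<Sum>i | grid h i \<in> D. indicator (cell h i) x *\<^sub>R w i)"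

definition cell_avg :: "real \<Rightarrow> (real^'n \<Rightarrow> real^'n) \<Rightarrow> int^'n \<Rightarrow> real^'n"
  where "cell_avg h w i = (1 / h ^ CARD('n)) *\<^sub>R (LINT x:cell h i|lborel. w x)"

definition fd_scheme ::
    "real \<Rightarrow> (real^'n) set \<Rightarrow> ((real^'n \<Rightarrow> real^'n) \<Rightarrow> real^'n \<Rightarrow> real^'n) \<Rightarrow>
     (real \<Rightarrow> real^'n \<Rightarrow> real^'n) \<Rightarrow> real \<Rightarrow> real \<Rightarrow>
     (nat \<Rightarrow> int^'n \<Rightarrow> real^'n) \<Rightarrow> (nat \<Rightarrow> int^'n \<Rightarrow> real^'n) \<Rightarrow> bool"
  where "fd_scheme T D L b h \<Delta>t uh vh \<longleftrightarrow>
    (\<forall>k. real (Suc k) * \<Delta>t \<le> T \<longrightarrow> (\<forall>i. grid h i \<in> D \<longrightarrow>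
       (uh (Suc k) i - uh k i) /\<^sub>R \<Delta>t = vh (Suc k) i \<and>
       (vh (Suc k) i - vh k i) /\<^sub>R \<Delta>t =
         L (pw_const D h (uh k)) (grid h i) + b (real k * \<Delta>t) (grid h i))) \<and>
    (\<forall>k i. grid h i \<notin> D \<longrightarrow> uh k i = 0)"

definition fd_error ::
    "(real^'n) set \<Rightarrow> (real \<Rightarrow> real^'n \<Rightarrow> real^'n) \<Rightarrow> (real \<Rightarrow> real^'n \<Rightarrow> real^'n) \<Rightarrow> real \<Rightarrow> real \<Rightarrow>
     (nat \<Rightarrow> int^'n \<Rightarrow> real^'n) \<Rightarrow> (nat \<Rightarrow> int^'n \<Rightarrow> real^'n) \<Rightarrow> nat \<Rightarrow> real"
  where "fd_error D u v h \<Delta>t uh vh k =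
    L2_norm D (\<lambda>x. pw_const D h (uh k) x - u (real k * \<Delta>t) x) +
    L2_norm D (\<lambda>x. pw_const D h (vh k) x - v (real k * \<Delta>t) x)"

definition tau_u :: "real \<Rightarrow> (real \<Rightarrow> real^'n \<Rightarrow> real^'n) \<Rightarrow> real \<Rightarrow> real \<Rightarrow> nat \<Rightarrow> int^'n \<Rightarrow> real^'n"
  where "tau_u T u h \<Delta>t k i =
    vector_derivative (\<lambda>t. cell_avg h (u t) i) (at (real (Suc k) * \<Delta>t) within {0..T}) -
    (cell_avg h (u (real (Suc k) * \<Delta>t)) i - cell_avg h (u (real k * \<Delta>t)) i) /\<^sub>R \<Delta>t"

definition tau_v :: "real \<Rightarrow> (real \<Rightarrow> real^'n \<Rightarrow> real^'n) \<Rightarrow> real \<Rightarrow> real \<Rightarrow> nat \<Rightarrow> int^'n \<Rightarrow> real^'n"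
  where "tau_v T v h \<Delta>t k i =
    vector_derivative (\<lambda>t. cell_avg h (v t) i) (at (real k * \<Delta>t) within {0..T}) -
    (cell_avg h (v (real (Suc k) * \<Delta>t)) i - cell_avg h (v (real k * \<Delta>t)) i) /\<^sub>R \<Delta>t"

definition sigma_u ::
    "(real^'n) set \<Rightarrow> ((real^'n \<Rightarrow> real^'n) \<Rightarrow> real^'n \<Rightarrow> real^'n) \<Rightarrow> (real \<Rightarrow> real^'n \<Rightarrow> real^'n) \<Rightarrow>
     real \<Rightarrow> real \<Rightarrow> nat \<Rightarrow> int^'n \<Rightarrow> real^'n"
  where "sigma_u D L u h \<Delta>t k i =
    L (pw_const D h (cell_avg h (u (real k * \<Delta>t)))) (grid h i) - L (u (real k * \<Delta>t)) (grid h i)"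

definition sigma_v :: "real \<Rightarrow> (real \<Rightarrow> real^'n \<Rightarrow> real^'n) \<Rightarrow> real \<Rightarrow> real \<Rightarrow> nat \<Rightarrow> int^'n \<Rightarrow> real^'n"
  where "sigma_v T v h \<Delta>t k i =
    vector_derivative (\<lambda>t. v t (grid h i)) (at (real k * \<Delta>t) within {0..T}) -
    vector_derivative (\<lambda>t. cell_avg h (v t) i) (at (real k * \<Delta>t) within {0..T})"

text \<open>The quantity tending to zero is controlled uniformly in the time level and in the other
  discretization parameter. The time truncation errors involve the level \<open>Suc k\<close>.\<close>

definition consistent_in_time ::
    "real \<Rightarrow> (real^'n) set \<Rightarrow> real \<Rightarrow> (real \<Rightarrow> real^'n \<Rightarrow> real^'n) \<Rightarrow> (real \<Rightarrow> real^'n \<Rightarrow> real^'n) \<Rightarrow> bool"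
  where "consistent_in_time T D \<epsilon> u v \<longleftrightarrow>
    (\<forall>\<eta>>0. \<forall>\<^sub>F \<Delta>t in at_right 0. \<forall>h\<in>{0<..<\<epsilon>}. \<forall>k. real (Suc k) * \<Delta>t \<le> T \<longrightarrow>
       L2_norm D (pw_const D h (tau_u T u h \<Delta>t k)) < \<eta> \<and>
       L2_norm D (pw_const D h (tau_v T v h \<Delta>t k)) < \<eta>)"

definition consistent_in_space ::
    "real \<Rightarrow> (real^'n) set \<Rightarrow> ((real^'n \<Rightarrow> real^'n) \<Rightarrow> real^'n \<Rightarrow> real^'n) \<Rightarrow>
     (real \<Rightarrow> real^'n \<Rightarrow> real^'n) \<Rightarrow> (real \<Rightarrow> real^'n \<Rightarrow> real^'n) \<Rightarrow> bool"
  where "consistent_in_space T D L u v \<longleftrightarrow>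
    (\<forall>\<eta>>0. \<forall>\<^sub>F h in at_right 0. \<forall>\<Delta>t>0. \<forall>k. real k * \<Delta>t \<le> T \<longrightarrow>
       L2_norm D (pw_const D h (sigma_u D L u h \<Delta>t k)) < \<eta> \<and>
       L2_norm D (pw_const D h (sigma_v T v h \<Delta>t k)) < \<eta>)"

text \<open>Uniform-in-time convergence, for every family of discrete solutions (one for each pair
  \<open>(h, \<Delta>t)\<close>) whose initial error tends to zero.\<close>

definition scheme_converges ::
    "real \<Rightarrow> (real^'n) set \<Rightarrow> real \<Rightarrow> ((real^'n \<Rightarrow> real^'n) \<Rightarrow> real^'n \<Rightarrow> real^'n) \<Rightarrow>
     (real \<Rightarrow> real^'n \<Rightarrow> real^'n) \<Rightarrow> (real \<Rightarrow> real^'n \<Rightarrow> real^'n) \<Rightarrow> (real \<Rightarrow> real^'n \<Rightarrow> real^'n) \<Rightarrow> bool"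
  where "scheme_converges T D \<epsilon> L b u v \<longleftrightarrow>
    (\<forall>uh vh.
       (\<forall>h\<in>{0<..<\<epsilon>}. \<forall>\<Delta>t>0. fd_scheme T D L b h \<Delta>t (uh h \<Delta>t) (vh h \<Delta>t)) \<and>
       ((\<lambda>(h, \<Delta>t). fd_error D u v h \<Delta>t (uh h \<Delta>t) (vh h \<Delta>t) 0) \<longlongrightarrow> 0) (at_right 0 \<times>\<^sub>F at_right 0)
       \<longrightarrow>
       ((\<lambda>(h, \<Delta>t). SUP k\<in>{k. real k * \<Delta>t \<le> T}. fd_error D u v h \<Delta>t (uh h \<Delta>t) (vh h \<Delta>t) k)
          \<longlongrightarrow> 0) (at_right 0 \<times>\<^sub>F at_right 0))"

text \<open>The spatial rate is governed by the Hoelder norms of \<open>u\<close>, \<open>v\<close> (projection errors, force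
  consistency) and \<open>\<partial>\<^sub>t v\<close> (from \<open>sigma_v\<close>), the temporal one by the \<open>L\<^sup>2\<close> norms of the second
  time derivatives; both are taken as suprema over \<open>[0,T]\<close>.\<close>

definition solution_holder_norm ::
    "real \<Rightarrow> (real^'n) set \<Rightarrow> real \<Rightarrow> (real \<Rightarrow> real^'n \<Rightarrow> real^'n) \<Rightarrow> (real \<Rightarrow> real^'n \<Rightarrow> real^'n) \<Rightarrow>
     (real \<Rightarrow> real^'n \<Rightarrow> real^'n) \<Rightarrow> real"
  where "solution_holder_norm T D \<gamma> u v v1 =
    (SUP t\<in>{0..T}. holder_norm D \<gamma> (u t) + holder_norm D \<gamma> (v t) + holder_norm D \<gamma> (v1 t))"

definition solution_L2_deriv_norm ::
    "real \<Rightarrow> (real^'n) set \<Rightarrow> (real \<Rightarrow> real^'n \<Rightarrow> real^'n) \<Rightarrow> (real \<Rightarrow> real^'n \<Rightarrow> real^'n) \<Rightarrow> real"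
  where "solution_L2_deriv_norm T D u2 v2 =
    (SUP t\<in>{0..T}. L2_norm D (u2 t) + L2_norm D (v2 t))"

end

theory Submission
  imports Defs
begin

text \<open>Why the theorem holds. The scheme is an explicit Euler step for the velocity followed by an
  update of the displacement with the new velocity. Its error splits into the projection error of
  the exact solution and the grid error between the discrete solution and the cell averages of the
  exact one. Consistency makes the defect of the cell averages in the scheme small, stability of
  the force makes one time step amplify the grid error by at most \<open>1 + A * \<Delta>t\<close>, and a discrete
  Gronwall argument (\<open>discrete_gronwall\<close>, \<open>grid_error_step\<close>, \<open>fd_error_estimate\<close>) adds up the steps.

  Stability. The potentials have Lipschitz derivatives, so a difference of forces is controlled by
  the difference \<open>e\<close> of the displacements: by its value at the point, by its mean over the body
  (through the hydrostatic strain) and by \<open>\<integral>\<^sub>D norm (e y) / norm (x - y) dy\<close> (through the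
  bond strain, whose scaling by the square root of the bond length occurs twice). This is
  \<open>peri_force_lipschitz\<close>. The kernel \<open>1 / norm z\<close> is locally integrable in dimension at least
  two, and Schur's test turns that into boundedness on L2 (\<open>riesz_L2_bound\<close>). Since the scheme
  samples the force at grid points only, the singular integral at a grid point has to be compared
  with its values in the rest of the cell; this is possible because the discrete field is constant
  on the cell (\<open>riesz_at_grid_le\<close>). Working throughout with the norm of \<open>L\<^sup>2(D)\<close>, in which a
  cell counts only with its part inside \<open>D\<close>, makes the stability estimate applicable when merely
  the initial error in this norm is known to vanish in the limit.

  Consistency in space. A function of the Hoelder space with zero boundary values stays Hoelder
  continuous with the same constant when extended by zero (\<open>holder0_continuity\<close>), so its cell
  averages differ from it by \<open>O(h powr \<gamma>)\<close>, uniformly and up to the boundary. The sup-norm version of the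
  force estimate passes this rate on to the forces.

  Consistency in time. The truncation error has to be bounded by the L2 norm of the second time
  derivative although that derivative exists in the Hoelder norm. Testing the truncation error
  against itself reduces the question to the mean value theorem for a real function of time
  (\<open>truncation_L2_bound\<close>), and averaging over cells does not increase the L2 norm
  (\<open>L2_pw_const_cell_avg_le\<close>).\<close>

section \<open>Hoelder spaces and functions extended by zero\<close>

lemma norm_le_of_bdd_quotient:
  fixes w :: "'a::metric_space \<Rightarrow> 'b::real_normed_vector"
  assumes "bdd_above (holder_quotients D \<gamma> w)" "x \<in> D" "y \<in> D"
  shows "norm (w x - w y) \<le> Sup (holder_quotients D \<gamma> w) * dist x y powr \<gamma>"
proof (cases "x = y")
  case False
  then have "norm (w x - w y) / dist x y powr \<gamma> \<in> holder_quotients D \<gamma> w"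
    using assms unfolding holder_quotients_def by blast
  then have "norm (w x - w y) / dist x y powr \<gamma> \<le> Sup (holder_quotients D \<gamma> w)"
    using assms(1) by (rule cSup_upper)
  moreover have "0 < dist x y powr \<gamma>" using False by simp
  ultimately show ?thesis by (simp add: divide_simps)
qed simp

lemma open_two_points:
  fixes D :: "'a::euclidean_space set"
  assumes "open D" "D \<noteq> {}"
  obtains x y where "x \<in> D" "y \<in> D" "x \<noteq> y"
proof -
  obtain x where x: "x \<in> D" using assms by auto
  have "\<not> D \<subseteq> {x}" using assms x
    by (metis finite.emptyI finite.insertI finite_imp_not_open finite_subset)
  then show thesis using that x by auto
qed

lemma holder_quotients_nonempty:
  fixes D :: "'a::euclidean_space set"
  assumes "open D" "D \<noteq> {}"
  shows "holder_quotients D \<gamma> w \<noteq> {}"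
proof -
  obtain x y where "x \<in> D" "y \<in> D" "x \<noteq> y" by (rule open_two_points[OF assms])
  then show ?thesis unfolding holder_quotients_def by blast
qed

text \<open>For a member of the Hoelder space both suprema range over nonempty bounded sets of nonnegative
  numbers, so the Hoelder norm dominates each of them. Two distinct points of the open set
  \<open>D\<close> make the set of quotients nonempty.\<close>

context
  fixes D :: "'a::euclidean_space set"
  assumes D: "open D" "D \<noteq> {}"
begin

lemma holder_sups_nonneg:
  fixes w :: "'a \<Rightarrow> 'b::real_normed_vector"
  assumes "w \<in> holder_space D \<gamma>"
  shows "0 \<le> (SUP x\<in>D. norm (w x))" "0 \<le> Sup (holder_quotients D \<gamma> w)"
proof -
  have b: "bdd_above ((\<lambda>x. norm (w x)) ` D)" "bdd_above (holder_quotients D \<gamma> w)"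
    using assms by (auto simp: holder_space_def)
  obtain x where "x \<in> D" using D by auto
  then have "norm (w x) \<le> (SUP x\<in>D. norm (w x))" using b(1) by (rule cSUP_upper)
  then show "0 \<le> (SUP x\<in>D. norm (w x))" using norm_ge_zero order_trans by blast
  obtain q where q: "q \<in> holder_quotients D \<gamma> w" using holder_quotients_nonempty[OF D] by blast
  then have "0 \<le> q" by (auto simp: holder_quotients_def)
  also have "q \<le> Sup (holder_quotients D \<gamma> w)" using q b(2) by (rule cSup_upper)
  finally show "0 \<le> Sup (holder_quotients D \<gamma> w)" .
qed

lemma holder_norm_nonneg:
  fixes w :: "'a \<Rightarrow> 'b::real_normed_vector"
  assumes "w \<in> holder_space D \<gamma>" shows "0 \<le> holder_norm D \<gamma> w"
  using holder_sups_nonneg[OF assms] by (simp add: holder_norm_def)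

lemma norm_le_holder_norm:
  fixes w :: "'a \<Rightarrow> 'b::real_normed_vector"
  assumes "w \<in> holder_space D \<gamma>" "x \<in> D"
  shows "norm (w x) \<le> holder_norm D \<gamma> w"
proof -
  have "bdd_above ((\<lambda>x. norm (w x)) ` D)" using assms by (auto simp: holder_space_def)
  then have "norm (w x) \<le> (SUP x\<in>D. norm (w x))" using assms(2) by (intro cSUP_upper)
  then show ?thesis using holder_sups_nonneg(2)[OF assms(1)] by (simp add: holder_norm_def)
qed

lemma holder_norm_continuity:
  fixes w :: "'a \<Rightarrow> 'b::real_normed_vector"
  assumes "w \<in> holder_space D \<gamma>" "x \<in> D" "y \<in> D"
  shows "norm (w x - w y) \<le> holder_norm D \<gamma> w * dist x y powr \<gamma>"
proof -
  have "bdd_above (holder_quotients D \<gamma> w)" using assms by (auto simp: holder_space_def)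
  from norm_le_of_bdd_quotient[OF this assms(2,3)]
  have "norm (w x - w y) \<le> Sup (holder_quotients D \<gamma> w) * dist x y powr \<gamma>" .
  also have "\<dots> \<le> holder_norm D \<gamma> w * dist x y powr \<gamma>"
    using holder_sups_nonneg(1)[OF assms(1)] by (intro mult_right_mono) (auto simp: holder_norm_def)
  finally show ?thesis .
qed

lemma holder_norm_leI:
  fixes w :: "'a \<Rightarrow> 'b::real_normed_vector"
  assumes "\<And>x. x \<in> D \<Longrightarrow> norm (w x) \<le> A"
    and "\<And>x y. x \<in> D \<Longrightarrow> y \<in> D \<Longrightarrow> norm (w x - w y) \<le> B * dist x y powr \<gamma>"
  shows "w \<in> holder_space D \<gamma>" "holder_norm D \<gamma> w \<le> A + B"
proof -
  have q: "q \<le> B" if q: "q \<in> holder_quotients D \<gamma> w" for q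
  proof -
    obtain x y where xy: "q = norm (w x - w y) / dist x y powr \<gamma>" "x \<in> D" "y \<in> D" "x \<noteq> y"
      using q unfolding holder_quotients_def by blast
    then have "0 < dist x y powr \<gamma>" by simp
    then have "norm (w x - w y) / dist x y powr \<gamma> \<le> B"
      using assms(2)[OF xy(2,3)] by (subst pos_divide_le_eq)
    then show ?thesis using xy(1) by simp
  qed
  show "w \<in> holder_space D \<gamma>"
    unfolding holder_space_def
    using assms(1) q by (intro CollectI conjI bdd_aboveI[of _ A] bdd_aboveI[of _ B]) auto
  have "(SUP x\<in>D. norm (w x)) \<le> A" using D assms(1) by (intro cSUP_least)
  moreover have "Sup (holder_quotients D \<gamma> w) \<le> B"
    using holder_quotients_nonempty[OF D] q by (intro cSup_least)
  ultimately show "holder_norm D \<gamma> w \<le> A + B" by (simp add: holder_norm_def)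
qed

lemma
  fixes w z :: "'a \<Rightarrow> 'b::real_normed_vector"
  assumes w: "w \<in> holder_space D \<gamma>" and z: "z \<in> holder_space D \<gamma>"
  shows holder_space_add: "(\<lambda>x. w x + z x) \<in> holder_space D \<gamma>"
    and holder_norm_add_le: "holder_norm D \<gamma> (\<lambda>x. w x + z x) \<le> holder_norm D \<gamma> w + holder_norm D \<gamma> z"
proof -
  let ?A = "(SUP x\<in>D. norm (w x)) + (SUP x\<in>D. norm (z x))"
  let ?B = "Sup (holder_quotients D \<gamma> w) + Sup (holder_quotients D \<gamma> z)"
  have b: "bdd_above ((\<lambda>x. norm (w x)) ` D)" "bdd_above (holder_quotients D \<gamma> w)"
    "bdd_above ((\<lambda>x. norm (z x)) ` D)" "bdd_above (holder_quotients D \<gamma> z)"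
    using w z by (auto simp: holder_space_def)
  have 1: "norm (w x + z x) \<le> ?A" if "x \<in> D" for x
    using cSUP_upper[OF that b(1)] cSUP_upper[OF that b(3)] norm_triangle_ineq[of "w x" "z x"]
    by linarith
  have 2: "norm ((w x + z x) - (w y + z y)) \<le> ?B * dist x y powr \<gamma>" if "x \<in> D" "y \<in> D" for x y
  proof -
    have "norm ((w x + z x) - (w y + z y)) \<le> norm (w x - w y) + norm (z x - z y)"
      by (metis add_diff_add norm_triangle_ineq)
    then show ?thesis using norm_le_of_bdd_quotient[OF b(2) that] norm_le_of_bdd_quotient[OF b(4) that]
      by (simp add: distrib_right)
  qed
  show "(\<lambda>x. w x + z x) \<in> holder_space D \<gamma>"
    by (rule holder_norm_leI(1)[of "\<lambda>x. w x + z x", OF 1 2])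
  have "holder_norm D \<gamma> (\<lambda>x. w x + z x) \<le> ?A + ?B"
    by (rule holder_norm_leI(2)[of "\<lambda>x. w x + z x", OF 1 2])
  then show "holder_norm D \<gamma> (\<lambda>x. w x + z x) \<le> holder_norm D \<gamma> w + holder_norm D \<gamma> z"
    by (simp add: holder_norm_def)
qed

lemma
  fixes w :: "'a \<Rightarrow> 'b::real_normed_vector"
  assumes w: "w \<in> holder_space D \<gamma>"
  shows holder_space_scale: "(\<lambda>x. c *\<^sub>R w x) \<in> holder_space D \<gamma>"
    and holder_norm_scale_le: "holder_norm D \<gamma> (\<lambda>x. c *\<^sub>R w x) \<le> \<bar>c\<bar> * holder_norm D \<gamma> w"
proof -
  let ?A = "\<bar>c\<bar> * (SUP x\<in>D. norm (w x))"
  let ?B = "\<bar>c\<bar> * Sup (holder_quotients D \<gamma> w)"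
  have b: "bdd_above ((\<lambda>x. norm (w x)) ` D)" "bdd_above (holder_quotients D \<gamma> w)"
    using w by (auto simp: holder_space_def)
  have 1: "norm (c *\<^sub>R w x) \<le> ?A" if "x \<in> D" for x
    using cSUP_upper[OF that b(1)] by (simp add: mult_left_mono)
  have 2: "norm (c *\<^sub>R w x - c *\<^sub>R w y) \<le> ?B * dist x y powr \<gamma>" if "x \<in> D" "y \<in> D" for x y
    using norm_le_of_bdd_quotient[OF b(2) that]
    by (simp add: scaleR_diff_right[symmetric] mult.assoc mult_left_mono)
  show "(\<lambda>x. c *\<^sub>R w x) \<in> holder_space D \<gamma>"
    by (rule holder_norm_leI(1)[of "\<lambda>x. c *\<^sub>R w x", OF 1 2])
  have "holder_norm D \<gamma> (\<lambda>x. c *\<^sub>R w x) \<le> ?A + ?B"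
    by (rule holder_norm_leI(2)[of "\<lambda>x. c *\<^sub>R w x", OF 1 2])
  then show "holder_norm D \<gamma> (\<lambda>x. c *\<^sub>R w x) \<le> \<bar>c\<bar> * holder_norm D \<gamma> w"
    by (simp add: holder_norm_def distrib_left)
qed

lemma holder_space_diff:
  fixes w z :: "'a \<Rightarrow> 'b::real_normed_vector"
  assumes w: "w \<in> holder_space D \<gamma>" and z: "z \<in> holder_space D \<gamma>"
  shows "(\<lambda>x. w x - z x) \<in> holder_space D \<gamma>"
  using holder_space_add[OF w holder_space_scale[OF z, of "-1"]] by simp

end

subsection \<open>Extension by zero\<close>

lemma C0_space_zero: "w \<in> C0_space D \<Longrightarrow> x \<notin> D \<Longrightarrow> w x = 0"
  by (simp add: C0_space_def)

text \<open>Both a function of \<open>C0_space D\<close> and its compactly supported approximations vanish off \<open>D\<close>,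
  so the approximation is uniform on the whole space and continuity passes to the limit.\<close>

lemma C0_space_continuous:
  fixes w :: "'a::metric_space \<Rightarrow> 'b::real_normed_vector"
  assumes "w \<in> C0_space D"
  shows "continuous_on UNIV w"
proof -
  have "\<exists>\<phi>. continuous_on UNIV \<phi> \<and> (\<forall>x. norm (w x - \<phi> x) \<le> \<eta>)" if eta: "\<eta> > 0" for \<eta>
  proof -
    obtain \<phi> where \<phi>: "\<phi> \<in> compactly_supported D" "\<forall>x\<in>D. norm (w x - \<phi> x) \<le> \<eta>"
      using assms eta by (auto simp: C0_space_def)
    then obtain K where K: "continuous_on UNIV \<phi>" "K \<subseteq> D" "\<forall>x. x \<notin> K \<longrightarrow> \<phi> x = 0"
      by (auto simp: compactly_supported_def)
    have "norm (w x - \<phi> x) \<le> \<eta>" for x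
    proof (cases "x \<in> D")
      case False
      then have "w x = 0" "\<phi> x = 0" using assms K by (auto simp: C0_space_zero)
      then show ?thesis using eta by simp
    qed (use \<phi> in auto)
    then show ?thesis using K(1) by blast
  qed
  then obtain \<phi> where \<phi>: "\<And>\<eta>. \<eta> > 0 \<Longrightarrow> continuous_on UNIV (\<phi> \<eta>)"
      "\<And>\<eta> x. \<eta> > 0 \<Longrightarrow> norm (w x - \<phi> \<eta> x) \<le> \<eta>" by metis
  have "uniform_limit UNIV (\<lambda>n. \<phi> (inverse (real (Suc n)))) w sequentially"
  proof (rule uniform_limitI)
    fix e :: real assume "e > 0"
    then have "\<forall>\<^sub>F n in sequentially. inverse (real (Suc n)) < e"
      using LIMSEQ_inverse_real_of_nat by (rule order_tendstoD(2)[rotated])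
    then show "\<forall>\<^sub>F n in sequentially. \<forall>x\<in>UNIV. dist (\<phi> (inverse (real (Suc n))) x) (w x) < e"
    proof eventually_elim
      case (elim n)
      then show ?case using \<phi>(2)[of "inverse (real (Suc n))"]
        by (auto simp: dist_norm norm_minus_commute intro: le_less_trans)
    qed
  qed
  moreover have "\<forall>\<^sub>F n in sequentially. continuous_on UNIV (\<phi> (inverse (real (Suc n))))"
    by (intro always_eventually allI \<phi>(1)) simp
  ultimately show ?thesis using uniform_limit_theorem by (metis sequentially_bot)
qed

lemma C0_space_approx:
  assumes "w \<in> C0_space D" "0 < \<eta>"
  obtains \<phi> where "\<phi> \<in> compactly_supported D" "\<And>x. x \<in> D \<Longrightarrow> norm (w x - \<phi> x) \<le> \<eta>"
  using assms unfolding C0_space_def by blast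

lemma C0_space_add:
  fixes w z :: "'a::metric_space \<Rightarrow> 'b::real_normed_vector"
  assumes w: "w \<in> C0_space D" and z: "z \<in> C0_space D"
  shows "(\<lambda>x. w x + z x) \<in> C0_space D"
  unfolding C0_space_def
proof (intro CollectI conjI allI impI)
  fix x assume "x \<notin> D" then show "w x + z x = 0" using w z by (simp add: C0_space_zero)
next
  fix \<eta> :: real assume "0 < \<eta>"
  then have "0 < \<eta> / 2" by simp
  then obtain \<phi> \<psi> where \<phi>: "\<phi> \<in> compactly_supported D" "\<And>x. x \<in> D \<Longrightarrow> norm (w x - \<phi> x) \<le> \<eta> / 2"
    and \<psi>: "\<psi> \<in> compactly_supported D" "\<And>x. x \<in> D \<Longrightarrow> norm (z x - \<psi> x) \<le> \<eta> / 2"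
    using C0_space_approx[OF w] C0_space_approx[OF z] by metis
  obtain K where K: "compact K" "K \<subseteq> D" "\<forall>x. x \<notin> K \<longrightarrow> \<phi> x = 0" "continuous_on UNIV \<phi>"
    using \<phi>(1) unfolding compactly_supported_def by blast
  obtain L where L: "compact L" "L \<subseteq> D" "\<forall>x. x \<notin> L \<longrightarrow> \<psi> x = 0" "continuous_on UNIV \<psi>"
    using \<psi>(1) unfolding compactly_supported_def by blast
  have "compact (K \<union> L)" "K \<union> L \<subseteq> D" "\<forall>x. x \<notin> K \<union> L \<longrightarrow> \<phi> x + \<psi> x = 0"
      "continuous_on UNIV (\<lambda>x. \<phi> x + \<psi> x)"
    using K L by (simp_all add: compact_Un continuous_on_add)
  then have "(\<lambda>x. \<phi> x + \<psi> x) \<in> compactly_supported D"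
    unfolding compactly_supported_def by blast
  moreover have "norm ((w x + z x) - (\<phi> x + \<psi> x)) \<le> \<eta>" if "x \<in> D" for x
  proof -
    have "norm ((w x + z x) - (\<phi> x + \<psi> x)) \<le> norm (w x - \<phi> x) + norm (z x - \<psi> x)"
      by (metis add_diff_add norm_triangle_ineq)
    then show ?thesis using \<phi>(2)[OF that] \<psi>(2)[OF that] by simp
  qed
  ultimately show "\<exists>\<phi>\<in>compactly_supported D. \<forall>x\<in>D. norm (w x + z x - \<phi> x) \<le> \<eta>"
    by (intro bexI[of _ "\<lambda>x. \<phi> x + \<psi> x"]) simp_all
qed

lemma C0_space_scale:
  fixes w :: "'a::metric_space \<Rightarrow> 'b::real_normed_vector"
  assumes w: "w \<in> C0_space D"
  shows "(\<lambda>x. c *\<^sub>R w x) \<in> C0_space D"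
  unfolding C0_space_def
proof (intro CollectI conjI allI impI)
  fix x assume "x \<notin> D" then show "c *\<^sub>R w x = 0" using w by (simp add: C0_space_zero)
next
  fix \<eta> :: real assume "0 < \<eta>"
  then have "0 < \<eta> / (\<bar>c\<bar> + 1)" by simp
  then obtain \<phi> where \<phi>: "\<phi> \<in> compactly_supported D"
      "\<And>x. x \<in> D \<Longrightarrow> norm (w x - \<phi> x) \<le> \<eta> / (\<bar>c\<bar> + 1)"
    using C0_space_approx[OF w] by metis
  obtain K where K: "compact K" "K \<subseteq> D" "\<forall>x. x \<notin> K \<longrightarrow> \<phi> x = 0" "continuous_on UNIV \<phi>"
    using \<phi>(1) unfolding compactly_supported_def by blast
  have "\<forall>x. x \<notin> K \<longrightarrow> c *\<^sub>R \<phi> x = 0" "continuous_on UNIV (\<lambda>x. c *\<^sub>R \<phi> x)"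
    using K by (simp_all add: continuous_on_scaleR)
  with K have "(\<lambda>x. c *\<^sub>R \<phi> x) \<in> compactly_supported D"
    unfolding compactly_supported_def by blast
  moreover have "norm (c *\<^sub>R w x - c *\<^sub>R \<phi> x) \<le> \<eta>" if "x \<in> D" for x
  proof -
    have "norm (c *\<^sub>R w x - c *\<^sub>R \<phi> x) = \<bar>c\<bar> * norm (w x - \<phi> x)"
      by (simp add: scaleR_diff_right[symmetric])
    also have "\<dots> \<le> (\<bar>c\<bar> + 1) * (\<eta> / (\<bar>c\<bar> + 1))"
      using \<phi>(2) that by (intro mult_mono) auto
    also have "\<dots> = \<eta>" by simp
    finally show ?thesis .
  qed
  ultimately show "\<exists>\<phi>\<in>compactly_supported D. \<forall>x\<in>D. norm (c *\<^sub>R w x - \<phi> x) \<le> \<eta>"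
    by (intro bexI[of _ "\<lambda>x. c *\<^sub>R \<phi> x"]) simp_all
qed

lemma holder0_space_add:
  fixes w z :: "'a::euclidean_space \<Rightarrow> 'b::real_normed_vector"
  assumes "open D" "D \<noteq> {}" "w \<in> holder0_space D \<gamma>" "z \<in> holder0_space D \<gamma>"
  shows "(\<lambda>x. w x + z x) \<in> holder0_space D \<gamma>"
  using assms by (auto simp: holder0_space_def intro: holder_space_add C0_space_add)

lemma holder0_space_scale:
  fixes w :: "'a::euclidean_space \<Rightarrow> 'b::real_normed_vector"
  assumes "open D" "D \<noteq> {}" "w \<in> holder0_space D \<gamma>"
  shows "(\<lambda>x. c *\<^sub>R w x) \<in> holder0_space D \<gamma>"
  using assms by (auto simp: holder0_space_def intro: holder_space_scale C0_space_scale)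

lemma holder0_space_diff:
  fixes w z :: "'a::euclidean_space \<Rightarrow> 'b::real_normed_vector"
  assumes "open D" "D \<noteq> {}" "w \<in> holder0_space D \<gamma>" "z \<in> holder0_space D \<gamma>"
  shows "(\<lambda>x. w x - z x) \<in> holder0_space D \<gamma>"
  using holder0_space_add[OF assms(1-3) holder0_space_scale[OF assms(1,2,4), of "-1"]] by simp

lemma holder0_norm_le:
  fixes w :: "'a::euclidean_space \<Rightarrow> 'b::real_normed_vector"
  assumes "open D" "D \<noteq> {}" "w \<in> holder0_space D \<gamma>"
  shows "norm (w x) \<le> holder_norm D \<gamma> w"
proof (cases "x \<in> D")
  case False
  then have "w x = 0" using assms by (auto simp: holder0_space_def C0_space_zero)
  then show ?thesis using holder_norm_nonneg[OF assms(1,2)] assms by (auto simp: holder0_space_def)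
qed (use norm_le_holder_norm[OF assms(1,2)] assms in \<open>auto simp: holder0_space_def\<close>)

lemma holder0_measurable:
  fixes w :: "'a::euclidean_space \<Rightarrow> 'b::euclidean_space"
  assumes "w \<in> holder0_space D \<gamma>"
  shows "w \<in> borel_measurable borel"
  using assms by (intro borel_measurable_continuous_onI C0_space_continuous) (auto simp: holder0_space_def)

text \<open>The zero extension keeps the Hoelder constant: a segment from \<open>D\<close> to its complement
  meets the frontier, where the continuous extension vanishes, and the Hoelder estimate on \<open>D\<close>
  extends to its closure.\<close>

lemma holder0_continuity:
  fixes w :: "'a::euclidean_space \<Rightarrow> 'b::real_normed_vector"
  assumes D: "open D" "D \<noteq> {}" and g: "0 < \<gamma>" and w: "w \<in> holder0_space D \<gamma>"
  shows "norm (w x - w y) \<le> holder_norm D \<gamma> w * dist x y powr \<gamma>"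
proof -
  let ?H = "holder_norm D \<gamma> w"
  have ws: "w \<in> holder_space D \<gamma>" and w0: "w \<in> C0_space D" using w by (auto simp: holder0_space_def)
  have H0: "0 \<le> ?H" by (rule holder_norm_nonneg[OF D ws])
  have out: "norm (w x) \<le> ?H * dist x y powr \<gamma>" if "x \<in> D" "y \<notin> D" for x y
  proof -
    have "closed_segment x y \<inter> frontier D \<noteq> {}"
      using that by (intro connected_Int_frontier) auto
    then obtain z where z: "z \<in> closed_segment x y" "z \<in> frontier D" by auto
    have "z \<notin> D" "z \<in> closure D" using z(2) D(1) by (auto simp: frontier_def interior_open)
    then have wz: "w z = 0" using w0 by (simp add: C0_space_zero)
    let ?S = "{p. norm (w x - w p) \<le> ?H * dist x p powr \<gamma>}"
    have "closed ?S" using g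
      by (intro closed_Collect_le continuous_intros C0_space_continuous[OF w0] continuous_on_powr') auto
    moreover have "D \<subseteq> ?S" using holder_norm_continuity[OF D ws] that(1) by auto
    ultimately have "z \<in> ?S" using \<open>z \<in> closure D\<close> closure_minimal by blast
    then have "norm (w x) \<le> ?H * dist x z powr \<gamma>" using wz by simp
    also have "\<dots> \<le> ?H * dist x y powr \<gamma>"
      using H0 g dist_in_closed_segment(1)[OF z(1)]
      by (intro mult_left_mono powr_mono2) (auto simp: dist_commute)
    finally show ?thesis .
  qed
  show ?thesis
  proof (cases "x \<in> D")
    case True
    then show ?thesis
    proof (cases "y \<in> D")
      case False
      then show ?thesis using out[OF True False] w0 by (simp add: C0_space_zero)
    qed (use holder_norm_continuity[OF D ws] in auto)
  next
    case False
    then have wx: "w x = 0" using w0 by (simp add: C0_space_zero)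
    show ?thesis
    proof (cases "y \<in> D")
      case True
      then show ?thesis using out[OF True False] wx by (simp add: dist_commute)
    next
      case y: False
      then have "w y = 0" using w0 by (simp add: C0_space_zero)
      then show ?thesis using H0 wx by simp
    qed
  qed
qed

subsection \<open>Time derivatives in the Hoelder norm\<close>

lemma holder_norm_bounded_on_interval:
  fixes w :: "real \<Rightarrow> 'a::euclidean_space \<Rightarrow> 'b::real_normed_vector"
  assumes D: "open D" "D \<noteq> {}" and w: "\<And>t. t \<in> {0..T} \<Longrightarrow> w t \<in> holder_space D \<gamma>"
    and lim: "\<And>t. t \<in> {0..T} \<Longrightarrow> ((\<lambda>s. holder_norm D \<gamma> (\<lambda>x. w s x - w t x)) \<longlongrightarrow> 0) (at t within {0..T})"
  shows "\<exists>B. \<forall>t\<in>{0..T}. holder_norm D \<gamma> (w t) \<le> B"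
proof -
  have "((\<lambda>s. holder_norm D \<gamma> (w s)) \<longlongrightarrow> holder_norm D \<gamma> (w t)) (at t within {0..T})"
    if t: "t \<in> {0..T}" for t
  proof (rule LIM_zero_cancel, rule Lim_null_comparison[OF _ lim[OF t]])
    have "norm (holder_norm D \<gamma> (w s) - holder_norm D \<gamma> (w t)) \<le> holder_norm D \<gamma> (\<lambda>x. w s x - w t x)"
      if s: "s \<in> {0..T}" for s
    proof -
      have d: "(\<lambda>x. w s x - w t x) \<in> holder_space D \<gamma>" using w[OF s] w[OF t] by (rule holder_space_diff[OF D])
      have "holder_norm D \<gamma> (w s) \<le> holder_norm D \<gamma> (\<lambda>x. w s x - w t x) + holder_norm D \<gamma> (w t)"
        using holder_norm_add_le[OF D d w[OF t]] by simp
      moreover have "holder_norm D \<gamma> (w t) \<le> holder_norm D \<gamma> (w s) + holder_norm D \<gamma> (\<lambda>x. w s x - w t x)"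
        using holder_norm_add_le[OF D w[OF s] holder_space_scale[OF D d, of "-1"]]
          holder_norm_scale_le[OF D d, of "-1"] by simp
      ultimately show ?thesis by simp
    qed
    then show "\<forall>\<^sub>F s in at t within {0..T}. norm (holder_norm D \<gamma> (w s) - holder_norm D \<gamma> (w t))
        \<le> holder_norm D \<gamma> (\<lambda>x. w s x - w t x)"
      by (auto simp: eventually_at_filter)
  qed
  then have "continuous_on {0..T} (\<lambda>s. holder_norm D \<gamma> (w s))" by (simp add: continuous_on_def)
  then have "bounded ((\<lambda>s. holder_norm D \<gamma> (w s)) ` {0..T})"
    by (intro compact_imp_bounded compact_continuous_image) auto
  then obtain B where "\<forall>t\<in>{0..T}. \<bar>holder_norm D \<gamma> (w t)\<bar> \<le> B" by (auto simp: bounded_iff)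
  then show ?thesis by (meson abs_ge_self order_trans)
qed

lemma holder_time_deriv_continuous:
  fixes w w1 :: "real \<Rightarrow> 'a::euclidean_space \<Rightarrow> 'b::real_normed_vector"
  assumes D: "open D" "D \<noteq> {}" and w: "\<And>t. t \<in> {0..T} \<Longrightarrow> w t \<in> holder_space D \<gamma>"
    "\<And>t. t \<in> {0..T} \<Longrightarrow> w1 t \<in> holder_space D \<gamma>"
    and d: "has_holder_time_deriv T D \<gamma> w w1" and t: "t \<in> {0..T}"
  shows "((\<lambda>s. holder_norm D \<gamma> (\<lambda>x. w s x - w t x)) \<longlongrightarrow> 0) (at t within {0..T})"
proof -
  let ?q = "\<lambda>s. holder_norm D \<gamma> (\<lambda>x. (w s x - w t x) /\<^sub>R (s - t) - w1 t x)"
  have lq: "(?q \<longlongrightarrow> 0) (at t within {0..T})" using d t by (auto simp: has_holder_time_deriv_def)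
  have "((\<lambda>s. \<bar>s - t\<bar> * (?q s + holder_norm D \<gamma> (w1 t))) \<longlongrightarrow> \<bar>t - t\<bar> * (0 + holder_norm D \<gamma> (w1 t)))
      (at t within {0..T})"
    by (intro tendsto_intros lq)
  then have lim: "((\<lambda>s. \<bar>s - t\<bar> * (?q s + holder_norm D \<gamma> (w1 t))) \<longlongrightarrow> 0) (at t within {0..T})" by simp
  have "norm (holder_norm D \<gamma> (\<lambda>x. w s x - w t x)) \<le> \<bar>s - t\<bar> * (?q s + holder_norm D \<gamma> (w1 t))"
    if s: "s \<in> {0..T}" "s \<noteq> t" for s
  proof -
    have h: "(\<lambda>x. w s x - w t x) \<in> holder_space D \<gamma>" using w s t by (intro holder_space_diff[OF D]) auto
    have h2: "(\<lambda>x. (w s x - w t x) /\<^sub>R (s - t) - w1 t x) \<in> holder_space D \<gamma>"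
      using w t by (intro holder_space_diff[OF D] holder_space_scale[OF D] h) auto
    have h3: "(\<lambda>x. ((w s x - w t x) /\<^sub>R (s - t) - w1 t x) + w1 t x) \<in> holder_space D \<gamma>"
      using w t by (intro holder_space_add[OF D] h2) auto
    have "(\<lambda>x. w s x - w t x) = (\<lambda>x. (s - t) *\<^sub>R (((w s x - w t x) /\<^sub>R (s - t) - w1 t x) + w1 t x))"
      using s by auto
    then have "holder_norm D \<gamma> (\<lambda>x. w s x - w t x) \<le>
      \<bar>s - t\<bar> * holder_norm D \<gamma> (\<lambda>x. ((w s x - w t x) /\<^sub>R (s - t) - w1 t x) + w1 t x)"
      using holder_norm_scale_le[OF D h3, of "s - t"] by simp
    also have "\<dots> \<le> \<bar>s - t\<bar> * (?q s + holder_norm D \<gamma> (w1 t))"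
      using w t by (intro mult_left_mono holder_norm_add_le[OF D] h2) auto
    finally show ?thesis using holder_norm_nonneg[OF D h] by simp
  qed
  then show ?thesis
    by (intro Lim_null_comparison[OF _ lim]) (auto simp: eventually_at_filter)
qed

text \<open>Averages over a cell, point values and moments against a test function are continuous
  linear functionals on the Hoelder space, so they commute with the time derivative.\<close>

lemma functional_has_vector_derivative:
  fixes w w1 :: "real \<Rightarrow> 'a::euclidean_space \<Rightarrow> 'b::real_normed_vector"
    and \<Lambda> :: "('a \<Rightarrow> 'b) \<Rightarrow> 'c::real_normed_vector"
  assumes D: "open D" "D \<noteq> {}" and w: "\<And>t. t \<in> {0..T} \<Longrightarrow> w t \<in> holder0_space D \<gamma>"
    "\<And>t. t \<in> {0..T} \<Longrightarrow> w1 t \<in> holder0_space D \<gamma>"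
    and d: "has_holder_time_deriv T D \<gamma> w w1" and t: "t \<in> {0..T}"
    and lin: "\<And>a p q r. p \<in> holder0_space D \<gamma> \<Longrightarrow> q \<in> holder0_space D \<gamma> \<Longrightarrow> r \<in> holder0_space D \<gamma> \<Longrightarrow>
        \<Lambda> (\<lambda>x. a *\<^sub>R (p x - q x) - r x) = a *\<^sub>R (\<Lambda> p - \<Lambda> q) - \<Lambda> r"
    and bd: "\<And>p. p \<in> holder0_space D \<gamma> \<Longrightarrow> norm (\<Lambda> p) \<le> C * holder_norm D \<gamma> p"
  shows "((\<lambda>s. \<Lambda> (w s)) has_vector_derivative \<Lambda> (w1 t)) (at t within {0..T})"
proof -
  let ?q = "\<lambda>s. holder_norm D \<gamma> (\<lambda>x. (w s x - w t x) /\<^sub>R (s - t) - w1 t x)"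
  have lq: "(?q \<longlongrightarrow> 0) (at t within {0..T})" using d t by (auto simp: has_holder_time_deriv_def)
  have "((\<lambda>s. (\<Lambda> (w s) - \<Lambda> (w t)) /\<^sub>R (s - t) - \<Lambda> (w1 t)) \<longlongrightarrow> 0) (at t within {0..T})"
  proof (rule Lim_null_comparison)
    show "((\<lambda>s. C * ?q s) \<longlongrightarrow> 0) (at t within {0..T})" using tendsto_mult_left[OF lq, of C] by simp
    have "norm ((\<Lambda> (w s) - \<Lambda> (w t)) /\<^sub>R (s - t) - \<Lambda> (w1 t)) \<le> C * ?q s" if s: "s \<in> {0..T}" for s
    proof -
      have "(\<lambda>x. (w s x - w t x) /\<^sub>R (s - t) - w1 t x) \<in> holder0_space D \<gamma>"
        using w s t by (intro holder0_space_diff holder0_space_scale D) auto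
      from bd[OF this] show ?thesis using w s t by (subst (asm) lin) auto
    qed
    then show "\<forall>\<^sub>F s in at t within {0..T}. norm ((\<Lambda> (w s) - \<Lambda> (w t)) /\<^sub>R (s - t) - \<Lambda> (w1 t)) \<le> C * ?q s"
      by (auto simp: eventually_at_filter)
  qed
  then have "((\<lambda>s. norm ((\<Lambda> (w s) - \<Lambda> (w t)) /\<^sub>R (s - t) - \<Lambda> (w1 t))) \<longlongrightarrow> 0) (at t within {0..T})"
    by (rule tendsto_norm_zero)
  moreover have "norm ((\<Lambda> (w s) - \<Lambda> (w t)) /\<^sub>R (s - t) - \<Lambda> (w1 t)) =
      norm ((\<Lambda> (w s) - \<Lambda> (w t)) - (s - t) *\<^sub>R \<Lambda> (w1 t)) / norm (s - t)" if "s \<noteq> t" for s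
  proof -
    have "(\<Lambda> (w s) - \<Lambda> (w t)) /\<^sub>R (s - t) - \<Lambda> (w1 t)
        = ((\<Lambda> (w s) - \<Lambda> (w t)) - (s - t) *\<^sub>R \<Lambda> (w1 t)) /\<^sub>R (s - t)"
      using that by (simp add: scaleR_diff_right)
    then show ?thesis by (simp add: divide_inverse mult.commute)
  qed
  ultimately have "((\<lambda>s. norm ((\<Lambda> (w s) - \<Lambda> (w t)) - (s - t) *\<^sub>R \<Lambda> (w1 t)) / norm (s - t)) \<longlongrightarrow> 0)
      (at t within {0..T})"
    by (simp cong: Lim_cong_within)
  then show ?thesis
    by (simp add: has_vector_derivative_def has_derivative_iff_norm bounded_linear_scaleR_left)
qed

section \<open>The L2 norm of bounded functions\<close>

text \<open>Solutions, projections and discrete fields are all of this kind; on a set of finite measure it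
  makes them and all their products integrable.\<close>

definition bounded_borel :: "('a::euclidean_space \<Rightarrow> 'b::euclidean_space) \<Rightarrow> bool"
  where "bounded_borel w \<longleftrightarrow> w \<in> borel_measurable borel \<and> (\<exists>C. \<forall>x. norm (w x) \<le> C)"

lemma bounded_borelI: "w \<in> borel_measurable borel \<Longrightarrow> (\<And>x. norm (w x) \<le> C) \<Longrightarrow> bounded_borel w"
  by (auto simp: bounded_borel_def)

lemma bounded_borel_measurable [measurable_dest]: "bounded_borel w \<Longrightarrow> w \<in> borel_measurable borel"
  by (auto simp: bounded_borel_def)

lemma bounded_borel_bound:
  assumes "bounded_borel w" obtains C where "0 \<le> C" "\<And>x. norm (w x) \<le> C"
  using assms unfolding bounded_borel_def by (meson norm_ge_zero order_trans)

lemma bounded_borel_add: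
  assumes "bounded_borel w" "bounded_borel z" shows "bounded_borel (\<lambda>x. w x + z x)"
proof -
  note [measurable] = assms[THEN bounded_borel_measurable]
  obtain C where C: "\<And>x. norm (w x) \<le> C" using bounded_borel_bound[OF assms(1)] by blast
  obtain E where E: "\<And>x. norm (z x) \<le> E" using bounded_borel_bound[OF assms(2)] by blast
  show ?thesis by (rule bounded_borelI[of _ "C + E"]) (measurable, meson C E norm_triangle_mono)
qed

lemma bounded_borel_scale:
  assumes "bounded_borel w" shows "bounded_borel (\<lambda>x. c *\<^sub>R w x)"
proof -
  note [measurable] = assms[THEN bounded_borel_measurable]
  obtain C where C: "\<And>x. norm (w x) \<le> C" using bounded_borel_bound[OF assms(1)] by blast
  show ?thesis by (rule bounded_borelI[of _ "\<bar>c\<bar> * C"]) (auto simp: C mult_left_mono)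
qed

lemma bounded_borel_diff:
  assumes "bounded_borel w" "bounded_borel z" shows "bounded_borel (\<lambda>x. w x - z x)"
  using bounded_borel_add[OF assms(1) bounded_borel_scale[OF assms(2), of "-1"]] by simp

lemma bounded_borel_inner:
  assumes "bounded_borel w" "bounded_borel z" shows "bounded_borel (\<lambda>x. w x \<bullet> z x)"
proof -
  note [measurable] = assms[THEN bounded_borel_measurable]
  obtain C where C: "0 \<le> C" "\<And>x. norm (w x) \<le> C" using bounded_borel_bound[OF assms(1)] by blast
  obtain E where E: "\<And>x. norm (z x) \<le> E" using bounded_borel_bound[OF assms(2)] by blast
  have "norm (w x \<bullet> z x) \<le> C * E" for x
    using Cauchy_Schwarz_ineq2[of "w x" "z x"] mult_mono[OF C(2) E C(1) norm_ge_zero, of x x]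
    by simp
  then show ?thesis by (intro bounded_borelI[of _ "C * E"]) measurable
qed

lemma bounded_borel_norm:
  assumes "bounded_borel w" shows "bounded_borel (\<lambda>x. norm (w x))"
proof -
  note [measurable] = assms[THEN bounded_borel_measurable]
  obtain C where C: "\<And>x. norm (w x) \<le> C" using bounded_borel_bound[OF assms(1)] by blast
  show ?thesis by (rule bounded_borelI[of _ C]) (auto simp: C)
qed

lemma bounded_borel_const: "bounded_borel (\<lambda>x. c)"
  by (rule bounded_borelI[of _ "norm c"]) auto

lemma bounded_borel_holder0:
  fixes w :: "'a::euclidean_space \<Rightarrow> 'b::euclidean_space"
  assumes "open D" "D \<noteq> {}" "w \<in> holder0_space D \<gamma>" shows "bounded_borel w"
  using holder0_measurable[OF assms(3)] holder0_norm_le[OF assms] by (rule bounded_borelI)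

lemma bounded_set_finite_measure:
  fixes A :: "'a::euclidean_space set"
  assumes "bounded A" shows "emeasure lborel A < \<infinity>"
  using assms emeasure_bounded_finite by blast

context
  fixes A :: "'a::euclidean_space set"
  assumes A [measurable]: "A \<in> sets borel" and finA: "emeasure lborel A < \<infinity>"
begin

lemma set_integrable_bounded:
  fixes f :: "'a \<Rightarrow> 'b::euclidean_space"
  assumes "f \<in> borel_measurable borel" "\<And>x. x \<in> A \<Longrightarrow> norm (f x) \<le> C"
  shows "set_integrable lborel A f"
  unfolding set_integrable_def
  using assms A finA by (intro integrableI_bounded_set_indicator[where B = C]) auto

lemma bounded_borel_set_integrable: "bounded_borel f \<Longrightarrow> set_integrable lborel A f"
  by (auto simp: bounded_borel_def intro: set_integrable_bounded)

lemma set_integral_nonneg':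
  fixes f :: "'a \<Rightarrow> real"
  assumes "\<And>x. x \<in> A \<Longrightarrow> 0 \<le> f x" shows "0 \<le> (LINT x:A|lborel. f x)"
  unfolding set_lebesgue_integral_def using assms by (intro Bochner_Integration.integral_nonneg) (auto simp: indicator_def)

lemma L2_norm_nonneg: "0 \<le> L2_norm A w"
  unfolding L2_norm_def by (intro real_sqrt_ge_zero set_integral_nonneg') simp

lemma L2_norm_power2: "(L2_norm A w)\<^sup>2 = (LINT x:A|lborel. w x \<bullet> w x)"
  unfolding L2_norm_def by (subst real_sqrt_pow2) (auto intro!: set_integral_nonneg' simp: power2_norm_eq_inner)

lemma L2_norm_mono:
  assumes z: "bounded_borel z" and w: "w \<in> borel_measurable borel"
    and "\<And>x. x \<in> A \<Longrightarrow> norm (w x) \<le> norm (z x)"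
  shows "L2_norm A w \<le> L2_norm A z"
  unfolding L2_norm_def
proof (intro real_sqrt_le_mono set_integral_mono)
  obtain C where C: "\<And>x. norm (z x) \<le> C" using bounded_borel_bound[OF z] by blast
  note [measurable] = w z[THEN bounded_borel_measurable]
  show "set_integrable lborel A (\<lambda>x. (norm (z x))\<^sup>2)"
    by (rule set_integrable_bounded[of _ "C\<^sup>2"]) (auto simp: C power_mono)
  show "set_integrable lborel A (\<lambda>x. (norm (w x))\<^sup>2)"
    by (rule set_integrable_bounded[of _ "C\<^sup>2"])
      (auto intro!: power_mono order_trans[OF assms(3)] simp: C)
qed (auto intro: power_mono assms(3))

lemma L2_norm_norm [simp]: "L2_norm A (\<lambda>x. norm (w x)) = L2_norm A w"
  by (simp add: L2_norm_def)

lemma L2_norm_scale: "L2_norm A (\<lambda>x. c *\<^sub>R w x) = \<bar>c\<bar> * L2_norm A w"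
proof -
  have "(LINT x:A|lborel. (norm (c *\<^sub>R w x))\<^sup>2) = c\<^sup>2 * (LINT x:A|lborel. (norm (w x))\<^sup>2)"
    by (simp add: power_mult_distrib)
  then show ?thesis by (simp add: L2_norm_def real_sqrt_mult)
qed

lemma L2_norm_const: "L2_norm A (\<lambda>x. c) = sqrt (measure lborel A) * norm c"
  using finA by (simp add: L2_norm_def set_integral_const real_sqrt_mult)

lemma L2_norm_le_const:
  assumes "w \<in> borel_measurable borel" "\<And>x. x \<in> A \<Longrightarrow> norm (w x) \<le> c" "0 \<le> c"
  shows "L2_norm A w \<le> sqrt (measure lborel A) * c"
proof -
  have "L2_norm A w \<le> L2_norm A (\<lambda>x. c)"
    using assms by (intro L2_norm_mono bounded_borel_const) auto
  then show ?thesis using assms(3) by (simp add: L2_norm_const)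
qed

lemma L2_Cauchy_Schwarz:
  fixes a b :: "'a \<Rightarrow> 'b::euclidean_space"
  assumes a: "bounded_borel a" and b: "bounded_borel b"
  shows "\<bar>LINT x:A|lborel. a x \<bullet> b x\<bar> \<le> L2_norm A a * L2_norm A b"
proof -
  let ?p = "(L2_norm A a)\<^sup>2" and ?q = "(L2_norm A b)\<^sup>2" and ?I = "LINT x:A|lborel. a x \<bullet> b x"
  have i: "set_integrable lborel A (\<lambda>x. a x \<bullet> a x)" "set_integrable lborel A (\<lambda>x. a x \<bullet> b x)"
    "set_integrable lborel A (\<lambda>x. b x \<bullet> b x)"
    by (intro bounded_borel_set_integrable bounded_borel_inner a b)+
  have quad: "0 \<le> ?p - 2 * s * ?I + s\<^sup>2 * ?q" for s
  proof -
    have "0 \<le> (LINT x:A|lborel. (a x - s *\<^sub>R b x) \<bullet> (a x - s *\<^sub>R b x))"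
      by (intro set_integral_nonneg') simp
    also have "\<dots> = (LINT x:A|lborel. (a x \<bullet> a x - 2 * s * (a x \<bullet> b x)) + s\<^sup>2 * (b x \<bullet> b x))"
      by (intro set_lebesgue_integral_cong)
        (auto simp: inner_diff_left inner_diff_right inner_commute power2_eq_square)
    also have "\<dots> = ?p - 2 * s * ?I + s\<^sup>2 * ?q"
      using i by (simp add: L2_norm_power2)
    finally show ?thesis .
  qed
  have "?I\<^sup>2 \<le> ?p * ?q"
  proof (cases "?q = 0")
    case True
    show ?thesis
    proof (cases "?I = 0")
      case False
      \<comment> \<open>The quadratic polynomial is now linear in \<open>s\<close>, and this choice gives it the value -1.\<close>
      then show ?thesis using quad[of "(?p + 1) / (2 * ?I)"] True by simp
    qed (simp add: True)
  next
    case False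
    then have q: "0 < ?q" by simp
    \<comment> \<open>The minimum of the quadratic polynomial is attained at \<open>?I / ?q\<close>.\<close>
    have "(?I / ?q)\<^sup>2 * ?q = ?I\<^sup>2 / ?q" using False by (simp only: power2_eq_square) simp
    then have "0 \<le> ?p - ?I\<^sup>2 / ?q"
      using quad[of "?I / ?q"] by (simp add: power2_eq_square)
    then show ?thesis using q by (simp add: pos_divide_le_eq)
  qed
  then have "\<bar>?I\<bar>\<^sup>2 \<le> (L2_norm A a * L2_norm A b)\<^sup>2" by (simp add: power_mult_distrib)
  then show ?thesis by (rule power2_le_imp_le) (simp add: L2_norm_nonneg)
qed

lemma L2_norm_triangle:
  fixes a b :: "'a \<Rightarrow> 'b::euclidean_space"
  assumes a: "bounded_borel a" and b: "bounded_borel b"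
  shows "L2_norm A (\<lambda>x. a x + b x) \<le> L2_norm A a + L2_norm A b"
proof -
  have i: "set_integrable lborel A (\<lambda>x. a x \<bullet> a x)" "set_integrable lborel A (\<lambda>x. a x \<bullet> b x)"
    "set_integrable lborel A (\<lambda>x. b x \<bullet> b x)"
    by (intro bounded_borel_set_integrable bounded_borel_inner a b)+
  have "(L2_norm A (\<lambda>x. a x + b x))\<^sup>2 = (LINT x:A|lborel. (a x \<bullet> a x + 2 * (a x \<bullet> b x)) + b x \<bullet> b x)"
    unfolding L2_norm_power2
    by (intro set_lebesgue_integral_cong) (auto simp: inner_add_left inner_add_right inner_commute)
  also have "\<dots> = (L2_norm A a)\<^sup>2 + 2 * (LINT x:A|lborel. a x \<bullet> b x) + (L2_norm A b)\<^sup>2"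
    using i by (simp add: L2_norm_power2)
  also have "\<dots> \<le> (L2_norm A a)\<^sup>2 + 2 * (L2_norm A a * L2_norm A b) + (L2_norm A b)\<^sup>2"
    using L2_Cauchy_Schwarz[OF a b] by simp
  also have "\<dots> = (L2_norm A a + L2_norm A b)\<^sup>2" by (simp add: power2_sum)
  finally show ?thesis by (rule power2_le_imp_le) (simp add: L2_norm_nonneg)
qed

lemma L1_le_L2_norm:
  assumes "bounded_borel w"
  shows "(LINT x:A|lborel. norm (w x)) \<le> sqrt (measure lborel A) * L2_norm A w"
  using L2_Cauchy_Schwarz[OF bounded_borel_norm[OF assms] bounded_borel_const[of 1]]
  by (simp add: L2_norm_const mult.commute)

end

section \<open>The weakly singular kernel\<close>

text \<open>Dyadic decomposition: the kernel is of size \<open>2 ^ n\<close> on a ball of volume comparable to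
  \<open>2 ^ (- n * d)\<close>, so the contributions decay geometrically once \<open>d \<ge> 2\<close>.\<close>

lemma inverse_norm_integrable_ball:
  assumes dim: "2 \<le> DIM('a::euclidean_space)"
  shows "(\<integral>\<^sup>+z\<in>ball (0::'a) 1. ennreal (1 / norm z) \<partial>lborel) < \<infinity>"
proof -
  let ?B = "\<lambda>n::nat. ball (0::'a) ((1/2)^n)"
  define V where "V = unit_ball_vol (real DIM('a))"
  have V0: "0 \<le> V" by (simp add: V_def)
  have [measurable]: "?B n \<in> sets borel" for n by simp
  have cover: "ennreal (1 / norm z) * indicator (ball 0 1) z \<le>
      (\<Sum>n. ennreal (2 * 2 ^ n) * indicator (?B n) z)" for z :: 'a
  proof (cases "z \<in> ball 0 1 \<and> z \<noteq> 0")
    case True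
    define n where "n = (LEAST m. (1/2::real)^Suc m \<le> norm z)"
    have "\<exists>m. (1/2::real)^m < norm z" using True by (intro real_arch_pow_inv) auto
    then obtain m where "(1/2::real)^m < norm z" by blast
    moreover have "(1/2::real) ^ Suc m \<le> (1/2) ^ m" by (simp add: power_decreasing)
    ultimately have ex: "(1/2::real)^Suc m \<le> norm z" by linarith
    have n1: "(1/2::real)^Suc n \<le> norm z" unfolding n_def by (rule LeastI[of _ m]) (rule ex)
    have n2: "norm z < (1/2)^n"
    proof (cases n)
      case (Suc k)
      then have "\<not> (1/2::real)^Suc k \<le> norm z" unfolding n_def by (intro not_less_Least) simp
      then show ?thesis using Suc by simp
    qed (use True in auto)
    have "1 / norm z \<le> 1 / (1/2::real)^Suc n" using n1 True by (intro divide_left_mono) auto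
    also have "\<dots> = 2 * 2 ^ n" by (simp add: power_divide)
    finally have "ennreal (1 / norm z) * indicator (ball 0 1) z \<le> ennreal (2 * 2 ^ n) * indicator (?B n) z"
      using True n2 by (simp add: ennreal_leI)
    also have "\<dots> = (\<Sum>i\<in>{n}. ennreal (2 * 2 ^ i) * indicator (?B i) z)"
      by (simp only: sum.insert sum.empty finite.emptyI empty_iff not_False_eq_True add_0_right)
    also have "\<dots> \<le> (\<Sum>i. ennreal (2 * 2 ^ i) * indicator (?B i) z)"
      by (intro sum_le_suminf) auto
    finally show ?thesis .
  qed auto
  have "(\<integral>\<^sup>+z\<in>ball (0::'a) 1. ennreal (1 / norm z) \<partial>lborel)
     \<le> (\<integral>\<^sup>+z. (\<Sum>n. ennreal (2 * 2 ^ n) * indicator (?B n) z) \<partial>lborel)"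
    by (intro nn_integral_mono cover)
  also have "\<dots> = (\<Sum>n. ennreal (2 * 2 ^ n) * emeasure lborel (?B n))"
    by (subst nn_integral_suminf) (auto simp: nn_integral_cmult_indicator)
  also have "\<dots> \<le> (\<Sum>n. ennreal (2 * V * (1/2) ^ n))"
  proof (intro suminf_le)
    fix n
    have "((1/2::real) ^ n) ^ DIM('a) \<le> ((1/2) ^ n) ^ 2"
      using dim by (intro power_decreasing power_le_one) auto
    then have "2 * 2 ^ n * (V * ((1/2::real) ^ n) ^ DIM('a)) \<le> 2 * 2 ^ n * (V * ((1/2) ^ n) ^ 2)"
      using V0 by (intro mult_left_mono) auto
    also have "\<dots> = 2 * V * (1/2) ^ n" by (simp add: power2_eq_square power_divide field_simps)
    finally show "ennreal (2 * 2 ^ n) * emeasure lborel (?B n) \<le> ennreal (2 * V * (1/2) ^ n)"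
      using V0 by (simp add: emeasure_ball V_def[symmetric] ennreal_mult[symmetric] ennreal_leI)
  qed auto
  also have "\<dots> < \<infinity>"
    using V0 by (subst suminf_ennreal2) (auto intro!: summable_mult summable_geometric)
  finally show ?thesis .
qed

lemma nn_integral_lborel_translate:
  fixes f :: "'a::euclidean_space \<Rightarrow> ennreal"
  assumes [measurable]: "f \<in> borel_measurable borel"
  shows "(\<integral>\<^sup>+y. f y \<partial>lborel) = (\<integral>\<^sup>+z. f (x + z) \<partial>lborel)"
proof -
  have "(\<integral>\<^sup>+y. f y \<partial>lborel) = (\<integral>\<^sup>+y. f y \<partial>distr lborel borel ((+) x))"
    by (simp add: lborel_distr_plus)
  then show ?thesis by (simp add: nn_integral_distr)
qed

text \<open>With the nonnegative integral the bound also asserts integrability of the kernel.\<close>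

definition kernel_bound :: "'a::euclidean_space set \<Rightarrow> real \<Rightarrow> bool" where
  "kernel_bound D \<kappa> \<longleftrightarrow> 0 \<le> \<kappa> \<and> (\<forall>x. (\<integral>\<^sup>+y\<in>D. ennreal (1 / norm (x - y)) \<partial>lborel) \<le> ennreal \<kappa>)"

text \<open>The kernel is at most one outside the unit ball around \<open>x\<close>, and inside that ball its mass
  does not depend on \<open>x\<close>.\<close>

lemma kernel_bound_exists:
  fixes D :: "'a::euclidean_space set"
  assumes dim: "2 \<le> DIM('a)" and D [measurable]: "D \<in> sets borel" and b: "bounded D"
  obtains \<kappa> where "kernel_bound D \<kappa>"
proof -
  let ?K = "(\<integral>\<^sup>+z\<in>ball (0::'a) 1. ennreal (1 / norm z) \<partial>lborel)"
  define \<kappa> where "\<kappa> = enn2real (emeasure lborel D + ?K)"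
  have fin: "emeasure lborel D + ?K < \<infinity>"
    using inverse_norm_integrable_ball[OF dim] bounded_set_finite_measure[OF b] by simp
  have "(\<integral>\<^sup>+y\<in>D. ennreal (1 / norm (x - y)) \<partial>lborel) \<le> ennreal \<kappa>" for x
  proof -
    have [measurable]: "ball x 1 \<in> sets borel" by simp
    have pt: "ennreal (1 / norm (x - y)) * indicator D y \<le>
        indicator D y + ennreal (1 / norm (x - y)) * indicator (ball x 1) y" for y
    proof (cases "y \<in> ball x 1")
      case False
      then have "1 \<le> norm (x - y)" by (simp add: dist_norm)
      then have "1 / norm (x - y) \<le> 1" by (simp add: divide_simps)
      then have "ennreal (1 / norm (x - y)) \<le> 1" by (metis ennreal_1 ennreal_leI)
      then show ?thesis by (auto simp: indicator_def)
    qed (auto simp: indicator_def)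
    have "(\<integral>\<^sup>+y\<in>D. ennreal (1 / norm (x - y)) \<partial>lborel) \<le>
       (\<integral>\<^sup>+y. indicator D y + ennreal (1 / norm (x - y)) * indicator (ball x 1) y \<partial>lborel)"
      by (intro nn_integral_mono pt)
    also have "\<dots> = emeasure lborel D + (\<integral>\<^sup>+y. ennreal (1 / norm (x - y)) * indicator (ball x 1) y \<partial>lborel)"
      by (subst nn_integral_add) auto
    also have "(\<integral>\<^sup>+y. ennreal (1 / norm (x - y)) * indicator (ball x 1) y \<partial>lborel) = ?K"
      by (subst nn_integral_lborel_translate[of _ x]) (auto intro!: nn_integral_cong simp: indicator_def dist_norm)
    also have "emeasure lborel D + ?K = ennreal \<kappa>" using fin by (simp add: \<kappa>_def less_top)
    finally show ?thesis .
  qed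
  then have "kernel_bound D \<kappa>" by (simp add: kernel_bound_def \<kappa>_def)
  then show thesis by (rule that)
qed

text \<open>Up to normalization, the Riesz potential of order \<open>d - 1\<close> of the norm of \<open>e\<close> restricted to \<open>D\<close>.\<close>

definition riesz_potential :: "'a::euclidean_space set \<Rightarrow> ('a \<Rightarrow> 'b::euclidean_space) \<Rightarrow> 'a \<Rightarrow> real" where
  "riesz_potential D e x = (LINT y:D|lborel. norm (e y) / norm (x - y))"

context
  fixes D :: "'a::euclidean_space set" and \<kappa> :: real
  assumes D [measurable]: "D \<in> sets borel" and finD: "emeasure lborel D < \<infinity>"
    and k: "kernel_bound D \<kappa>"
begin

lemma kernel_set_integrable: "set_integrable lborel D (\<lambda>y. 1 / norm (x - y))"
  unfolding set_integrable_def
proof (rule integrableI_bounded)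
  have "(\<integral>\<^sup>+ y. ennreal (norm (indicator D y *\<^sub>R (1 / norm (x - y)))) \<partial>lborel)
     = (\<integral>\<^sup>+y\<in>D. ennreal (1 / norm (x - y)) \<partial>lborel)"
    by (intro nn_integral_cong) (auto simp: indicator_def)
  also have "\<dots> \<le> ennreal \<kappa>" using k by (simp add: kernel_bound_def)
  also have "\<dots> < \<infinity>" by simp
  finally show "(\<integral>\<^sup>+ y. ennreal (norm (indicator D y *\<^sub>R (1 / norm (x - y)))) \<partial>lborel) < \<infinity>" .
qed auto

lemma kernel_integral_le: "(LINT y:D|lborel. 1 / norm (x - y)) \<le> \<kappa>"
proof -
  have "ennreal (LINT y:D|lborel. 1 / norm (x - y)) = (\<integral>\<^sup>+y. ennreal (indicator D y *\<^sub>R (1 / norm (x - y))) \<partial>lborel)"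
    unfolding set_lebesgue_integral_def using kernel_set_integrable[of x, unfolded set_integrable_def]
    by (subst nn_integral_eq_integral) auto
  also have "\<dots> = (\<integral>\<^sup>+y\<in>D. ennreal (1 / norm (x - y)) \<partial>lborel)"
    by (intro nn_integral_cong) (auto simp: indicator_def)
  also have "\<dots> \<le> ennreal \<kappa>" using k by (simp add: kernel_bound_def)
  finally show ?thesis using k by (simp add: ennreal_le_iff kernel_bound_def)
qed

lemma riesz_set_integrable:
  assumes [measurable]: "e \<in> borel_measurable borel" and "\<And>y. y \<in> D \<Longrightarrow> norm (e y) \<le> \<eta>"
  shows "set_integrable lborel D (\<lambda>y. norm (e y) / norm (x - y))"
proof (rule set_integrable_bound)
  show "set_integrable lborel D (\<lambda>y. \<eta> * (1 / norm (x - y)))"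
    by (intro set_integrable_mult_right kernel_set_integrable)
  show "AE y in lborel. y \<in> D \<longrightarrow> norm (norm (e y) / norm (x - y)) \<le> norm (\<eta> * (1 / norm (x - y)))"
    using assms(2) by (intro AE_I2) (auto intro!: divide_right_mono order_trans[OF _ abs_ge_self])
qed (auto simp: set_borel_measurable_def)

lemma riesz_nonneg: "0 \<le> riesz_potential D e x"
  unfolding riesz_potential_def using D finD by (intro set_integral_nonneg') auto

lemma riesz_le:
  assumes "e \<in> borel_measurable borel" and "\<And>y. y \<in> D \<Longrightarrow> norm (e y) \<le> \<eta>" "0 \<le> \<eta>"
  shows "riesz_potential D e x \<le> \<kappa> * \<eta>"
proof -
  have "riesz_potential D e x \<le> (LINT y:D|lborel. \<eta> * (1 / norm (x - y)))"
    unfolding riesz_potential_def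
    by (intro set_integral_mono riesz_set_integrable[OF assms(1,2)] set_integrable_mult_right kernel_set_integrable)
      (auto intro!: divide_right_mono assms)
  also have "\<dots> = \<eta> * (LINT y:D|lborel. 1 / norm (x - y))" by (rule set_integral_mult_right)
  also have "\<dots> \<le> \<eta> * \<kappa>" by (intro mult_left_mono kernel_integral_le assms)
  finally show ?thesis by (simp add: mult.commute)
qed

lemma riesz_bounded_borel:
  assumes e: "bounded_borel e" shows "bounded_borel (riesz_potential D e)"
proof -
  note [measurable] = e[THEN bounded_borel_measurable]
  obtain C where C: "0 \<le> C" "\<And>x. norm (e x) \<le> C" using bounded_borel_bound[OF e] by blast
  have "(\<lambda>x. riesz_potential D e x) \<in> borel_measurable borel"
    unfolding riesz_potential_def set_lebesgue_integral_def by measurable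
  moreover have "norm (riesz_potential D e x) \<le> \<kappa> * C" for x
    using riesz_le[of e C x] riesz_nonneg[of e x] C by auto
  ultimately show ?thesis by (rule bounded_borelI)
qed

text \<open>Schur's test: Cauchy--Schwarz against the measure with density the kernel, followed by
  Tonelli, uses the bound on the kernel mass once in each variable.\<close>

lemma riesz_L2_bound:
  assumes e: "bounded_borel e"
  shows "L2_norm D (riesz_potential D e) \<le> \<kappa> * L2_norm D e"
proof -
  note [measurable] = e[THEN bounded_borel_measurable] riesz_bounded_borel[OF e, THEN bounded_borel_measurable]
  obtain C where C: "0 \<le> C" "\<And>x. norm (e x) \<le> C" using bounded_borel_bound[OF e] by blast
  have k0: "0 \<le> \<kappa>" and kk: "\<And>x. (\<integral>\<^sup>+y\<in>D. ennreal (1 / norm (x - y)) \<partial>lborel) \<le> ennreal \<kappa>"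
    using k by (auto simp: kernel_bound_def)
  let ?k = "\<lambda>x y. ennreal (1 / norm (x - y)) * indicator D y"
  have one: "ennreal ((riesz_potential D e x)\<^sup>2) \<le> ennreal \<kappa> * (\<integral>\<^sup>+y. ?k x y * ennreal ((norm (e y))\<^sup>2) \<partial>lborel)" for x
  proof -
    let ?f = "\<lambda>y. ennreal (sqrt (1 / norm (x - y))) * indicator D y"
    let ?g = "\<lambda>y. ennreal (sqrt (1 / norm (x - y)) * norm (e y)) * indicator D y"
    have "ennreal (riesz_potential D e x) = (\<integral>\<^sup>+y. ennreal (indicator D y *\<^sub>R (norm (e y) / norm (x - y))) \<partial>lborel)"
      unfolding riesz_potential_def set_lebesgue_integral_def
      using riesz_set_integrable[of e C x, unfolded set_integrable_def] C(2)
      by (subst nn_integral_eq_integral) auto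
    also have "\<dots> = (\<integral>\<^sup>+y. ?f y * ?g y \<partial>lborel)"
      by (intro nn_integral_cong) (auto simp: indicator_def ennreal_mult[symmetric] real_sqrt_divide field_simps)
    finally have "(ennreal (riesz_potential D e x))\<^sup>2 = (\<integral>\<^sup>+y. ?f y * ?g y \<partial>lborel)\<^sup>2" by simp
    also have "\<dots> \<le> (\<integral>\<^sup>+y. (?f y)\<^sup>2 \<partial>lborel) * (\<integral>\<^sup>+y. (?g y)\<^sup>2 \<partial>lborel)"
      by (rule Cauchy_Schwarz_nn_integral) measurable
    also have "(\<integral>\<^sup>+y. (?f y)\<^sup>2 \<partial>lborel) = (\<integral>\<^sup>+y\<in>D. ennreal (1 / norm (x - y)) \<partial>lborel)"
      by (intro nn_integral_cong) (auto simp: indicator_def ennreal_power)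
    also have "(\<integral>\<^sup>+y. (?g y)\<^sup>2 \<partial>lborel) = (\<integral>\<^sup>+y. ?k x y * ennreal ((norm (e y))\<^sup>2) \<partial>lborel)"
      by (intro nn_integral_cong)
        (auto simp: indicator_def ennreal_power power_mult_distrib power_divide ennreal_mult[symmetric])
    finally show ?thesis using kk[of x] riesz_nonneg[of e x]
      by (simp add: ennreal_power) (meson mult_right_mono order_trans zero_le)
  qed
  have "(\<integral>\<^sup>+x\<in>D. ennreal ((riesz_potential D e x)\<^sup>2) \<partial>lborel) \<le>
      (\<integral>\<^sup>+x. ennreal \<kappa> * (\<integral>\<^sup>+y. ?k x y * ennreal ((norm (e y))\<^sup>2) * indicator D x \<partial>lborel) \<partial>lborel)"
  proof (intro nn_integral_mono)
    fix x
    show "ennreal ((riesz_potential D e x)\<^sup>2) * indicator D x \<le>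
       ennreal \<kappa> * (\<integral>\<^sup>+y. ?k x y * ennreal ((norm (e y))\<^sup>2) * indicator D x \<partial>lborel)"
      using one[of x] by (cases "x \<in> D") auto
  qed
  also have "\<dots> = ennreal \<kappa> * (\<integral>\<^sup>+x. (\<integral>\<^sup>+y. ?k x y * ennreal ((norm (e y))\<^sup>2) * indicator D x \<partial>lborel) \<partial>lborel)"
    by (rule nn_integral_cmult) measurable
  also have "(\<integral>\<^sup>+x. (\<integral>\<^sup>+y. ?k x y * ennreal ((norm (e y))\<^sup>2) * indicator D x \<partial>lborel) \<partial>lborel)
     = (\<integral>\<^sup>+y. (\<integral>\<^sup>+x. ?k x y * ennreal ((norm (e y))\<^sup>2) * indicator D x \<partial>lborel) \<partial>lborel)"
    by (rule lborel_pair.Fubini'[symmetric]) measurable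
  also have "\<dots> = (\<integral>\<^sup>+y. ennreal ((norm (e y))\<^sup>2) * indicator D y * (\<integral>\<^sup>+x\<in>D. ennreal (1 / norm (y - x)) \<partial>lborel) \<partial>lborel)"
    by (intro nn_integral_cong, subst nn_integral_cmult[symmetric])
      (auto intro!: nn_integral_cong simp: mult_ac norm_minus_commute)
  also have "\<dots> \<le> (\<integral>\<^sup>+y. ennreal ((norm (e y))\<^sup>2) * indicator D y * ennreal \<kappa> \<partial>lborel)"
    by (intro nn_integral_mono mult_left_mono kk) simp
  also have "\<dots> = (\<integral>\<^sup>+y\<in>D. ennreal ((norm (e y))\<^sup>2) \<partial>lborel) * ennreal \<kappa>"
    by (rule nn_integral_multc) measurable
  finally have le: "(\<integral>\<^sup>+x\<in>D. ennreal ((riesz_potential D e x)\<^sup>2) \<partial>lborel) \<le>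
      ennreal \<kappa> * ((\<integral>\<^sup>+y\<in>D. ennreal ((norm (e y))\<^sup>2) \<partial>lborel) * ennreal \<kappa>)"
    by (simp add: mult_left_mono)
  have conv: "(\<integral>\<^sup>+y\<in>D. ennreal ((norm (w y))\<^sup>2) \<partial>lborel) = ennreal ((L2_norm D w)\<^sup>2)"
    if w: "bounded_borel w" for w :: "'a \<Rightarrow> 'c::euclidean_space"
  proof -
    have i: "set_integrable lborel D (\<lambda>x. w x \<bullet> w x)"
      by (intro bounded_borel_set_integrable[OF D finD] bounded_borel_inner w)
    have "(\<integral>\<^sup>+y\<in>D. ennreal ((norm (w y))\<^sup>2) \<partial>lborel) = (\<integral>\<^sup>+y. ennreal (indicator D y *\<^sub>R (w y \<bullet> w y)) \<partial>lborel)"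
      by (intro nn_integral_cong) (auto simp: indicator_def power2_norm_eq_inner)
    also have "\<dots> = ennreal ((L2_norm D w)\<^sup>2)"
      using i unfolding L2_norm_power2[OF D finD] set_lebesgue_integral_def set_integrable_def
      by (subst nn_integral_eq_integral) auto
    finally show ?thesis .
  qed
  have "ennreal ((L2_norm D (riesz_potential D e))\<^sup>2) \<le> ennreal (\<kappa> * ((L2_norm D e)\<^sup>2 * \<kappa>))"
    using le conv[OF riesz_bounded_borel[OF e]] conv[OF e] k0 riesz_nonneg
    by (simp add: ennreal_mult[symmetric])
  then have "(L2_norm D (riesz_potential D e))\<^sup>2 \<le> (\<kappa> * L2_norm D e)\<^sup>2"
    using k0 by (subst (asm) ennreal_le_iff) (auto simp: power_mult_distrib power2_eq_square mult_ac)
  then show ?thesis by (rule power2_le_imp_le) (simp add: k0 L2_norm_nonneg[OF D finD])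
qed

end

section \<open>Cells, piecewise constant functions and averages\<close>

definition cell_index :: "real \<Rightarrow> real^'n \<Rightarrow> int^'n" where
  "cell_index h x = (\<chi> j. \<lfloor>x $ j / h + 1 / 2\<rfloor>)"

text \<open>The cells are half-open, so rounding each coordinate of \<open>x / h\<close> picks exactly one of them.\<close>

lemma mem_cell_iff:
  assumes "0 < h" shows "x \<in> cell h i \<longleftrightarrow> i = cell_index h x"
proof -
  have "grid h i $ j - h / 2 \<le> x $ j \<and> x $ j < grid h i $ j + h / 2 \<longleftrightarrow> i $ j = \<lfloor>x $ j / h + 1 / 2\<rfloor>" for j
  proof -
    have "i $ j = \<lfloor>x $ j / h + 1 / 2\<rfloor> \<longleftrightarrow> real_of_int (i $ j) \<le> x $ j / h + 1 / 2 \<and> x $ j / h + 1 / 2 < real_of_int (i $ j) + 1"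
      by (metis floor_eq_iff)
    also have "\<dots> \<longleftrightarrow> real_of_int (i $ j) - 1/2 \<le> x $ j / h \<and> x $ j / h < real_of_int (i $ j) + 1/2"
      by linarith
    also have "\<dots> \<longleftrightarrow> (real_of_int (i $ j) - 1/2) * h \<le> x $ j \<and> x $ j < (real_of_int (i $ j) + 1/2) * h"
      using assms by (simp add: pos_le_divide_eq pos_divide_less_eq)
    also have "\<dots> \<longleftrightarrow> grid h i $ j - h / 2 \<le> x $ j \<and> x $ j < grid h i $ j + h / 2"
      by (simp add: grid_def algebra_simps)
    finally show ?thesis by simp
  qed
  then show ?thesis by (simp add: cell_def cell_index_def vec_eq_iff)
qed

lemma grid_mem_cell: "0 < h \<Longrightarrow> grid h i \<in> cell h i"
  by (simp add: cell_def)

lemma finite_grid: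
  fixes D :: "(real^'n) set"
  assumes "bounded D" "0 < h"
  shows "finite {i. grid h i \<in> D}"
proof -
  obtain B where B: "\<And>x. x \<in> D \<Longrightarrow> norm x \<le> B" using assms(1) by (auto simp: bounded_iff)
  let ?S = "{- \<lceil>B / h\<rceil>..\<lceil>B / h\<rceil>}"
  have "{i. grid h i \<in> D} \<subseteq> vec_lambda ` (PiE UNIV (\<lambda>_. ?S))"
  proof
    fix i :: "int^'n" assume "i \<in> {i. grid h i \<in> D}"
    then have n: "norm (grid h i) \<le> B" using B by auto
    have "i $ j \<in> ?S" for j
    proof -
      have "\<bar>grid h i $ j\<bar> \<le> B" using n component_le_norm_cart[of "grid h i" j] by linarith
      then have "h * \<bar>real_of_int (i $ j)\<bar> \<le> B" using assms(2) by (simp add: grid_def abs_mult)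
      then have "\<bar>real_of_int (i $ j)\<bar> \<le> B / h" using assms(2) by (simp add: field_simps)
      then show ?thesis by (simp add: abs_le_iff) linarith
    qed
    then show "i \<in> vec_lambda ` (PiE UNIV (\<lambda>_. ?S))"
      by (intro image_eqI[of _ _ "vec_nth i"]) (auto simp: vec_nth_inverse)
  qed
  moreover have "finite (vec_lambda ` (PiE UNIV (\<lambda>_. ?S)) :: (int^'n) set)"
    by (intro finite_imageI finite_PiE) auto
  ultimately show ?thesis by (rule finite_subset)
qed

lemma pw_const_eq:
  fixes D :: "(real^'n) set"
  assumes "bounded D" "0 < h"
  shows "pw_const D h w x = (if grid h (cell_index h x) \<in> D then w (cell_index h x) else 0)"
proof -
  have "pw_const D h w x = (\<Sum>i | grid h i \<in> D. if i = cell_index h x then w i else 0)"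
    unfolding pw_const_def using assms(2) by (intro sum.cong refl) (simp add: mem_cell_iff indicator_def)
  then show ?thesis using finite_grid[OF assms] by (simp add: sum.delta)
qed

lemma pw_const_in_cell:
  fixes D :: "(real^'n) set"
  assumes "bounded D" "0 < h" "x \<in> cell h i"
  shows "pw_const D h w x = (if grid h i \<in> D then w i else 0)"
  using assms by (simp add: pw_const_eq mem_cell_iff)

lemma pw_const_grid:
  fixes D :: "(real^'n) set"
  assumes "bounded D" "0 < h" "grid h i \<in> D"
  shows "pw_const D h w (grid h i) = w i"
  using pw_const_in_cell[OF assms(1,2) grid_mem_cell[OF assms(2)]] assms(3) by auto

lemma cell_borel [measurable]: "cell h i \<in> sets borel"
proof -
  have "cell h i = (\<Inter>j. {x. grid h i $ j - h / 2 \<le> x $ j} \<inter> {x. x $ j < grid h i $ j + h / 2})"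
    by (auto simp: cell_def)
  also have "\<dots> \<in> sets borel"
    by (intro sets.finite_INT sets.Int borel_closed borel_open closed_Collect_le open_Collect_less
        continuous_intros) auto
  finally show ?thesis .
qed

lemma emeasure_cell:
  fixes i :: "int^'n"
  assumes "0 < h" shows "emeasure lborel (cell h i) = ennreal (h ^ CARD('n))"
proof -
  let ?l = "\<chi> j. grid h i $ j - h / 2" and ?u = "\<chi> j. grid h i $ j + h / 2"
  have d: "(?u - ?l) \<bullet> b = h" if "b \<in> Basis" for b
    using that by (auto simp: Basis_vec_def inner_axis)
  have le: "\<And>b. b \<in> Basis \<Longrightarrow> ?l \<bullet> b \<le> ?u \<bullet> b"
    using assms d by (metis diff_ge_0_iff_ge inner_diff_left less_imp_le)
  have p: "(\<Prod>b\<in>Basis. (?u - ?l) \<bullet> b) = h ^ CARD('n)"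
    using d by simp
  have sub: "box ?l ?u \<subseteq> cell h i" "cell h i \<subseteq> cbox ?l ?u"
    by (auto simp: cell_def mem_box_cart less_imp_le)
  have "emeasure lborel (box ?l ?u) \<le> emeasure lborel (cell h i)"
    using sub by (intro emeasure_mono) auto
  moreover have "emeasure lborel (cell h i) \<le> emeasure lborel (cbox ?l ?u)"
    using sub by (intro emeasure_mono) auto
  moreover have "emeasure lborel (box ?l ?u) = ennreal (h ^ CARD('n))"
    unfolding emeasure_lborel_box_eq using le p by auto
  moreover have "emeasure lborel (cbox ?l ?u) = ennreal (h ^ CARD('n))"
    unfolding emeasure_lborel_cbox_eq using le p by auto
  ultimately show ?thesis by simp
qed

lemma cell_finite_measure: "0 < h \<Longrightarrow> emeasure lborel (cell h i) < \<infinity>"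
  by (simp add: emeasure_cell)

lemma measure_cell:
  fixes i :: "int^'n"
  shows "0 < h \<Longrightarrow> measure lborel (cell h i) = h ^ CARD('n)"
  by (simp add: measure_def emeasure_cell)

lemma dist_grid_le:
  fixes x :: "real^'n"
  assumes "x \<in> cell h i" shows "norm (x - grid h i) \<le> CARD('n) * (h / 2)"
proof -
  have "norm (x - grid h i) \<le> (\<Sum>j\<in>UNIV. \<bar>(x - grid h i) $ j\<bar>)" by (rule norm_le_l1_cart)
  also have "\<dots> \<le> (\<Sum>j\<in>(UNIV::'n set). h / 2)"
  proof (intro sum_mono)
    fix j
    have "grid h i $ j - h / 2 \<le> x $ j \<and> x $ j < grid h i $ j + h / 2"
      using assms by (simp add: cell_def)
    then show "\<bar>(x - grid h i) $ j\<bar> \<le> h / 2" unfolding vector_minus_component by linarith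
  qed
  finally show ?thesis by simp
qed

lemma dist_same_cell_le:
  fixes x y :: "real^'n" and h :: real
  assumes "x \<in> cell h i" "y \<in> cell h i" shows "norm (x - y) \<le> CARD('n) * h"
  using dist_grid_le[OF assms(1)] dist_grid_le[OF assms(2)] norm_triangle_ineq4[of "x - grid h i" "y - grid h i"]
  by simp

lemma dist_grid_outside_cell:
  fixes y :: "real^'n"
  assumes "y \<notin> cell h i" "0 < h" shows "h / 2 \<le> norm (y - grid h i)"
proof -
  obtain j where "\<not> (grid h i $ j - h / 2 \<le> y $ j \<and> y $ j < grid h i $ j + h / 2)"
    using assms by (auto simp: cell_def)
  then have "h / 2 \<le> \<bar>(y - grid h i) $ j\<bar>" unfolding vector_minus_component using assms(2) by linarith
  also have "\<dots> \<le> norm (y - grid h i)" by (rule component_le_norm_cart)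
  finally show ?thesis .
qed

lemma bounded_borel_sum:
  assumes "finite S" "\<And>i. i \<in> S \<Longrightarrow> bounded_borel (w i)"
  shows "bounded_borel (\<lambda>x. \<Sum>i\<in>S. w i x)"
  using assms by (induction S rule: finite_induct) (simp_all add: bounded_borel_const bounded_borel_add)

lemma bounded_borel_pw_const:
  fixes D :: "(real^'n) set"
  assumes "bounded D" "0 < h" shows "bounded_borel (pw_const D h w)"
proof -
  have "bounded_borel (\<lambda>x. indicator (cell h i) x *\<^sub>R w i)" for i
    by (rule bounded_borelI[of _ "norm (w i)"]) (auto simp: indicator_def)
  then have "bounded_borel (\<lambda>x. \<Sum>i | grid h i \<in> D. indicator (cell h i) x *\<^sub>R w i)"
    using finite_grid[OF assms] by (intro bounded_borel_sum)
  then show ?thesis by (simp add: pw_const_def[abs_def])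
qed

lemma pw_const_add: "pw_const D h (\<lambda>i. a i + b i) x = pw_const D h a x + pw_const D h b x"
  by (simp add: pw_const_def scaleR_add_right sum.distrib)

lemma pw_const_scale: "pw_const D h (\<lambda>i. c *\<^sub>R a i) x = c *\<^sub>R pw_const D h a x"
  by (simp add: pw_const_def scaleR_sum_right mult.commute)

lemma pw_const_diff: "pw_const D h (\<lambda>i. a i - b i) x = pw_const D h a x - pw_const D h b x"
  by (simp add: pw_const_def scaleR_diff_right sum_subtractf)

lemma L2_pw_const_le:
  fixes D :: "(real^'n) set"
  assumes D: "D \<in> sets borel" "bounded D" and h: "0 < h" and c: "0 \<le> c"
    and le: "\<And>i. grid h i \<in> D \<Longrightarrow> norm (a i) \<le> c"
  shows "L2_norm D (pw_const D h a) \<le> sqrt (measure lborel D) * c"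
  using bounded_borel_pw_const[OF D(2) h, of a] c le
  by (intro L2_norm_le_const[OF D(1) bounded_set_finite_measure[OF D(2)]])
    (auto simp: pw_const_eq[OF D(2) h] bounded_borel_def)

subsection \<open>Cell averages\<close>

lemma cell_avg_lincomb:
  fixes p q r :: "real^'n \<Rightarrow> real^'n"
  assumes "0 < h" "bounded_borel p" "bounded_borel q" "bounded_borel r"
  shows "cell_avg h (\<lambda>x. a *\<^sub>R (p x - q x) - r x) i = a *\<^sub>R (cell_avg h p i - cell_avg h q i) - cell_avg h r i"
proof -
  have "set_integrable lborel (cell h i) p" "set_integrable lborel (cell h i) q" "set_integrable lborel (cell h i) r"
    using assms by (auto intro!: bounded_borel_set_integrable cell_finite_measure)
  then show ?thesis
    unfolding cell_avg_def by (simp add: set_integral_diff scaleR_diff_right mult.commute)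
qed

lemma cell_avg_const:
  fixes c :: "real^'n"
  shows "0 < h \<Longrightarrow> cell_avg h (\<lambda>x. c) i = c"
  using emeasure_cell[of h i] by (simp add: cell_avg_def set_integral_const measure_cell)

lemma norm_cell_avg_le:
  fixes w :: "real^'n \<Rightarrow> real^'n"
  assumes h: "0 < h" and w: "bounded_borel w" and le: "\<And>x. x \<in> cell h i \<Longrightarrow> norm (w x) \<le> c"
  shows "norm (cell_avg h w i) \<le> c"
proof -
  have "norm (LINT x:cell h i|lborel. w x) \<le> (LINT x:cell h i|lborel. c)"
    unfolding set_lebesgue_integral_def
  proof (rule Bochner_Integration.integral_norm_bound_integral)
    show "integrable lborel (\<lambda>x. indicator (cell h i) x *\<^sub>R w x)"
      using bounded_borel_set_integrable[OF cell_borel cell_finite_measure[OF h] w] by (simp add: set_integrable_def)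
    show "integrable lborel (\<lambda>x. indicator (cell h i) x *\<^sub>R c)"
      unfolding set_integrable_def[symmetric]
      by (rule bounded_borel_set_integrable[OF cell_borel cell_finite_measure[OF h] bounded_borel_const])
  qed (use le in \<open>auto simp: indicator_def\<close>)
  also have "\<dots> = h ^ CARD('n) * c"
    using h emeasure_cell[OF h, of i] by (simp add: set_integral_const measure_cell)
  finally have "norm (LINT x:cell h i|lborel. w x) \<le> h ^ CARD('n) * c" .
  then show ?thesis using h by (simp add: cell_avg_def field_simps)
qed

lemma cell_avg_diff_const_le:
  fixes w :: "real^'n \<Rightarrow> real^'n"
  assumes h: "0 < h" and w: "bounded_borel w" and le: "\<And>x. x \<in> cell h i \<Longrightarrow> norm (w x - b) \<le> c"
  shows "norm (cell_avg h w i - b) \<le> c"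
proof -
  have "cell_avg h (\<lambda>x. 1 *\<^sub>R (w x - b) - 0) i = cell_avg h w i - b"
    using cell_avg_lincomb[OF h w bounded_borel_const bounded_borel_const, of 1 b 0 i] h
    by (simp add: cell_avg_const)
  moreover have "norm (cell_avg h (\<lambda>x. 1 *\<^sub>R (w x - b) - 0) i) \<le> c"
    using le bounded_borel_diff[OF w bounded_borel_const] by (intro norm_cell_avg_le[OF h]) auto
  ultimately show ?thesis by simp
qed

text \<open>Cauchy--Schwarz against the constant one.\<close>

lemma cell_avg_Jensen:
  fixes w :: "real^'n \<Rightarrow> real^'n"
  assumes h: "0 < h" and w: "bounded_borel w"
  shows "h ^ CARD('n) * (norm (cell_avg h w i))\<^sup>2 \<le> (L2_norm (cell h i) w)\<^sup>2"
proof -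
  note fin = cell_borel[of h i] cell_finite_measure[OF h, of i]
  have "norm (LINT x:cell h i|lborel. w x) \<le> (LINT x:cell h i|lborel. norm (w x))"
    using bounded_borel_set_integrable[OF fin w]
    by (rule set_integral_norm_bound)
  also have "\<dots> \<le> sqrt (h ^ CARD('n)) * L2_norm (cell h i) w"
    using L1_le_L2_norm[OF fin w] h by (simp add: measure_cell)
  finally have "(norm (LINT x:cell h i|lborel. w x))\<^sup>2 \<le> (sqrt (h ^ CARD('n)) * L2_norm (cell h i) w)\<^sup>2"
    by (rule power_mono) simp
  also have "\<dots> = h ^ CARD('n) * (L2_norm (cell h i) w)\<^sup>2"
    using h by (simp add: power_mult_distrib)
  finally have "(norm (LINT x:cell h i|lborel. w x))\<^sup>2 / h ^ CARD('n) \<le> (L2_norm (cell h i) w)\<^sup>2"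
    using h by (simp add: divide_simps mult.commute)
  moreover have "h ^ CARD('n) * (norm (cell_avg h w i))\<^sup>2 = (norm (LINT x:cell h i|lborel. w x))\<^sup>2 / h ^ CARD('n)"
    using h by (simp add: cell_avg_def power_mult_distrib power_divide power2_eq_square)
  ultimately show ?thesis by simp
qed

text \<open>Sum Jensen's inequality over the cells. A cell may stick out of \<open>D\<close>, which costs nothing because
  the averaged function vanishes there.\<close>

lemma L2_pw_const_cell_avg_le:
  fixes r :: "real^'n \<Rightarrow> real^'n"
  assumes D [measurable]: "D \<in> sets borel" and b: "bounded D" and h: "0 < h" and r: "bounded_borel r"
    and r0: "\<And>x. x \<notin> D \<Longrightarrow> r x = 0"
  shows "L2_norm D (pw_const D h (cell_avg h r)) \<le> L2_norm D r"
proof -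
  note finD = bounded_set_finite_measure[OF b] and fin = finite_grid[OF b h]
  note cm = cell_finite_measure[OF h]
  let ?I = "{i. grid h i \<in> D}" and ?a = "cell_avg h r"
  have rr: "bounded_borel (\<lambda>x. r x \<bullet> r x)" by (intro bounded_borel_inner r)
  have "(L2_norm D (pw_const D h ?a))\<^sup>2 = (LINT x|lborel. (\<Sum>i\<in>?I. indicator (D \<inter> cell h i) x *\<^sub>R (norm (?a i))\<^sup>2))"
    unfolding L2_norm_power2[OF D finD] set_lebesgue_integral_def
  proof (intro Bochner_Integration.integral_cong refl)
    fix x
    have "(\<Sum>i\<in>?I. indicator (D \<inter> cell h i) x *\<^sub>R (norm (?a i))\<^sup>2)
       = (\<Sum>i\<in>?I. if i = cell_index h x then indicator D x *\<^sub>R (norm (?a i))\<^sup>2 else 0)"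
      by (intro sum.cong refl) (simp add: mem_cell_iff[OF h] indicator_def)
    also have "\<dots> = indicator D x *\<^sub>R (pw_const D h ?a x \<bullet> pw_const D h ?a x)"
      using fin by (simp add: pw_const_eq[OF b h] power2_norm_eq_inner)
    finally show "indicator D x *\<^sub>R (pw_const D h ?a x \<bullet> pw_const D h ?a x)
      = (\<Sum>i\<in>?I. indicator (D \<inter> cell h i) x *\<^sub>R (norm (?a i))\<^sup>2)" by simp
  qed
  also have "\<dots> = (\<Sum>i\<in>?I. LINT x|lborel. indicator (D \<inter> cell h i) x *\<^sub>R (norm (?a i))\<^sup>2)"
  proof (intro Bochner_Integration.integral_sum)
    fix i
    have "emeasure lborel (D \<inter> cell h i) < \<infinity>"
      by (rule le_less_trans[OF emeasure_mono finD]) auto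
    then show "integrable lborel (\<lambda>x. indicator (D \<inter> cell h i) x *\<^sub>R (norm (?a i))\<^sup>2)"
      using bounded_borel_set_integrable[of "D \<inter> cell h i", OF _ _ bounded_borel_const]
      by (simp add: set_integrable_def)
  qed
  also have "\<dots> \<le> (\<Sum>i\<in>?I. LINT x:cell h i|lborel. r x \<bullet> r x)"
  proof (intro sum_mono)
    fix i
    have "measure lborel (D \<inter> cell h i) \<le> measure lborel (cell h i)"
      using cm[of i] by (intro measure_mono_fmeasurable) (auto simp: fmeasurable_def)
    then have "measure lborel (D \<inter> cell h i) * (norm (?a i))\<^sup>2 \<le> h ^ CARD('n) * (norm (?a i))\<^sup>2"
      using h by (intro mult_right_mono) (auto simp: measure_cell)
    also have "\<dots> \<le> (LINT x:cell h i|lborel. r x \<bullet> r x)"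
      using cell_avg_Jensen[OF h r] by (simp add: L2_norm_power2[OF cell_borel cm])
    finally show "(LINT x|lborel. indicator (D \<inter> cell h i) x *\<^sub>R (norm (?a i))\<^sup>2) \<le> (LINT x:cell h i|lborel. r x \<bullet> r x)"
      by simp
  qed
  also have "\<dots> = (LINT x|lborel. (\<Sum>i\<in>?I. indicator (cell h i) x *\<^sub>R (r x \<bullet> r x)))"
    unfolding set_lebesgue_integral_def
    using bounded_borel_set_integrable[OF cell_borel cm rr]
    by (intro Bochner_Integration.integral_sum[symmetric]) (simp add: set_integrable_def)
  also have "\<dots> \<le> (LINT x|lborel. indicator D x *\<^sub>R (r x \<bullet> r x))"
  proof (rule integral_mono)
    show "integrable lborel (\<lambda>x. \<Sum>i\<in>?I. indicator (cell h i) x *\<^sub>R (r x \<bullet> r x))"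
      using bounded_borel_set_integrable[OF cell_borel cm rr]
      by (intro Bochner_Integration.integrable_sum) (simp add: set_integrable_def)
    show "integrable lborel (\<lambda>x. indicator D x *\<^sub>R (r x \<bullet> r x))"
      using bounded_borel_set_integrable[OF D finD rr] by (simp add: set_integrable_def)
    fix x
    have "(\<Sum>i\<in>?I. indicator (cell h i) x *\<^sub>R (r x \<bullet> r x)) = (\<Sum>i\<in>?I. if i = cell_index h x then r x \<bullet> r x else 0)"
      by (intro sum.cong refl) (simp add: mem_cell_iff[OF h] indicator_def)
    also have "\<dots> \<le> r x \<bullet> r x" using fin by simp
    also have "\<dots> = indicator D x *\<^sub>R (r x \<bullet> r x)" using r0[of x] by (auto simp: indicator_def)
    finally show "(\<Sum>i\<in>?I. indicator (cell h i) x *\<^sub>R (r x \<bullet> r x)) \<le> indicator D x *\<^sub>R (r x \<bullet> r x)" .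
  qed
  also have "\<dots> = (L2_norm D r)\<^sup>2"
    by (simp add: L2_norm_power2[OF D finD] set_lebesgue_integral_def)
  finally show ?thesis by (rule power2_le_imp_le) (rule L2_norm_nonneg[OF D finD])
qed

text \<open>The scheme evaluates the force only at grid points, where the kernel is singular inside the
  cell of the grid point. There the density is constant, so the kernel mass suffices; outside that
  cell the grid point and any other point of the cell see comparable distances.\<close>

lemma riesz_at_grid_le:
  fixes D :: "(real^'n) set"
  assumes D: "D \<in> sets borel" and b: "bounded D" and k: "kernel_bound D \<kappa>" and h: "0 < h"
    and i: "grid h i \<in> D" and x: "x \<in> cell h i"
  shows "riesz_potential D (pw_const D h a) (grid h i)
     \<le> \<kappa> * norm (a i) + (1 + real CARD('n)) * riesz_potential D (pw_const D h a) x"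
proof -
  note finD = bounded_set_finite_measure[OF b]
  let ?e = "pw_const D h a" and ?p = "grid h i"
  have e: "bounded_borel ?e" by (rule bounded_borel_pw_const[OF b h])
  then obtain C where C: "\<And>y. norm (?e y) \<le> C" using bounded_borel_bound by blast
  have em: "?e \<in> borel_measurable borel" using e by (rule bounded_borel_measurable)
  have int: "set_integrable lborel D (\<lambda>y. norm (?e y) / norm (z - y))" for z
    using riesz_set_integrable[OF D finD k em C] .
  have ki: "set_integrable lborel D (\<lambda>y. 1 / norm (?p - y))" by (rule kernel_set_integrable[OF D finD k])
  have "riesz_potential D ?e ?p \<le> (LINT y:D|lborel. norm (a i) * (1 / norm (?p - y)) + (1 + real CARD('n)) * (norm (?e y) / norm (x - y)))"
    unfolding riesz_potential_def
  proof (intro set_integral_mono int set_integral_add(1) set_integrable_mult_right ki)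
    fix y
    show "norm (?e y) / norm (?p - y) \<le> norm (a i) * (1 / norm (?p - y)) + (1 + real CARD('n)) * (norm (?e y) / norm (x - y))"
    proof (cases "y \<in> cell h i")
      case True
      then have "?e y = a i" using pw_const_in_cell[OF b h True] i by simp
      then show ?thesis by simp
    next
      case False
      then have far: "h / 2 \<le> norm (?p - y)" using dist_grid_outside_cell[OF False h] by (simp add: norm_minus_commute)
      have "norm (x - y) \<le> norm (x - ?p) + norm (?p - y)"
        by (metis diff_add_cancel add_diff_eq norm_triangle_ineq)
      also have "\<dots> \<le> CARD('n) * norm (?p - y) + norm (?p - y)"
        using dist_grid_le[OF x] mult_left_mono[OF far, of "real CARD('n)"] by linarith
      finally have le: "norm (x - y) \<le> (1 + real CARD('n)) * norm (?p - y)" by (simp add: algebra_simps)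
      have pos: "0 < norm (?p - y)" "0 < norm (x - y)" using far h x False by auto
      have "1 / norm (?p - y) \<le> (1 + real CARD('n)) / norm (x - y)"
        using le pos by (simp add: divide_simps mult.commute)
      then have "norm (?e y) * (1 / norm (?p - y)) \<le> norm (?e y) * ((1 + real CARD('n)) / norm (x - y))"
        by (intro mult_left_mono) auto
      then have "norm (?e y) / norm (?p - y) \<le> (1 + real CARD('n)) * (norm (?e y) / norm (x - y))"
        by (simp add: mult.commute)
      then show ?thesis by (meson add_increasing divide_nonneg_nonneg mult_nonneg_nonneg norm_ge_zero zero_le_one)
    qed
  qed
  also have "\<dots> = norm (a i) * (LINT y:D|lborel. 1 / norm (?p - y)) + (1 + real CARD('n)) * riesz_potential D ?e x"
    unfolding riesz_potential_def
    using set_integral_add(2)[OF set_integrable_mult_right[OF ki, of "norm (a i)"] set_integrable_mult_right[OF int[of x], of "1 + real CARD('n)"]]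
    by (simp only: set_integral_mult_right)
  also have "\<dots> \<le> norm (a i) * \<kappa> + (1 + real CARD('n)) * riesz_potential D ?e x"
    using kernel_integral_le[OF D finD k] by (intro add_right_mono mult_left_mono) auto
  finally show ?thesis by (simp add: mult.commute)
qed

section \<open>Lipschitz estimates for the peridynamic force\<close>

lemma set_integral_diff_bound:
  fixes f g :: "'a::euclidean_space \<Rightarrow> 'b::euclidean_space"
  assumes "set_integrable lborel A f" "set_integrable lborel A g" "set_integrable lborel A b"
    and "\<And>x. x \<in> A \<Longrightarrow> norm (f x - g x) \<le> b x"
  shows "norm ((LINT x:A|lborel. f x) - (LINT x:A|lborel. g x)) \<le> (LINT x:A|lborel. b x)"
proof -
  have "(LINT x:A|lborel. f x) - (LINT x:A|lborel. g x) = (LINT x:A|lborel. f x - g x)"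
    using assms by (simp add: set_integral_diff)
  also have "norm \<dots> \<le> (LINT x:A|lborel. b x)"
    unfolding set_lebesgue_integral_def
  proof (rule Bochner_Integration.integral_norm_bound_integral)
    show "integrable lborel (\<lambda>x. indicat_real A x *\<^sub>R (f x - g x))"
      using set_integral_diff(1)[OF assms(1,2)] by (simp add: set_integrable_def)
    show "integrable lborel (\<lambda>x. indicat_real A x *\<^sub>R b x)"
      using assms(3) by (simp add: set_integrable_def)
  qed (use assms(4) in \<open>auto simp: indicator_def\<close>)
  finally show ?thesis .
qed

text \<open>Rescaling the unit ball to the horizon turns an integral over bonds into one over the body.\<close>

lemma ball_integral_affine_le:
  fixes D :: "'a::euclidean_space set" and \<psi> :: "'a \<Rightarrow> real"
  assumes eps: "0 < \<epsilon>" and int: "set_integrable lborel D \<psi>" and pos: "\<And>y. y \<in> D \<Longrightarrow> 0 \<le> \<psi> y"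
  shows "set_integrable lborel (ball 0 1) (\<lambda>\<xi>. indicator D (x + \<epsilon> *\<^sub>R \<xi>) * \<psi> (x + \<epsilon> *\<^sub>R \<xi>))"
    and "(LINT \<xi>:ball 0 1|lborel. indicator D (x + \<epsilon> *\<^sub>R \<xi>) * \<psi> (x + \<epsilon> *\<^sub>R \<xi>))
      \<le> (LINT y:D|lborel. \<psi> y) / \<epsilon> ^ DIM('a)"
proof -
  let ?\<Psi> = "\<lambda>y. indicat_real D y *\<^sub>R \<psi> y" and ?T = "\<lambda>\<xi>. x + \<epsilon> *\<^sub>R \<xi>" and ?d = "DIM('a)"
  have i: "integrable lborel ?\<Psi>" using int by (simp add: set_integrable_def)
  then have [measurable]: "(\<lambda>y. indicat_real D y * \<psi> y) \<in> borel_measurable borel"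
    using borel_measurable_integrable by fastforce
  have aff: "lborel = density (distr lborel borel ?T) (\<lambda>_. ennreal (\<epsilon> ^ ?d))"
    using lborel_affine[of \<epsilon> x] eps by simp
  have "integrable (density (distr lborel borel ?T) (\<lambda>_. ennreal (\<epsilon> ^ ?d))) ?\<Psi>"
    using i aff by simp
  then have "integrable (distr lborel borel ?T) (\<lambda>y. \<epsilon> ^ ?d *\<^sub>R ?\<Psi> y)"
    using eps by (subst (asm) integrable_density) auto
  then have "integrable (distr lborel borel ?T) (\<lambda>y. (1 / \<epsilon> ^ ?d) *\<^sub>R (\<epsilon> ^ ?d *\<^sub>R ?\<Psi> y))"
    by (rule integrable_scaleR_right)
  then have "integrable (distr lborel borel ?T) ?\<Psi>"
    using eps by simp
  then have iT: "integrable lborel (\<lambda>\<xi>. ?\<Psi> (?T \<xi>))" by (subst (asm) integrable_distr_eq) auto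
  have "(LINT y|lborel. ?\<Psi> y) = (LINT y|density (distr lborel borel ?T) (\<lambda>_. ennreal (\<epsilon> ^ ?d)). ?\<Psi> y)"
    using aff by simp
  also have "\<dots> = (LINT y|distr lborel borel ?T. \<epsilon> ^ ?d *\<^sub>R ?\<Psi> y)"
    using eps by (intro integral_density) auto
  also have "\<dots> = \<epsilon> ^ ?d * (LINT \<xi>|lborel. ?\<Psi> (?T \<xi>))"
    by (subst integral_distr) auto
  finally have eq: "(LINT \<xi>|lborel. ?\<Psi> (?T \<xi>)) = (LINT y:D|lborel. \<psi> y) / \<epsilon> ^ ?d"
    using eps by (simp add: set_lebesgue_integral_def)
  have "integrable lborel (\<lambda>\<xi>. indicat_real (ball 0 1) \<xi> *\<^sub>R ?\<Psi> (?T \<xi>))"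
    by (rule integrable_mult_indicator[OF _ iT]) simp
  then show 1: "set_integrable lborel (ball 0 1) (\<lambda>\<xi>. indicator D (?T \<xi>) * \<psi> (?T \<xi>))"
    by (simp add: set_integrable_def)
  have "(LINT \<xi>:ball 0 1|lborel. indicator D (?T \<xi>) * \<psi> (?T \<xi>)) \<le> (LINT \<xi>|lborel. ?\<Psi> (?T \<xi>))"
    unfolding set_lebesgue_integral_def
    using 1 iT pos by (intro integral_mono) (auto simp: set_integrable_def indicator_def)
  then show "(LINT \<xi>:ball 0 1|lborel. indicator D (?T \<xi>) * \<psi> (?T \<xi>)) \<le> (LINT y:D|lborel. \<psi> y) / \<epsilon> ^ ?d"
    using eq by simp
qed

lemma norm_unit_vec_le: "norm (unit_vec \<xi>) \<le> 1"
  by (cases "\<xi> = 0") (simp_all add: unit_vec_def)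

lemma inner_unit_vec_le: "\<bar>a \<bullet> unit_vec \<xi>\<bar> \<le> norm a"
  using Cauchy_Schwarz_ineq2[of a "unit_vec \<xi>"] mult_left_mono[OF norm_unit_vec_le norm_ge_zero, of a \<xi>]
  by simp

lemma unit_vec_measurable [measurable]: "unit_vec \<in> borel_measurable (borel :: 'a::euclidean_space measure)"
  unfolding unit_vec_def[abs_def] by measurable

lemma influence_function_facts:
  assumes "influence_function J"
  obtains M where "0 \<le> M" "\<And>r. 0 \<le> r \<Longrightarrow> 0 \<le> J r" "\<And>r. 0 \<le> r \<Longrightarrow> J r \<le> M"
    "(\<lambda>\<xi>::'a::euclidean_space. J (norm \<xi>)) \<in> borel_measurable borel"
proof -
  obtain M where M: "\<forall>r\<in>{0..<1}. 0 \<le> J r \<and> J r \<le> M" and J1: "\<forall>r\<ge>1. J r = 0"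
    and Jm: "J \<in> borel_measurable (restrict_space borel {0..})"
    using assms unfolding influence_function_def by blast
  have "0 \<le> J 0 \<and> J 0 \<le> M" using M by (rule bspec) simp
  then have M0: "0 \<le> M" by linarith
  have r: "0 \<le> J r \<and> J r \<le> M" if "0 \<le> r" for r
    using M J1 M0 that by (cases "r < 1") auto
  have "(\<lambda>\<xi>::'a. norm \<xi>) \<in> borel \<rightarrow>\<^sub>M restrict_space borel {0..}"
    by (intro measurable_restrict_space2) auto
  then have "(\<lambda>\<xi>::'a. J (norm \<xi>)) \<in> borel_measurable borel"
    using Jm by (rule measurable_compose)
  then show thesis using that[of M] M0 r by blast
qed

lemma ball_vol_pos: "0 < ball_vol TYPE('n::finite)"
  by (simp add: ball_vol_def content_ball)

context
  fixes D :: "(real^'n) set" and \<epsilon> M :: real and J :: "real \<Rightarrow> real" and \<omega> :: "real^'n \<Rightarrow> real"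
  assumes D [measurable]: "D \<in> sets borel" and Db: "bounded D"
    and eps: "0 < \<epsilon>"
    and M0: "0 \<le> M" and J0: "\<And>r. 0 \<le> r \<Longrightarrow> 0 \<le> J r" and JM: "\<And>r. 0 \<le> r \<Longrightarrow> J r \<le> M"
    and Jm [measurable]: "(\<lambda>\<xi>::real^'n. J (norm \<xi>)) \<in> borel_measurable borel"
    and om [measurable]: "\<omega> \<in> borel_measurable borel" and om01: "\<And>x. 0 \<le> \<omega> x" "\<And>x. \<omega> x \<le> 1"
    and omD: "\<And>x. x \<notin> D \<Longrightarrow> \<omega> x = 0"
begin

abbreviation far :: "real^'n \<Rightarrow> real^'n \<Rightarrow> real^'n" where "far x \<xi> \<equiv> x + \<epsilon> *\<^sub>R \<xi>"

lemmas body = D bounded_set_finite_measure[OF Db]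

lemma unit_ball: "ball (0::real^'n) 1 \<in> sets borel" "emeasure lborel (ball (0::real^'n) 1) < \<infinity>"
  using bounded_set_finite_measure[OF bounded_ball[of "0::real^'n" 1]] by simp_all

text \<open>Bonds with an end outside the body carry no force. The indicator of \<open>D\<close> kept here is what
  later restricts all integrals to the body.\<close>

lemma weight_le: "\<omega> x * J (norm \<xi>) \<le> M * indicator D x" "0 \<le> \<omega> x * J (norm \<xi>)"
proof -
  have J: "0 \<le> J (norm \<xi>)" "J (norm \<xi>) \<le> M" using J0 JM by auto
  show "0 \<le> \<omega> x * J (norm \<xi>)" using om01 J by simp
  show "\<omega> x * J (norm \<xi>) \<le> M * indicator D x"
  proof (cases "x \<in> D")
    case True
    have "\<omega> x * J (norm \<xi>) \<le> 1 * M" using om01 J M0 by (intro mult_mono) auto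
    then show ?thesis using True by simp
  qed (simp add: omD)
qed

lemma norm_bond_force_le:
  "norm ((\<omega> x * \<omega> y * J (norm \<xi>) * s) *\<^sub>R unit_vec \<xi>) \<le> M * indicator D y * \<bar>s\<bar>"
proof -
  have "norm ((\<omega> x * \<omega> y * J (norm \<xi>) * s) *\<^sub>R unit_vec \<xi>)
     = (\<omega> x * (\<omega> y * J (norm \<xi>)) * \<bar>s\<bar>) * norm (unit_vec \<xi>)"
    using om01 J0 by (simp add: abs_mult)
  also have "\<dots> \<le> (1 * (M * indicator D y) * \<bar>s\<bar>) * 1"
    by (rule mult_mono[OF mult_right_mono[OF mult_mono[OF om01(2) weight_le(1) _ weight_le(2)]] norm_unit_vec_le])
      (use M0 in auto)
  finally show ?thesis by simp
qed

lemma strain_integrable: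
  assumes w: "bounded_borel w"
  shows "set_integrable lborel (ball 0 1)
    (\<lambda>\<xi>. \<omega> (far x \<xi>) * J (norm \<xi>) * ((w (far x \<xi>) - w x) \<bullet> unit_vec \<xi>))"
    and "\<exists>C. \<forall>x. \<bar>hydrostatic_strain \<epsilon> J \<omega> w x\<bar> \<le> C"
proof -
  note [measurable] = w[THEN bounded_borel_measurable]
  let ?F = "\<lambda>x \<xi>. \<omega> (far x \<xi>) * J (norm \<xi>) * ((w (far x \<xi>) - w x) \<bullet> unit_vec \<xi>)"
  obtain C where C: "0 \<le> C" "\<And>y. norm (w y) \<le> C" using bounded_borel_bound[OF w] by blast
  have F: "\<bar>?F x \<xi>\<bar> \<le> M * (2 * C)" for x \<xi>
  proof -
    have 1: "\<bar>(w (far x \<xi>) - w x) \<bullet> unit_vec \<xi>\<bar> \<le> 2 * C"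
      using inner_unit_vec_le[of "w (far x \<xi>) - w x" \<xi>]
        norm_triangle_ineq4[of "w (far x \<xi>)" "w x"] C(2)[of x] C(2)[of "far x \<xi>"] by linarith
    have 2: "\<omega> (far x \<xi>) * J (norm \<xi>) \<le> M"
      using weight_le(1)[of "far x \<xi>" \<xi>] M0 by (cases "far x \<xi> \<in> D") auto
    show ?thesis
      unfolding abs_mult[of "\<omega> (far x \<xi>) * J (norm \<xi>)"] abs_of_nonneg[OF weight_le(2)]
      by (rule mult_mono[OF 2 1 M0]) simp
  qed
  have i: "set_integrable lborel (ball 0 1) (?F x)" for x
    by (rule set_integrable_bounded[OF unit_ball, of _ "M * (2 * C)"]) (use F in auto)
  then show "set_integrable lborel (ball 0 1) (?F x)" .
  have "\<bar>LINT \<xi>:ball 0 1|lborel. ?F x \<xi>\<bar> \<le> (LINT \<xi>:ball (0::real^'n) 1|lborel. M * (2 * C))" for x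
  proof -
    have c: "set_integrable lborel (ball (0::real^'n) 1) (\<lambda>_. c)" for c :: real
      by (rule bounded_borel_set_integrable[OF unit_ball bounded_borel_const])
    have "norm ((LINT \<xi>:ball 0 1|lborel. ?F x \<xi>) - (LINT \<xi>:ball (0::real^'n) 1|lborel. 0)) \<le> (LINT \<xi>:ball (0::real^'n) 1|lborel. M * (2 * C))"
      by (rule set_integral_diff_bound[OF i c c]) (use F in auto)
    then show ?thesis by simp
  qed
  then have "\<bar>hydrostatic_strain \<epsilon> J \<omega> w x\<bar> \<le> 1 / ball_vol TYPE('n) * (LINT \<xi>:ball (0::real^'n) 1|lborel. M * (2 * C))" for x
    using ball_vol_pos[where 'n='n] unfolding hydrostatic_strain_def abs_mult
    by (intro mult_mono) auto
  then show "\<exists>C. \<forall>x. \<bar>hydrostatic_strain \<epsilon> J \<omega> w x\<bar> \<le> C" by blast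
qed

lemma strain_bounded_borel:
  assumes w: "bounded_borel w" shows "bounded_borel (hydrostatic_strain \<epsilon> J \<omega> w)"
proof -
  note [measurable] = w[THEN bounded_borel_measurable]
  have [measurable]: "ball (0::real^'n) 1 \<in> sets borel" by simp
  have "(\<lambda>x. hydrostatic_strain \<epsilon> J \<omega> w x) \<in> borel_measurable borel"
    unfolding hydrostatic_strain_def set_lebesgue_integral_def by measurable
  then show ?thesis using strain_integrable(2)[OF w] by (auto simp: bounded_borel_def)
qed

text \<open>The common majorant of the bond integrals: a term for the far end of the bond, which becomes an
  integral over the body, and a constant for the near end.\<close>

lemma unit_ball_affine_bound:
  assumes e: "bounded_borel e"
  shows "set_integrable lborel (ball 0 1) (\<lambda>\<xi>. indicator D (far x \<xi>) * norm (e (far x \<xi>)) + c)"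
    and "(LINT \<xi>:ball 0 1|lborel. indicator D (far x \<xi>) * norm (e (far x \<xi>)) + c) \<le>
       (LINT y:D|lborel. norm (e y)) / \<epsilon> ^ CARD('n) + ball_vol TYPE('n) * c"
proof -
  have i: "set_integrable lborel D (\<lambda>y. norm (e y))"
    by (intro bounded_borel_set_integrable[OF body] bounded_borel_norm e)
  note a = ball_integral_affine_le[OF eps i, of x]
  have c: "set_integrable lborel (ball (0::real^'n) 1) (\<lambda>_. c)"
    by (rule bounded_borel_set_integrable[OF unit_ball bounded_borel_const])
  have "(LINT \<xi>:ball (0::real^'n) 1|lborel. c) = ball_vol TYPE('n) * c"
    using unit_ball(2) by (simp add: set_integral_const ball_vol_def)
  then show "(LINT \<xi>:ball 0 1|lborel. indicator D (far x \<xi>) * norm (e (far x \<xi>)) + c) \<le>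
       (LINT y:D|lborel. norm (e y)) / \<epsilon> ^ CARD('n) + ball_vol TYPE('n) * c"
    using a c by simp
  show "set_integrable lborel (ball 0 1) (\<lambda>\<xi>. indicator D (far x \<xi>) * norm (e (far x \<xi>)) + c)"
    using a(1) c by (intro set_integral_add(1)) auto
qed

lemma strain_lipschitz:
  fixes w z :: "real^'n \<Rightarrow> real^'n"
  assumes w: "bounded_borel w" and z: "bounded_borel z"
  defines "e \<equiv> \<lambda>y. w y - z y"
  defines "K \<equiv> M * (1 / (ball_vol TYPE('n) * \<epsilon> ^ CARD('n)) + 1)"
  shows "\<bar>hydrostatic_strain \<epsilon> J \<omega> w x - hydrostatic_strain \<epsilon> J \<omega> z x\<bar>
     \<le> K * ((LINT y:D|lborel. norm (e y)) + norm (e x))"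
proof -
  let ?V = "ball_vol TYPE('n)" and ?E = "LINT y:D|lborel. norm (e y)"
  let ?F = "\<lambda>w \<xi>. \<omega> (far x \<xi>) * J (norm \<xi>) * ((w (far x \<xi>) - w x) \<bullet> unit_vec \<xi>)"
  let ?b = "\<lambda>\<xi>. indicator D (far x \<xi>) * norm (e (far x \<xi>)) + norm (e x)"
  have e: "bounded_borel e" unfolding e_def by (intro bounded_borel_diff w z)
  have V: "0 < ?V" by (rule ball_vol_pos)
  have E0: "0 \<le> ?E" by (intro set_integral_nonneg'[OF body]) simp
  note b = unit_ball_affine_bound[OF e, of x "norm (e x)"]
  have "norm ((LINT \<xi>:ball 0 1|lborel. ?F w \<xi>) - (LINT \<xi>:ball 0 1|lborel. ?F z \<xi>)) \<le> (LINT \<xi>:ball 0 1|lborel. M * ?b \<xi>)"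
  proof (intro set_integral_diff_bound strain_integrable(1) w z set_integrable_mult_right b(1))
    fix \<xi> :: "real^'n"
    have e_split: "(e y - e x) \<bullet> u = (w y - w x) \<bullet> u - (z y - z x) \<bullet> u" for y u
      by (simp add: e_def inner_diff_left)
    have u: "\<bar>(e (far x \<xi>) - e x) \<bullet> unit_vec \<xi>\<bar> \<le> norm (e (far x \<xi>)) + norm (e x)"
      by (rule order_trans[OF inner_unit_vec_le norm_triangle_ineq4])
    have "norm (?F w \<xi> - ?F z \<xi>) = \<bar>\<omega> (far x \<xi>) * J (norm \<xi>) * ((e (far x \<xi>) - e x) \<bullet> unit_vec \<xi>)\<bar>"
      by (simp only: e_split right_diff_distrib real_norm_def)
    also have "\<dots> = (\<omega> (far x \<xi>) * J (norm \<xi>)) * \<bar>(e (far x \<xi>) - e x) \<bullet> unit_vec \<xi>\<bar>"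
      unfolding abs_mult[of "\<omega> (far x \<xi>) * J (norm \<xi>)"] abs_of_nonneg[OF weight_le(2)] ..
    also have "\<dots> \<le> (M * indicator D (far x \<xi>)) * (norm (e (far x \<xi>)) + norm (e x))"
      using M0 by (intro mult_mono weight_le u) auto
    also have "\<dots> \<le> M * ?b \<xi>" using M0 by (auto simp: indicator_def)
    finally show "norm (?F w \<xi> - ?F z \<xi>) \<le> M * ?b \<xi>" .
  qed
  also have "\<dots> \<le> M * (?E / \<epsilon> ^ CARD('n) + ?V * norm (e x))"
    using b(2) M0 by (simp only: set_integral_mult_right mult_left_mono)
  finally have "1 / ?V * norm ((LINT \<xi>:ball 0 1|lborel. ?F w \<xi>) - (LINT \<xi>:ball 0 1|lborel. ?F z \<xi>))
     \<le> 1 / ?V * (M * (?E / \<epsilon> ^ CARD('n) + ?V * norm (e x)))"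
    using V by (intro mult_left_mono) auto
  also have "\<dots> = M * (1 / (?V * \<epsilon> ^ CARD('n))) * ?E + M * norm (e x)"
    using V by (simp add: field_simps)
  also have "\<dots> \<le> K * ?E + K * norm (e x)"
  proof (intro add_mono mult_right_mono)
    have "K = M * (1 / (?V * \<epsilon> ^ CARD('n))) + M" unfolding K_def by (simp only: distrib_left mult_1_right)
    moreover have "0 \<le> M * (1 / (?V * \<epsilon> ^ CARD('n)))" using M0 V eps by auto
    ultimately show "M * (1 / (?V * \<epsilon> ^ CARD('n))) \<le> K" "M \<le> K" using M0 by linarith+
  qed (use E0 in auto)
  finally show ?thesis
    using V by (simp add: hydrostatic_strain_def distrib_left diff_divide_distrib[symmetric])
qed

text \<open>The dilatational force depends on the strain at both ends of a bond, hence twice on the mean of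
  the error over the body and once on its value at the far end.\<close>

lemma dilatational_lipschitz:
  fixes g :: "real \<Rightarrow> real"
  assumes A: "0 \<le> A" "\<And>s t. \<bar>deriv g s - deriv g t\<bar> \<le> A * \<bar>s - t\<bar>"
  shows "\<exists>C\<ge>0. \<forall>w z x. bounded_borel w \<longrightarrow> bounded_borel z \<longrightarrow>
     norm (dilatational_force \<epsilon> J \<omega> g w x - dilatational_force \<epsilon> J \<omega> g z x)
     \<le> C * (norm (w x - z x) + (LINT y:D|lborel. norm (w y - z y)))"
proof -
  let ?V = "ball_vol TYPE('n)"
  let ?\<theta> = "hydrostatic_strain \<epsilon> J \<omega>"
  let ?N = "1 / (\<epsilon>\<^sup>2 * ?V)"
  define K where "K = M * (1 / (?V * \<epsilon> ^ CARD('n)) + 1)"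
  define C where "C = ?N * (M * (A * K)) * (1 / \<epsilon> ^ CARD('n) + 2 * ?V)"
  have V: "0 < ?V" by (rule ball_vol_pos)
  have K0: "0 \<le> K" using V M0 eps by (simp add: K_def)
  have C0: "0 \<le> C" using V M0 eps A K0 by (simp add: C_def)
  have "A-lipschitz_on UNIV (deriv g)" using A by (intro lipschitz_onI) (auto simp: dist_real_def)
  then have [measurable]: "deriv g \<in> borel_measurable borel"
    by (intro borel_measurable_continuous_onI lipschitz_on_continuous_on)
  have "norm (dilatational_force \<epsilon> J \<omega> g w x - dilatational_force \<epsilon> J \<omega> g z x)
     \<le> C * (norm (w x - z x) + (LINT y:D|lborel. norm (w y - z y)))"
    if w: "bounded_borel w" and z: "bounded_borel z" for w z x
  proof -
    define e where "e = (\<lambda>y. w y - z y)"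
    have e: "bounded_borel e" unfolding e_def by (intro bounded_borel_diff w z)
    let ?E = "LINT y:D|lborel. norm (e y)"
    have E0: "0 \<le> ?E" by (intro set_integral_nonneg'[OF body]) simp
    let ?F = "\<lambda>w \<xi>. (\<omega> x * \<omega> (far x \<xi>) * J (norm \<xi>) *
        (deriv g (?\<theta> w (far x \<xi>)) + deriv g (?\<theta> w x))) *\<^sub>R unit_vec \<xi>"
    let ?b = "\<lambda>\<xi>. indicator D (far x \<xi>) * norm (e (far x \<xi>)) + (2 * ?E + norm (e x))"
    note b = unit_ball_affine_bound[OF e, of x "2 * ?E + norm (e x)"]
    have int: "set_integrable lborel (ball 0 1) (?F w)" if w: "bounded_borel w" for w
    proof -
      note [measurable] = w[THEN strain_bounded_borel, THEN bounded_borel_measurable]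
      obtain B where B: "\<And>x. norm (?\<theta> w x) \<le> B" using bounded_borel_bound[OF strain_bounded_borel[OF w]] by blast
      have dB: "\<bar>deriv g (?\<theta> w y)\<bar> \<le> \<bar>deriv g 0\<bar> + A * B" for y
        using A(2)[of "?\<theta> w y" 0] mult_left_mono[OF B[of y] A(1)] by simp
      show ?thesis
      proof (rule set_integrable_bounded[OF unit_ball, of _ "M * (2 * (\<bar>deriv g 0\<bar> + A * B))"])
        fix \<xi> :: "real^'n"
        have "norm (?F w \<xi>) \<le> M * indicator D (far x \<xi>) * \<bar>deriv g (?\<theta> w (far x \<xi>)) + deriv g (?\<theta> w x)\<bar>"
          by (rule norm_bond_force_le)
        also have "\<dots> \<le> M * 1 * (2 * (\<bar>deriv g 0\<bar> + A * B))"
          using M0 dB[of x] dB[of "far x \<xi>"] by (intro mult_mono) (auto simp: indicator_def)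
        finally show "norm (?F w \<xi>) \<le> M * (2 * (\<bar>deriv g 0\<bar> + A * B))" by simp
      qed measurable
    qed
    have "norm ((LINT \<xi>:ball 0 1|lborel. ?F w \<xi>) - (LINT \<xi>:ball 0 1|lborel. ?F z \<xi>)) \<le> (LINT \<xi>:ball 0 1|lborel. (M * (A * K)) * ?b \<xi>)"
    proof (intro set_integral_diff_bound int w z set_integrable_mult_right b(1))
      fix \<xi> :: "real^'n"
      let ?y = "far x \<xi>"
      let ?s = "(deriv g (?\<theta> w ?y) + deriv g (?\<theta> w x)) - (deriv g (?\<theta> z ?y) + deriv g (?\<theta> z x))"
      have one: "\<bar>deriv g (?\<theta> w y) - deriv g (?\<theta> z y)\<bar> \<le> A * K * (?E + norm (e y))" for y
      proof -
        have "\<bar>deriv g (?\<theta> w y) - deriv g (?\<theta> z y)\<bar> \<le> A * \<bar>?\<theta> w y - ?\<theta> z y\<bar>" by (rule A)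
        also have "\<dots> \<le> A * (K * (?E + norm (e y)))"
          unfolding K_def e_def by (intro mult_left_mono A strain_lipschitz w z)
        finally show ?thesis by (simp add: mult.assoc)
      qed
      have s: "\<bar>?s\<bar> \<le> A * K * (?E + norm (e ?y)) + A * K * (?E + norm (e x))"
        using one[of ?y] one[of x] by linarith
      have "?F w \<xi> - ?F z \<xi> = (\<omega> x * \<omega> ?y * J (norm \<xi>) * ?s) *\<^sub>R unit_vec \<xi>"
        by (simp add: right_diff_distrib scaleR_diff_left)
      then have "norm (?F w \<xi> - ?F z \<xi>) \<le> M * indicator D ?y * \<bar>?s\<bar>" using norm_bond_force_le[of x ?y \<xi> ?s] by simp
      also have "\<dots> \<le> M * indicator D ?y * (A * K * (?E + norm (e ?y)) + A * K * (?E + norm (e x)))"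
        using M0 s by (intro mult_left_mono) auto
      also have "\<dots> \<le> (M * (A * K)) * ?b \<xi>"
        using M0 A(1) K0 E0 by (cases "?y \<in> D") (auto simp: algebra_simps)
      finally show "norm (?F w \<xi> - ?F z \<xi>) \<le> (M * (A * K)) * ?b \<xi>" .
    qed
    also have "\<dots> = (M * (A * K)) * (LINT \<xi>:ball 0 1|lborel. ?b \<xi>)" by (rule set_integral_mult_right)
    also have "\<dots> \<le> (M * (A * K)) * (?E / \<epsilon> ^ CARD('n) + ?V * (2 * ?E + norm (e x)))"
      using M0 A(1) K0 by (intro mult_left_mono b(2)) auto
    also have "\<dots> \<le> (M * (A * K)) * ((1 / \<epsilon> ^ CARD('n) + 2 * ?V) * (norm (e x) + ?E))"
    proof (intro mult_left_mono)
      have "0 \<le> norm (e x) / \<epsilon> ^ CARD('n)" "0 \<le> ?V * norm (e x)" using eps V by auto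
      then show "?E / \<epsilon> ^ CARD('n) + ?V * (2 * ?E + norm (e x)) \<le> (1 / \<epsilon> ^ CARD('n) + 2 * ?V) * (norm (e x) + ?E)"
        by (simp add: algebra_simps)
    qed (use M0 A(1) K0 in auto)
    finally have "?N * norm ((LINT \<xi>:ball 0 1|lborel. ?F w \<xi>) - (LINT \<xi>:ball 0 1|lborel. ?F z \<xi>))
       \<le> ?N * ((M * (A * K)) * ((1 / \<epsilon> ^ CARD('n) + 2 * ?V) * (norm (e x) + ?E)))"
      using V by (intro mult_left_mono) auto
    moreover have "norm (dilatational_force \<epsilon> J \<omega> g w x - dilatational_force \<epsilon> J \<omega> g z x) =
        ?N * norm ((LINT \<xi>:ball 0 1|lborel. ?F w \<xi>) - (LINT \<xi>:ball 0 1|lborel. ?F z \<xi>))"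
      using V eps unfolding dilatational_force_def scaleR_diff_right[symmetric] by simp
    ultimately show ?thesis unfolding C_def e_def by (simp only: mult.assoc)
  qed
  with C0 show ?thesis by blast
qed

text \<open>The difference quotient in the argument of \<open>f'\<close> together with the prefactor produces the
  kernel \<open>1 / (\<epsilon> * norm \<xi>)\<close>, the inverse distance of the two ends of the bond.\<close>

lemma tensile_lipschitz:
  fixes f :: "real \<Rightarrow> real"
  assumes A: "0 \<le> A" "\<And>s t. \<bar>deriv f s - deriv f t\<bar> \<le> A * \<bar>s - t\<bar>" and B: "\<And>s. \<bar>deriv f s\<bar> \<le> B"
    and k: "kernel_bound D \<kappa>" and dim: "2 \<le> CARD('n)"
  shows "\<exists>C\<ge>0. \<forall>w z x. bounded_borel w \<longrightarrow> bounded_borel z \<longrightarrow>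
     norm (tensile_force \<epsilon> J \<omega> f w x - tensile_force \<epsilon> J \<omega> f z x)
     \<le> C * (norm (w x - z x) + riesz_potential D (\<lambda>y. w y - z y) x)"
proof -
  let ?V = "ball_vol TYPE('n)"
  let ?N = "2 / (\<epsilon> * ?V)"
  obtain \<kappa>1 where k1: "kernel_bound (ball (0::real^'n) 1) \<kappa>1"
    using kernel_bound_exists[of "ball (0::real^'n) 1"] dim by auto
  have k10: "0 \<le> \<kappa>1" using k1 by (simp add: kernel_bound_def)
  define C where "C = ?N * (M * A) * (\<kappa>1 / \<epsilon> + 1 / \<epsilon> ^ CARD('n))"
  have V: "0 < ?V" by (rule ball_vol_pos)
  have C0: "0 \<le> C" using V M0 eps A k10 by (simp add: C_def)
  have "A-lipschitz_on UNIV (deriv f)" using A by (intro lipschitz_onI) (auto simp: dist_real_def)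
  then have [measurable]: "deriv f \<in> borel_measurable borel"
    by (intro borel_measurable_continuous_onI lipschitz_on_continuous_on)
  have ki: "set_integrable lborel (ball (0::real^'n) 1) (\<lambda>\<xi>. 1 / norm \<xi>)"
    and kl: "(LINT \<xi>:ball (0::real^'n) 1|lborel. 1 / norm \<xi>) \<le> \<kappa>1"
    using kernel_set_integrable[OF unit_ball k1, of 0]
      kernel_integral_le[OF unit_ball k1, of 0] by auto
  have "norm (tensile_force \<epsilon> J \<omega> f w x - tensile_force \<epsilon> J \<omega> f z x)
     \<le> C * (norm (w x - z x) + riesz_potential D (\<lambda>y. w y - z y) x)"
    if w: "bounded_borel w" and z: "bounded_borel z" for w z x
  proof -
    define e where "e = (\<lambda>y. w y - z y)"
    have e: "bounded_borel e" unfolding e_def by (intro bounded_borel_diff w z)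
    let ?P = "riesz_potential D e x"
    have P0: "0 \<le> ?P" by (rule riesz_nonneg[OF body k])
    let ?q = "\<lambda>w \<xi>. ((w (far x \<xi>) - w x) \<bullet> unit_vec \<xi>) / sqrt (\<epsilon> * norm \<xi>)"
    let ?F = "\<lambda>w \<xi>. (\<omega> x * \<omega> (far x \<xi>) * (J (norm \<xi>) / sqrt (\<epsilon> * norm \<xi>)) * deriv f (?q w \<xi>)) *\<^sub>R unit_vec \<xi>"
    let ?\<psi> = "\<lambda>y. norm (e y) / norm (x - y)"
    let ?b = "\<lambda>\<xi>. indicator D (far x \<xi>) * ?\<psi> (far x \<xi>) + norm (e x) / \<epsilon> * (1 / norm \<xi>)"
    obtain Ce where Ce: "\<And>y. norm (e y) \<le> Ce" using bounded_borel_bound[OF e] by blast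
    have psi: "set_integrable lborel D ?\<psi>"
      using riesz_set_integrable[OF body k bounded_borel_measurable[OF e] Ce] .
    note a = ball_integral_affine_le[OF eps psi, of x]
    have bi: "set_integrable lborel (ball 0 1) ?b"
      using a(1) ki by (intro set_integral_add(1) set_integrable_mult_right) auto
    have bl: "(LINT \<xi>:ball 0 1|lborel. ?b \<xi>) \<le> ?P / \<epsilon> ^ CARD('n) + norm (e x) / \<epsilon> * \<kappa>1"
    proof -
      have "(LINT \<xi>:ball 0 1|lborel. ?b \<xi>) = (LINT \<xi>:ball 0 1|lborel. indicator D (far x \<xi>) * ?\<psi> (far x \<xi>))
         + norm (e x) / \<epsilon> * (LINT \<xi>:ball (0::real^'n) 1|lborel. 1 / norm \<xi>)"
        using a(1) set_integrable_mult_right[OF ki, of "norm (e x) / \<epsilon>"]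
        by (subst set_integral_add(2)) (simp_all only: set_integral_mult_right simp_thms, simp)
      also have "\<dots> \<le> ?P / \<epsilon> ^ CARD('n) + norm (e x) / \<epsilon> * \<kappa>1"
        using a(2) kl eps unfolding riesz_potential_def
        by (intro add_mono mult_left_mono) auto
      finally show ?thesis .
    qed
    have wt: "norm ((\<omega> x * \<omega> y * (J (norm \<xi>) / sqrt (\<epsilon> * norm \<xi>)) * s) *\<^sub>R unit_vec \<xi>)
       \<le> M * indicator D y * (\<bar>s\<bar> / sqrt (\<epsilon> * norm \<xi>))" for y \<xi> s
      using norm_bond_force_le[of x y \<xi> "s / sqrt (\<epsilon> * norm \<xi>)"] eps by simp
    have int: "set_integrable lborel (ball 0 1) (?F w)" if w: "bounded_borel w" for w
    proof -
      note [measurable] = w[THEN bounded_borel_measurable]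
      have B0: "0 \<le> B" using B[of 0] by linarith
      have [measurable]: "ball (0::real^'n) 1 \<in> sets borel" by simp
      show ?thesis
      proof (rule set_integrable_bound)
        show "set_integrable lborel (ball (0::real^'n) 1) (\<lambda>\<xi>. M * B * (1 + 1 / \<epsilon> * (1 / norm \<xi>)))"
          by (intro set_integrable_mult_right set_integral_add(1) ki
              bounded_borel_set_integrable[OF unit_ball bounded_borel_const])
        show "set_borel_measurable lborel (ball 0 1) (?F w)"
          unfolding set_borel_measurable_def measurable_lborel1 by measurable
        have bd: "norm (?F w \<xi>) \<le> M * B * (1 + 1 / \<epsilon> * (1 / norm \<xi>))" for \<xi>
        proof -
          \<comment> \<open>The weaker singularity of a single force is absorbed in the integrable kernel.\<close>
          have t: "1 / sqrt t \<le> 1 + 1 / t" if "0 \<le> t" for t :: real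
          proof (cases "t = 0")
            case False
            then have t: "0 < sqrt t" "t = sqrt t * sqrt t" using that by auto
            have "sqrt t \<le> sqrt t * sqrt t + 1"
              using sum_power2_ge_zero[of "sqrt t - 1/2" 0] by (simp add: power2_eq_square algebra_simps)
            then have "sqrt t / (sqrt t * sqrt t) \<le> (sqrt t * sqrt t + 1) / (sqrt t * sqrt t)"
              by (rule divide_right_mono) simp
            moreover have "sqrt t / (sqrt t * sqrt t) = 1 / sqrt t"
              using t(1) by (intro nonzero_divide_mult_cancel_left) simp
            moreover have "(sqrt t * sqrt t + 1) / (sqrt t * sqrt t) = 1 + 1 / t"
              using t by (simp add: add_divide_distrib)
            ultimately show ?thesis by simp
          qed simp
          have "norm (?F w \<xi>) \<le> M * indicator D (far x \<xi>) * (\<bar>deriv f (?q w \<xi>)\<bar> / sqrt (\<epsilon> * norm \<xi>))"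
            by (rule wt)
          also have "\<dots> \<le> M * 1 * (B / sqrt (\<epsilon> * norm \<xi>))"
            using M0 B B0 eps by (intro mult_mono divide_right_mono) (auto simp: indicator_def)
          also have "\<dots> = M * B * (1 / sqrt (\<epsilon> * norm \<xi>))" by simp
          also have "\<dots> \<le> M * B * (1 + 1 / (\<epsilon> * norm \<xi>))"
            using M0 B0 eps by (intro mult_left_mono t) auto
          finally show ?thesis by simp
        qed
        show "AE \<xi> in lborel. \<xi> \<in> ball 0 1 \<longrightarrow> norm (?F w \<xi>) \<le> norm (M * B * (1 + 1 / \<epsilon> * (1 / norm \<xi>)))"
          by (intro AE_I2 impI) (simp only: real_norm_def order_trans[OF bd abs_ge_self])
      qed
    qed
    have "norm ((LINT \<xi>:ball 0 1|lborel. ?F w \<xi>) - (LINT \<xi>:ball 0 1|lborel. ?F z \<xi>)) \<le> (LINT \<xi>:ball 0 1|lborel. (M * A) * ?b \<xi>)"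
    proof (intro set_integral_diff_bound int w z set_integrable_mult_right bi)
      fix \<xi> :: "real^'n"
      let ?y = "far x \<xi>" and ?r = "sqrt (\<epsilon> * norm \<xi>)"
      have rr: "?r * ?r = \<epsilon> * norm \<xi>" using eps by simp
      have r0: "0 \<le> ?r" using eps by simp
      have u: "\<bar>(e ?y - e x) \<bullet> unit_vec \<xi>\<bar> \<le> norm (e ?y) + norm (e x)"
        by (rule order_trans[OF inner_unit_vec_le norm_triangle_ineq4])
      have q: "?q w \<xi> - ?q z \<xi> = ((e ?y - e x) \<bullet> unit_vec \<xi>) / ?r"
        by (simp add: e_def diff_divide_distrib[symmetric] inner_diff_left)
      have "\<bar>deriv f (?q w \<xi>) - deriv f (?q z \<xi>)\<bar> \<le> A * \<bar>?q w \<xi> - ?q z \<xi>\<bar>" by (rule A)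
      also have "\<dots> \<le> A * ((norm (e ?y) + norm (e x)) / ?r)"
        unfolding q abs_divide abs_of_nonneg[OF r0] by (intro mult_left_mono A divide_right_mono u r0)
      finally have s: "\<bar>deriv f (?q w \<xi>) - deriv f (?q z \<xi>)\<bar> / ?r \<le> A * ((norm (e ?y) + norm (e x)) / ?r) / ?r"
        using r0 by (rule divide_right_mono)
      also have "\<dots> = A * ((norm (e ?y) + norm (e x)) / (\<epsilon> * norm \<xi>))"
        by (simp only: times_divide_eq_right divide_divide_eq_left rr)
      finally have s: "\<bar>deriv f (?q w \<xi>) - deriv f (?q z \<xi>)\<bar> / ?r \<le> A * ((norm (e ?y) + norm (e x)) / (\<epsilon> * norm \<xi>))" .
      have "?F w \<xi> - ?F z \<xi> = (\<omega> x * \<omega> ?y * (J (norm \<xi>) / ?r) * (deriv f (?q w \<xi>) - deriv f (?q z \<xi>))) *\<^sub>R unit_vec \<xi>"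
        by (simp only: right_diff_distrib scaleR_diff_left)
      then have "norm (?F w \<xi> - ?F z \<xi>) \<le> M * indicator D ?y * (\<bar>deriv f (?q w \<xi>) - deriv f (?q z \<xi>)\<bar> / ?r)"
        using wt by simp
      also have "\<dots> \<le> M * indicator D ?y * (A * ((norm (e ?y) + norm (e x)) / (\<epsilon> * norm \<xi>)))"
        using M0 s by (intro mult_left_mono) auto
      also have "\<dots> \<le> (M * A) * ?b \<xi>"
      proof -
        have "norm (x - ?y) = \<epsilon> * norm \<xi>" using eps by simp
        then have b: "?b \<xi> = indicator D ?y * (norm (e ?y) / (\<epsilon> * norm \<xi>)) + norm (e x) / (\<epsilon> * norm \<xi>)" by simp
        have "indicator D ?y * ((norm (e ?y) + norm (e x)) / (\<epsilon> * norm \<xi>)) \<le> ?b \<xi>"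
          unfolding b using eps by (auto simp: indicator_def add_divide_distrib)
        then have "(M * A) * (indicator D ?y * ((norm (e ?y) + norm (e x)) / (\<epsilon> * norm \<xi>))) \<le> (M * A) * ?b \<xi>"
          using M0 A(1) by (intro mult_left_mono) auto
        then show ?thesis by (simp only: mult_ac)
      qed
      finally show "norm (?F w \<xi> - ?F z \<xi>) \<le> (M * A) * ?b \<xi>" .
    qed
    also have "\<dots> = (M * A) * (LINT \<xi>:ball 0 1|lborel. ?b \<xi>)" by (rule set_integral_mult_right)
    also have "\<dots> \<le> (M * A) * (?P / \<epsilon> ^ CARD('n) + norm (e x) / \<epsilon> * \<kappa>1)"
      using M0 A(1) by (intro mult_left_mono bl) auto
    also have "\<dots> \<le> (M * A) * ((\<kappa>1 / \<epsilon> + 1 / \<epsilon> ^ CARD('n)) * (norm (e x) + ?P))"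
    proof (intro mult_left_mono)
      have "0 \<le> norm (e x) / \<epsilon> ^ CARD('n)" "0 \<le> \<kappa>1 * ?P / \<epsilon>" using eps k10 P0 by auto
      then show "?P / \<epsilon> ^ CARD('n) + norm (e x) / \<epsilon> * \<kappa>1 \<le> (\<kappa>1 / \<epsilon> + 1 / \<epsilon> ^ CARD('n)) * (norm (e x) + ?P)"
        by (simp add: algebra_simps)
    qed (use M0 A(1) in auto)
    finally have "?N * norm ((LINT \<xi>:ball 0 1|lborel. ?F w \<xi>) - (LINT \<xi>:ball 0 1|lborel. ?F z \<xi>))
       \<le> ?N * ((M * A) * ((\<kappa>1 / \<epsilon> + 1 / \<epsilon> ^ CARD('n)) * (norm (e x) + ?P)))"
      using V eps by (intro mult_left_mono) auto
    moreover have "norm (tensile_force \<epsilon> J \<omega> f w x - tensile_force \<epsilon> J \<omega> f z x) =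
        ?N * norm ((LINT \<xi>:ball 0 1|lborel. ?F w \<xi>) - (LINT \<xi>:ball 0 1|lborel. ?F z \<xi>))"
      using V eps unfolding tensile_force_def scaleR_diff_right[symmetric] by simp
    ultimately show ?thesis unfolding C_def e_def by (simp only: mult.assoc)
  qed
  with C0 show ?thesis by blast
qed

end

text \<open>The property of the force behind both stability of the scheme in L2 and consistency in the sup
  norm. The three terms come from the near end of a bond, from the strain and from the far end.\<close>

definition force_lipschitz ::
    "(real^'n) set \<Rightarrow> real \<Rightarrow> ((real^'n \<Rightarrow> real^'n) \<Rightarrow> real^'n \<Rightarrow> real^'n) \<Rightarrow> bool" where
  "force_lipschitz D C L \<longleftrightarrow> 0 \<le> C \<and> (\<forall>w z x. bounded_borel w \<longrightarrow> bounded_borel z \<longrightarrow>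
     norm (L w x - L z x) \<le>
       C * (norm (w x - z x) + (LINT y:D|lborel. norm (w y - z y)) + riesz_potential D (\<lambda>y. w y - z y) x))"

lemma bounded_derivs3_deriv_lipschitz:
  assumes "bounded_derivs3 f"
  obtains A B where "0 \<le> A" "\<And>s t. \<bar>deriv f s - deriv f t\<bar> \<le> A * \<bar>s - t\<bar>" "\<And>s. \<bar>deriv f s\<bar> \<le> B"
proof -
  have d: "\<And>i r. i < 3 \<Longrightarrow> ((deriv ^^ i) f) differentiable (at r)"
    and b: "\<And>i. i \<le> 3 \<Longrightarrow> bounded (range ((deriv ^^ i) f))"
    using assms by (auto simp: bounded_derivs3_def)
  have d1: "deriv f differentiable (at r)" for r using d[of 1 r] by simp
  have "bounded (range (deriv f))" using b[of 1] by simp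
  then obtain B where B: "\<And>s. \<bar>deriv f s\<bar> \<le> B" by (auto simp: bounded_iff)
  have "bounded (range (deriv (deriv f)))" using b[of 2] by (simp add: numeral_2_eq_2)
  then obtain A where A: "\<And>s. \<bar>deriv (deriv f) s\<bar> \<le> A" by (auto simp: bounded_iff)
  have A0: "0 \<le> A" using A[of 0] by linarith
  have "\<bar>deriv f s - deriv f t\<bar> \<le> A * \<bar>s - t\<bar>" for s t
  proof -
    have "(deriv f has_field_derivative deriv (deriv f) r) (at r within UNIV)" for r
      using d1 by (simp add: DERIV_deriv_iff_real_differentiable)
    from field_differentiable_bound[OF convex_UNIV this, of A s t] show ?thesis using A by simp
  qed
  then show thesis using that[OF A0 _ B] by blast
qed

lemma quadratic_deriv_lipschitz:
  assumes "quadratic_potential g"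
  obtains A where "0 \<le> A" "\<And>s t. \<bar>deriv g s - deriv g t\<bar> \<le> A * \<bar>s - t\<bar>"
proof -
  obtain \<beta> where b: "0 < \<beta>" "\<And>r. g r = \<beta> * r\<^sup>2 / 2" using assms by (auto simp: quadratic_potential_def)
  have g: "g = (\<lambda>r. \<beta> * r\<^sup>2 / 2)" using b(2) by auto
  have "deriv g r = \<beta> * r" for r
    unfolding g by (rule DERIV_imp_deriv) (auto intro!: derivative_eq_intros)
  then have "\<bar>deriv g s - deriv g t\<bar> \<le> \<beta> * \<bar>s - t\<bar>" for s t
    using b(1) by (simp add: right_diff_distrib[symmetric] abs_mult)
  then show thesis using that[of \<beta>] b(1) by simp
qed

lemma peri_force_lipschitz:
  fixes D :: "(real^'n) set"
  assumes dim: "2 \<le> CARD('n)" and D: "open D" "bounded D" "D \<noteq> {}" and eps: "0 < \<epsilon>"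
    and J: "influence_function J" and om: "boundary_function D \<gamma> \<epsilon> \<omega>"
    and f: "bounded_derivs3 f" and g: "quadratic_potential g \<or> bounded_derivs3 g"
    and k: "kernel_bound D \<kappa>"
  obtains C where "force_lipschitz D C (peri_force \<epsilon> J \<omega> f g)"
proof -
  obtain M where M: "0 \<le> M" "\<And>r. 0 \<le> r \<Longrightarrow> 0 \<le> J r" "\<And>r. 0 \<le> r \<Longrightarrow> J r \<le> M"
    "(\<lambda>\<xi>::real^'n. J (norm \<xi>)) \<in> borel_measurable borel"
    by (rule influence_function_facts[OF J, where 'a = "real^'n"]) blast
  have w0: "\<omega> \<in> holder0_space D \<gamma>" and w01: "\<And>x. x \<in> D \<Longrightarrow> 0 \<le> \<omega> x \<and> \<omega> x \<le> 1"
    using om by (auto simp: boundary_function_def)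
  have wD: "\<omega> x = 0" if "x \<notin> D" for x using w0 that by (auto simp: holder0_space_def C0_space_zero)
  have wb: "0 \<le> \<omega> x" "\<omega> x \<le> 1" for x using w01[of x] wD[of x] by (cases "x \<in> D"; simp)+
  have wm: "\<omega> \<in> borel_measurable borel" by (rule holder0_measurable[OF w0])
  have Db: "D \<in> sets borel" using D(1) by simp
  note finD = bounded_set_finite_measure[OF D(2)]
  obtain A B where A: "0 \<le> A" "\<And>s t. \<bar>deriv f s - deriv f t\<bar> \<le> A * \<bar>s - t\<bar>" "\<And>s. \<bar>deriv f s\<bar> \<le> B"
    using bounded_derivs3_deriv_lipschitz[OF f] by blast
  obtain A' where A': "0 \<le> A'" "\<And>s t. \<bar>deriv g s - deriv g t\<bar> \<le> A' * \<bar>s - t\<bar>"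
    using g quadratic_deriv_lipschitz[of g] bounded_derivs3_deriv_lipschitz[of g] by metis
  obtain C1 where C1: "0 \<le> C1" "\<forall>w z x. bounded_borel w \<longrightarrow> bounded_borel z \<longrightarrow>
     norm (tensile_force \<epsilon> J \<omega> f w x - tensile_force \<epsilon> J \<omega> f z x)
     \<le> C1 * (norm (w x - z x) + riesz_potential D (\<lambda>y. w y - z y) x)"
    using tensile_lipschitz[OF Db D(2) eps M wm wb wD A k dim] by blast
  obtain C2 where C2: "0 \<le> C2" "\<forall>w z x. bounded_borel w \<longrightarrow> bounded_borel z \<longrightarrow>
     norm (dilatational_force \<epsilon> J \<omega> g w x - dilatational_force \<epsilon> J \<omega> g z x)
     \<le> C2 * (norm (w x - z x) + (LINT y:D|lborel. norm (w y - z y)))"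
    using dilatational_lipschitz[OF Db D(2) eps M wm wb wD A'] by blast
  have "force_lipschitz D (C1 + C2) (peri_force \<epsilon> J \<omega> f g)"
    unfolding force_lipschitz_def
  proof (intro conjI allI impI)
    show "0 \<le> C1 + C2" using C1 C2 by simp
    fix w z :: "real^'n \<Rightarrow> real^'n" and x
    assume w: "bounded_borel w" and z: "bounded_borel z"
    let ?E = "LINT y:D|lborel. norm (w y - z y)" and ?P = "riesz_potential D (\<lambda>y. w y - z y) x"
    have E0: "0 \<le> ?E" by (intro set_integral_nonneg'[OF Db finD]) simp
    have P0: "0 \<le> ?P" by (rule riesz_nonneg[OF Db finD k])
    have "norm (peri_force \<epsilon> J \<omega> f g w x - peri_force \<epsilon> J \<omega> f g z x) \<le>
        norm (tensile_force \<epsilon> J \<omega> f w x - tensile_force \<epsilon> J \<omega> f z x) +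
        norm (dilatational_force \<epsilon> J \<omega> g w x - dilatational_force \<epsilon> J \<omega> g z x)"
      unfolding peri_force_def by (metis add_diff_add norm_triangle_ineq)
    also have "\<dots> \<le> C1 * (norm (w x - z x) + ?P) + C2 * (norm (w x - z x) + ?E)"
      by (intro add_mono C1(2)[rule_format] C2(2)[rule_format] w z)
    also have "\<dots> \<le> C1 * (norm (w x - z x) + ?E + ?P) + C2 * (norm (w x - z x) + ?E + ?P)"
      by (rule add_mono[OF mult_left_mono mult_left_mono]) (use C1(1) C2(1) E0 P0 in auto)
    finally show "norm (peri_force \<epsilon> J \<omega> f g w x - peri_force \<epsilon> J \<omega> f g z x)
        \<le> (C1 + C2) * (norm (w x - z x) + ?E + ?P)" by (simp only: distrib_right)
  qed
  then show thesis by (rule that)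
qed

section \<open>Consistency\<close>

lemma pw_const_cong: "(\<And>i. grid h i \<in> D \<Longrightarrow> a i = b i) \<Longrightarrow> pw_const D h a = pw_const D h b"
  by (auto simp: pw_const_def intro!: sum.cong)

lemma holder_scale_powr:
  fixes d :: nat
  assumes "0 < h" "0 \<le> H" "0 \<le> s" "s \<le> real d * h" "0 < \<gamma>"
  shows "H * s powr \<gamma> \<le> real d powr \<gamma> * H * h powr \<gamma>"
proof -
  have "s powr \<gamma> \<le> (real d * h) powr \<gamma>" using assms by (intro powr_mono2) auto
  also have "\<dots> = real d powr \<gamma> * h powr \<gamma>" using assms by (simp add: powr_mult)
  finally have "H * s powr \<gamma> \<le> H * (real d powr \<gamma> * h powr \<gamma>)" using assms by (intro mult_left_mono)
  then show ?thesis by (simp add: mult_ac)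
qed

context
  fixes D :: "(real^'n) set" and \<gamma> :: real
  assumes D: "open D" "bounded D" "D \<noteq> {}" and gam: "0 < \<gamma>"
begin

lemma domain_borel: "D \<in> sets borel" using D(1) by simp

lemmas domain = domain_borel bounded_set_finite_measure[OF D(2)]

lemma holder0_cell:
  fixes w :: "real^'n \<Rightarrow> real^'n"
  assumes h: "0 < h" and w: "w \<in> holder0_space D \<gamma>" and x: "x \<in> cell h i" "y \<in> cell h i"
  shows "norm (w x - w y) \<le> CARD('n) powr \<gamma> * holder_norm D \<gamma> w * h powr \<gamma>"
proof -
  have H0: "0 \<le> holder_norm D \<gamma> w"
    using w holder_norm_nonneg[OF D(1,3)] by (auto simp: holder0_space_def)
  have "norm (w x - w y) \<le> holder_norm D \<gamma> w * dist x y powr \<gamma>"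
    by (rule holder0_continuity[OF D(1,3) gam w])
  also have "\<dots> \<le> CARD('n) powr \<gamma> * holder_norm D \<gamma> w * h powr \<gamma>"
    using dist_same_cell_le[OF x] by (intro holder_scale_powr h H0 gam) (auto simp: dist_norm)
  finally show ?thesis .
qed

lemma holder0_cell_avg:
  fixes w :: "real^'n \<Rightarrow> real^'n"
  assumes h: "0 < h" and w: "w \<in> holder0_space D \<gamma>" and x: "x \<in> cell h i"
  shows "norm (cell_avg h w i - w x) \<le> CARD('n) powr \<gamma> * holder_norm D \<gamma> w * h powr \<gamma>"
  by (rule cell_avg_diff_const_le[OF h bounded_borel_holder0[OF D(1,3) w]]) (rule holder0_cell[OF h w _ x])

text \<open>In a cell whose grid point lies outside \<open>D\<close> the projection is zero, and so is the function
  at the grid point.\<close>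

lemma projection_error:
  fixes w :: "real^'n \<Rightarrow> real^'n"
  assumes h: "0 < h" and w: "w \<in> holder0_space D \<gamma>"
  shows "norm (pw_const D h (cell_avg h w) x - w x) \<le> CARD('n) powr \<gamma> * holder_norm D \<gamma> w * h powr \<gamma>"
proof -
  define i where "i = cell_index h x"
  have x: "x \<in> cell h i" using h by (simp add: mem_cell_iff i_def)
  show ?thesis
  proof (cases "grid h i \<in> D")
    case True
    then show ?thesis using holder0_cell_avg[OF h w x] pw_const_in_cell[OF D(2) h x] by simp
  next
    case False
    then have "w (grid h i) = 0" using w by (auto simp: holder0_space_def C0_space_zero)
    then show ?thesis
      using holder0_cell[OF h w grid_mem_cell[OF h] x] pw_const_in_cell[OF D(2) h x] False by simp
  qed
qed

subsection \<open>Time derivatives of averages and point values\<close>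

lemma cell_avg_time_deriv:
  fixes w w1 :: "real \<Rightarrow> real^'n \<Rightarrow> real^'n"
  assumes T: "0 < T" and h: "0 < h" and w: "\<And>t. t \<in> {0..T} \<Longrightarrow> w t \<in> holder0_space D \<gamma>"
    "\<And>t. t \<in> {0..T} \<Longrightarrow> w1 t \<in> holder0_space D \<gamma>"
    and d: "has_holder_time_deriv T D \<gamma> w w1" and t: "t \<in> {0..T}"
  shows "vector_derivative (\<lambda>s. cell_avg h (w s) i) (at t within {0..T}) = cell_avg h (w1 t) i"
proof (rule vector_derivative_within_closed_interval[OF T t])
  note bb = bounded_borel_holder0[where \<gamma> = \<gamma>, OF D(1,3)]
  show "((\<lambda>s. cell_avg h (w s) i) has_vector_derivative cell_avg h (w1 t) i) (at t within {0..T})"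
  proof (rule functional_has_vector_derivative[OF D(1,3) w d t, where \<Lambda> = "\<lambda>p. cell_avg h p i" and C = 1])
    fix p :: "real^'n \<Rightarrow> real^'n" assume p: "p \<in> holder0_space D \<gamma>"
    show "norm (cell_avg h p i) \<le> 1 * holder_norm D \<gamma> p"
      using norm_cell_avg_le[OF h bb[OF p], of i "holder_norm D \<gamma> p"] holder0_norm_le[OF D(1,3) p] by simp
  qed (use cell_avg_lincomb[OF h bb bb bb] in auto)
qed

lemma point_time_deriv:
  fixes w w1 :: "real \<Rightarrow> real^'n \<Rightarrow> real^'n"
  assumes T: "0 < T" and w: "\<And>t. t \<in> {0..T} \<Longrightarrow> w t \<in> holder0_space D \<gamma>"
    "\<And>t. t \<in> {0..T} \<Longrightarrow> w1 t \<in> holder0_space D \<gamma>"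
    and d: "has_holder_time_deriv T D \<gamma> w w1" and t: "t \<in> {0..T}"
  shows "vector_derivative (\<lambda>s. w s x) (at t within {0..T}) = w1 t x"
proof (rule vector_derivative_within_closed_interval[OF T t])
  show "((\<lambda>s. w s x) has_vector_derivative w1 t x) (at t within {0..T})"
    by (rule functional_has_vector_derivative[OF D(1,3) w d t, where \<Lambda> = "\<lambda>p. p x" and C = 1])
      (use holder0_norm_le[OF D(1,3)] in auto)
qed

subsection \<open>Truncation in time\<close>

text \<open>Pairing the truncation error \<open>r\<close> with itself reduces the estimate to the mean value theorem
  for the scalar function \<open>\<lambda>t. \<integral>\<^sub>D r \<bullet> w t\<close>: its second derivative is at most the product of
  the L2 norms of \<open>r\<close> and \<open>w2 t\<close>, so one factor of \<open>r\<close> cancels.\<close>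

lemma truncation_L2_bound:
  fixes w w1 w2 :: "real \<Rightarrow> real^'n \<Rightarrow> real^'n"
  assumes w: "C2_holder0 T D \<gamma> w w1 w2" and ab: "0 \<le> a" "a < b" "b \<le> T" and c: "c \<in> {a..b}"
    and S: "\<And>t. t \<in> {0..T} \<Longrightarrow> L2_norm D (w2 t) \<le> S"
  shows "L2_norm D (\<lambda>x. (1 / (b - a)) *\<^sub>R (w b x - w a x) - w1 c x) \<le> (b - a) * S"
proof -
  define r where "r = (\<lambda>x. (1 / (b - a)) *\<^sub>R (w b x - w a x) - w1 c x)"
  have h: "\<And>t. t \<in> {0..T} \<Longrightarrow> w t \<in> holder0_space D \<gamma>" "\<And>t. t \<in> {0..T} \<Longrightarrow> w1 t \<in> holder0_space D \<gamma>"
      "\<And>t. t \<in> {0..T} \<Longrightarrow> w2 t \<in> holder0_space D \<gamma>"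
    and d: "has_holder_time_deriv T D \<gamma> w w1" "has_holder_time_deriv T D \<gamma> w1 w2"
    using w by (auto simp: C2_holder0_def)
  note bb = bounded_borel_holder0[where \<gamma> = \<gamma>, OF D(1,3)]
  have r: "bounded_borel r"
    unfolding r_def using h ab c by (intro bounded_borel_diff bounded_borel_scale bb) auto
  define \<Lambda> where "\<Lambda> p = (LINT x:D|lborel. r x \<bullet> p x)" for p :: "real^'n \<Rightarrow> real^'n"
  note int = bounded_borel_set_integrable[OF domain]
  have lin: "\<Lambda> (\<lambda>x. s *\<^sub>R (p x - q x) - v x) = s *\<^sub>R (\<Lambda> p - \<Lambda> q) - \<Lambda> v"
    if "p \<in> holder0_space D \<gamma>" "q \<in> holder0_space D \<gamma>" "v \<in> holder0_space D \<gamma>" for s p q v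
  proof -
    have "set_integrable lborel D (\<lambda>x. r x \<bullet> p x)" "set_integrable lborel D (\<lambda>x. r x \<bullet> q x)"
      "set_integrable lborel D (\<lambda>x. r x \<bullet> v x)"
      by (intro int bounded_borel_inner r bb[OF that(1)] bb[OF that(2)] bb[OF that(3)])+
    then show ?thesis
      unfolding \<Lambda>_def by (simp add: inner_diff_right set_integral_diff)
  qed
  have CS: "\<bar>\<Lambda> p\<bar> \<le> L2_norm D r * L2_norm D p" if "bounded_borel p" for p
    unfolding \<Lambda>_def by (rule L2_Cauchy_Schwarz[OF domain r that])
  have bd: "norm (\<Lambda> p) \<le> (L2_norm D r * sqrt (measure lborel D)) * holder_norm D \<gamma> p"
    if p: "p \<in> holder0_space D \<gamma>" for p
  proof -
    have "0 \<le> holder_norm D \<gamma> p" using holder_norm_nonneg[OF D(1,3)] p by (auto simp: holder0_space_def)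
    then have "L2_norm D p \<le> sqrt (measure lborel D) * holder_norm D \<gamma> p"
      using holder0_norm_le[OF D(1,3) p] holder0_measurable[OF p]
      by (intro L2_norm_le_const[OF domain]) auto
    then have "L2_norm D r * L2_norm D p \<le> L2_norm D r * (sqrt (measure lborel D) * holder_norm D \<gamma> p)"
      by (intro mult_left_mono L2_norm_nonneg[OF domain])
    then show ?thesis using CS[OF bb[OF p]] by (simp add: mult.assoc)
  qed
  have D1: "((\<lambda>s. \<Lambda> (w s)) has_real_derivative \<Lambda> (w1 t)) (at t within {0..T})" if t: "t \<in> {0..T}" for t
    unfolding has_real_derivative_iff_has_vector_derivative
    by (rule functional_has_vector_derivative[OF D(1,3) h(1,2) d(1) t lin bd])
  have D2: "((\<lambda>s. \<Lambda> (w1 s)) has_real_derivative \<Lambda> (w2 t)) (at t within {0..T})" if t: "t \<in> {0..T}" for t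
    unfolding has_real_derivative_iff_has_vector_derivative
    by (rule functional_has_vector_derivative[OF D(1,3) h(2,3) d(2) t lin bd])
  have "\<exists>\<xi>\<in>{a..b}. \<Lambda> (w b) - \<Lambda> (w a) = \<Lambda> (w1 \<xi>) * (b - a)"
  proof (rule mvt_very_simple)
    fix x assume "a \<le> x" "x \<le> b"
    then have x: "x \<in> {0..T}" using ab by auto
    have "((\<lambda>s. \<Lambda> (w s)) has_real_derivative \<Lambda> (w1 x)) (at x within {a..b})"
      by (rule DERIV_subset[OF D1[OF x]]) (use ab in auto)
    then show "((\<lambda>s. \<Lambda> (w s)) has_derivative (*) (\<Lambda> (w1 x))) (at x within {a..b})"
      by (simp add: has_field_derivative_def)
  qed (use ab in auto)
  then obtain \<xi> where xi: "\<xi> \<in> {a..b}" "\<Lambda> (w b) - \<Lambda> (w a) = \<Lambda> (w1 \<xi>) * (b - a)" by blast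
  have S0: "0 \<le> S" using S[of a] ab order_trans[OF L2_norm_nonneg[OF domain]] by auto
  have "norm (\<Lambda> (w1 \<xi>) - \<Lambda> (w1 c)) \<le> (L2_norm D r * S) * norm (\<xi> - c)"
  proof (rule field_differentiable_bound[OF _ D2])
    fix t assume t: "t \<in> {0..T}"
    have "\<bar>\<Lambda> (w2 t)\<bar> \<le> L2_norm D r * L2_norm D (w2 t)" by (rule CS[OF bb[OF h(3)[OF t]]])
    also have "\<dots> \<le> L2_norm D r * S" by (intro mult_left_mono S t L2_norm_nonneg[OF domain])
    finally show "norm (\<Lambda> (w2 t)) \<le> L2_norm D r * S" by simp
  qed (use xi c ab in auto)
  also have "\<dots> \<le> (L2_norm D r * S) * (b - a)"
    using xi c S0 L2_norm_nonneg[OF domain, of r] by (intro mult_left_mono) auto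
  finally have le: "\<Lambda> (w1 \<xi>) - \<Lambda> (w1 c) \<le> (L2_norm D r * S) * (b - a)" by simp
  have "(L2_norm D r)\<^sup>2 = \<Lambda> r" unfolding \<Lambda>_def by (rule L2_norm_power2[OF domain])
  also have "\<dots> = (1 / (b - a)) *\<^sub>R (\<Lambda> (w b) - \<Lambda> (w a)) - \<Lambda> (w1 c)"
    unfolding r_def by (rule lin[of "w b" "w a" "w1 c" "1 / (b - a)", unfolded r_def]) (use h ab c in auto)
  also have "\<dots> = \<Lambda> (w1 \<xi>) - \<Lambda> (w1 c)" using xi(2) ab by simp
  finally have sq: "L2_norm D r * L2_norm D r \<le> L2_norm D r * ((b - a) * S)"
    using le by (simp add: power2_eq_square mult_ac)
  have "L2_norm D r \<le> (b - a) * S"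
  proof (cases "L2_norm D r = 0")
    case True
    then show ?thesis using S0 ab by simp
  next
    case False
    then have "0 < L2_norm D r" using L2_norm_nonneg[OF domain, of r] by linarith
    then show ?thesis using sq by simp
  qed
  then show ?thesis by (simp add: r_def)
qed

lemma tau_bound:
  fixes w w1 w2 :: "real \<Rightarrow> real^'n \<Rightarrow> real^'n"
  assumes T: "0 < T" and w: "C2_holder0 T D \<gamma> w w1 w2" and h: "0 < h" and dt: "0 < \<Delta>t"
    and k: "real (Suc k) * \<Delta>t \<le> T"
    and S: "\<And>t. t \<in> {0..T} \<Longrightarrow> L2_norm D (w2 t) \<le> S"
  shows "L2_norm D (pw_const D h (tau_u T w h \<Delta>t k)) \<le> \<Delta>t * S"
    and "L2_norm D (pw_const D h (tau_v T w h \<Delta>t k)) \<le> \<Delta>t * S"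
proof -
  let ?a = "real k * \<Delta>t" and ?b = "real (Suc k) * \<Delta>t"
  have hs: "\<And>t. t \<in> {0..T} \<Longrightarrow> w t \<in> holder0_space D \<gamma>" "\<And>t. t \<in> {0..T} \<Longrightarrow> w1 t \<in> holder0_space D \<gamma>"
    and d: "has_holder_time_deriv T D \<gamma> w w1"
    using w by (auto simp: C2_holder0_def)
  have ba: "?b - ?a = \<Delta>t" by (simp add: algebra_simps)
  have ab: "0 \<le> ?a" "?a < ?b" using dt by (auto simp: algebra_simps)
  then have at: "?a \<in> {0..T}" and bt: "?b \<in> {0..T}" using k by auto
  note bb = bounded_borel_holder0[where \<gamma> = \<gamma>, OF D(1,3)]
  have main: "L2_norm D (pw_const D h (\<lambda>i. cell_avg h (w1 c) i -
      (cell_avg h (w ?b) i - cell_avg h (w ?a) i) /\<^sub>R \<Delta>t)) \<le> \<Delta>t * S" if c: "c \<in> {?a..?b}" for c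
  proof -
    have ct: "c \<in> {0..T}" using c ab k by auto
    define r where "r = (\<lambda>x. (1 / (?b - ?a)) *\<^sub>R (w ?b x - w ?a x) - w1 c x)"
    have r: "bounded_borel r"
      unfolding r_def using hs at bt ct by (intro bounded_borel_diff bounded_borel_scale bb) auto
    have r0: "r x = 0" if "x \<notin> D" for x
      using that hs(1)[OF at] hs(1)[OF bt] hs(2)[OF ct] by (auto simp: r_def holder0_space_def C0_space_zero)
    have "cell_avg h r i = (1 / \<Delta>t) *\<^sub>R (cell_avg h (w ?b) i - cell_avg h (w ?a) i) - cell_avg h (w1 c) i" for i
      unfolding r_def ba using hs at bt ct by (intro cell_avg_lincomb h bb) auto
    then have "(\<lambda>i. cell_avg h (w1 c) i - (cell_avg h (w ?b) i - cell_avg h (w ?a) i) /\<^sub>R \<Delta>t)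
        = (\<lambda>i. (-1) *\<^sub>R cell_avg h r i)"
      by (auto simp: divide_inverse)
    then have "L2_norm D (pw_const D h (\<lambda>i. cell_avg h (w1 c) i - (cell_avg h (w ?b) i - cell_avg h (w ?a) i) /\<^sub>R \<Delta>t))
       = L2_norm D (\<lambda>x. (-1) *\<^sub>R pw_const D h (cell_avg h r) x)"
      by (simp only: pw_const_scale[abs_def])
    also have "\<dots> = L2_norm D (pw_const D h (cell_avg h r))"
      by (subst L2_norm_scale[OF domain]) simp
    also have "\<dots> \<le> L2_norm D r"
      by (rule L2_pw_const_cell_avg_le[OF domain_borel D(2) h r r0])
    also have "\<dots> \<le> (?b - ?a) * S"
      unfolding r_def by (rule truncation_L2_bound[OF w ab k c S])
    finally show ?thesis using ba by simp
  qed
  have tu: "tau_u T w h \<Delta>t k = (\<lambda>i. cell_avg h (w1 ?b) i - (cell_avg h (w ?b) i - cell_avg h (w ?a) i) /\<^sub>R \<Delta>t)"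
    using cell_avg_time_deriv[OF T h hs d bt] by (auto simp: tau_u_def)
  have tv: "tau_v T w h \<Delta>t k = (\<lambda>i. cell_avg h (w1 ?a) i - (cell_avg h (w ?b) i - cell_avg h (w ?a) i) /\<^sub>R \<Delta>t)"
    using cell_avg_time_deriv[OF T h hs d at] by (auto simp: tau_v_def)
  show "L2_norm D (pw_const D h (tau_u T w h \<Delta>t k)) \<le> \<Delta>t * S"
    unfolding tu by (rule main) (use ab in auto)
  show "L2_norm D (pw_const D h (tau_v T w h \<Delta>t k)) \<le> \<Delta>t * S"
    unfolding tv by (rule main) (use ab in auto)
qed

subsection \<open>Consistency and stability of the discretized force\<close>

context
  fixes L :: "(real^'n \<Rightarrow> real^'n) \<Rightarrow> real^'n \<Rightarrow> real^'n" and \<kappa> C :: real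
  assumes k: "kernel_bound D \<kappa>" and L: "force_lipschitz D C L"
begin

lemma force_lipschitz_nonneg: "0 \<le> C" "0 \<le> \<kappa>"
  using L k by (auto simp: force_lipschitz_def kernel_bound_def)

lemma force_sup_lipschitz:
  assumes w: "bounded_borel w" and z: "bounded_borel z" and le: "\<And>y. norm (w y - z y) \<le> \<eta>"
  shows "norm (L w x - L z x) \<le> C * (1 + measure lborel D + \<kappa>) * \<eta>"
proof -
  let ?e = "\<lambda>y. w y - z y"
  have e: "bounded_borel ?e" by (rule bounded_borel_diff[OF w z])
  have eta: "0 \<le> \<eta>" using le[of x] norm_ge_zero order_trans by blast
  have E: "(LINT y:D|lborel. norm (?e y)) \<le> measure lborel D * \<eta>"
  proof -
    have "(LINT y:D|lborel. norm (?e y)) \<le> (LINT y:D|lborel. \<eta>)"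
      by (intro set_integral_mono bounded_borel_set_integrable[OF domain]
          bounded_borel_norm e bounded_borel_const le)
    then show ?thesis using domain by (simp add: set_integral_const)
  qed
  have P: "riesz_potential D ?e x \<le> \<kappa> * \<eta>"
    by (rule riesz_le[OF domain k bounded_borel_measurable[OF e] le eta])
  have "norm (L w x - L z x) \<le> C * (norm (?e x) + (LINT y:D|lborel. norm (?e y)) + riesz_potential D ?e x)"
    using L w z by (simp add: force_lipschitz_def)
  also have "\<dots> \<le> C * (\<eta> + measure lborel D * \<eta> + \<kappa> * \<eta>)"
    using force_lipschitz_nonneg by (intro mult_left_mono add_mono E P le)
  finally show ?thesis by (simp add: algebra_simps)
qed

text \<open>The bound at a grid point carries over to every point of its cell, and then the L2 bound of the
  Riesz potential applies. The norm weighs a cell by its part inside \<open>D\<close>, as the norm of the initial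
  error does.\<close>

lemma force_pw_const_stable:
  assumes h: "0 < h"
  shows "L2_norm D (pw_const D h (\<lambda>i. L (pw_const D h a) (grid h i) - L (pw_const D h b) (grid h i)))
    \<le> C * ((1 + \<kappa>) + measure lborel D + (1 + real CARD('n)) * \<kappa>) * L2_norm D (pw_const D h (\<lambda>i. a i - b i))"
proof -
  define e where "e = pw_const D h (\<lambda>i. a i - b i)"
  let ?F = "pw_const D h (\<lambda>i. L (pw_const D h a) (grid h i) - L (pw_const D h b) (grid h i))"
  let ?P = "riesz_potential D e" and ?E = "LINT y:D|lborel. norm (e y)" and ?m = "measure lborel D"
  let ?d = "1 + real CARD('n)"
  note C0 = force_lipschitz_nonneg
  note bp = bounded_borel_pw_const[OF D(2) h]
  have e: "bounded_borel e" unfolding e_def by (rule bp)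
  have ed: "(\<lambda>y. pw_const D h a y - pw_const D h b y) = e" by (auto simp: e_def pw_const_diff)
  have E0: "0 \<le> ?E" by (intro set_integral_nonneg'[OF domain]) simp
  note P0 = riesz_nonneg[OF domain k, of e]
  have P: "bounded_borel ?P" by (rule riesz_bounded_borel[OF domain k e])
  define B where "B = (\<lambda>x. C *\<^sub>R ((1 + \<kappa>) *\<^sub>R norm (e x) + (?E + ?d *\<^sub>R ?P x)))"
  have B: "bounded_borel B"
    unfolding B_def by (intro bounded_borel_scale bounded_borel_add bounded_borel_norm bounded_borel_const e P)
  have B0: "0 \<le> B x" for x unfolding B_def using C0 E0 P0 by simp
  have "norm (?F x) \<le> norm (B x)" for x
  proof -
    define i where "i = cell_index h x"
    have x: "x \<in> cell h i" using h by (simp add: mem_cell_iff i_def)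
    show ?thesis
    proof (cases "grid h i \<in> D")
      case True
      have ex: "e x = a i - b i" using pw_const_in_cell[OF D(2) h x] True by (simp add: e_def)
      have eg: "e (grid h i) = a i - b i" using pw_const_grid[OF D(2) h True] by (simp add: e_def)
      have "?F x = L (pw_const D h a) (grid h i) - L (pw_const D h b) (grid h i)"
        using pw_const_in_cell[OF D(2) h x] True by simp
      moreover have "norm (L (pw_const D h a) (grid h i) - L (pw_const D h b) (grid h i))
          \<le> C * (norm (e (grid h i)) + ?E + ?P (grid h i))"
        unfolding ed[symmetric]
        using L[unfolded force_lipschitz_def, THEN conjunct2, rule_format, OF bp[of a] bp[of b], of "grid h i"] .
      ultimately have "norm (?F x) \<le> C * (norm (e (grid h i)) + ?E + ?P (grid h i))" by simp
      also have "\<dots> \<le> C * (norm (a i - b i) + ?E + (\<kappa> * norm (a i - b i) + ?d * ?P x))"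
        unfolding eg using riesz_at_grid_le[OF domain_borel D(2) k h True x, of "\<lambda>i. a i - b i"] C0
        by (intro mult_left_mono add_mono order_refl) (auto simp: e_def)
      also have "\<dots> = B x" unfolding B_def ex by (simp add: algebra_simps)
      finally show ?thesis using B0[of x] by simp
    qed (use pw_const_in_cell[OF D(2) h x] in simp)
  qed
  then have "L2_norm D ?F \<le> L2_norm D B"
    by (intro L2_norm_mono[OF domain B] bounded_borel_measurable[OF bp])
  also have "\<dots> = C * L2_norm D (\<lambda>x. (1 + \<kappa>) *\<^sub>R norm (e x) + (?E + ?d *\<^sub>R ?P x))"
    unfolding B_def using C0 by (subst L2_norm_scale[OF domain]) simp
  also have "\<dots> \<le> C * (((1 + \<kappa>) + ?m + ?d * \<kappa>) * L2_norm D e)"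
  proof (intro mult_left_mono C0)
    note tri = L2_norm_triangle[OF domain]
      and sc = L2_norm_scale[OF domain]
    have "L2_norm D (\<lambda>x. (1 + \<kappa>) *\<^sub>R norm (e x) + (?E + ?d *\<^sub>R ?P x))
       \<le> L2_norm D (\<lambda>x. (1 + \<kappa>) *\<^sub>R norm (e x)) + L2_norm D (\<lambda>x. ?E + ?d *\<^sub>R ?P x)"
      by (intro tri bounded_borel_scale bounded_borel_add bounded_borel_norm bounded_borel_const e P)
    also have "L2_norm D (\<lambda>x. (1 + \<kappa>) *\<^sub>R norm (e x)) = (1 + \<kappa>) * L2_norm D e"
      using C0 by (subst sc) (simp add: L2_norm_def)
    also have "L2_norm D (\<lambda>x. ?E + ?d *\<^sub>R ?P x) \<le> L2_norm D (\<lambda>x::real^'n. ?E) + L2_norm D (\<lambda>x. ?d *\<^sub>R ?P x)"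
      by (intro tri bounded_borel_scale bounded_borel_const P)
    also have "L2_norm D (\<lambda>x::real^'n. ?E) \<le> ?m * L2_norm D e"
    proof -
      have "sqrt ?m * ?E \<le> sqrt ?m * (sqrt ?m * L2_norm D e)"
        by (intro mult_left_mono L1_le_L2_norm[OF domain e]) simp
      then show ?thesis using E0 by (simp add: L2_norm_const[OF domain] mult.assoc[symmetric])
    qed
    also have "L2_norm D (\<lambda>x. ?d *\<^sub>R ?P x) \<le> ?d * (\<kappa> * L2_norm D e)"
      using riesz_L2_bound[OF domain k e]
      by (subst sc) (simp add: mult_left_mono)
    finally show "L2_norm D (\<lambda>x. (1 + \<kappa>) *\<^sub>R norm (e x) + (?E + ?d *\<^sub>R ?P x))
        \<le> ((1 + \<kappa>) + ?m + ?d * \<kappa>) * L2_norm D e" by (simp add: algebra_simps)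
  qed
  finally show ?thesis unfolding e_def by (simp add: mult.assoc)
qed

lemma sigma_u_bound:
  fixes w :: "real \<Rightarrow> real^'n \<Rightarrow> real^'n"
  assumes h: "0 < h" and w: "w (real n * \<Delta>t) \<in> holder0_space D \<gamma>"
    and H: "holder_norm D \<gamma> (w (real n * \<Delta>t)) \<le> H"
  shows "L2_norm D (pw_const D h (sigma_u D L w h \<Delta>t n))
    \<le> sqrt (measure lborel D) * (C * (1 + measure lborel D + \<kappa>) * (CARD('n) powr \<gamma> * H * h powr \<gamma>))"
proof (rule L2_pw_const_le[OF domain_borel D(2) h])
  let ?z = "w (real n * \<Delta>t)"
  have H0: "0 \<le> H" using H holder_norm_nonneg[OF D(1,3)] w by (fastforce simp: holder0_space_def)
  show "0 \<le> C * (1 + measure lborel D + \<kappa>) * (CARD('n) powr \<gamma> * H * h powr \<gamma>)"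
    using force_lipschitz_nonneg H0 by simp
  have "norm (pw_const D h (cell_avg h ?z) y - ?z y) \<le> CARD('n) powr \<gamma> * H * h powr \<gamma>" for y
    by (rule order_trans[OF projection_error[OF h w]]) (use H in \<open>auto intro!: mult_right_mono mult_left_mono\<close>)
  then show "norm (sigma_u D L w h \<Delta>t n i) \<le> C * (1 + measure lborel D + \<kappa>) * (CARD('n) powr \<gamma> * H * h powr \<gamma>)" for i
    unfolding sigma_u_def
    by (intro force_sup_lipschitz bounded_borel_pw_const D(2) h bounded_borel_holder0[OF D(1,3) w])
qed

end

lemma sigma_v_bound:
  fixes w w1 :: "real \<Rightarrow> real^'n \<Rightarrow> real^'n"
  assumes T: "0 < T" and h: "0 < h" and w: "\<And>t. t \<in> {0..T} \<Longrightarrow> w t \<in> holder0_space D \<gamma>"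
    "\<And>t. t \<in> {0..T} \<Longrightarrow> w1 t \<in> holder0_space D \<gamma>"
    and d: "has_holder_time_deriv T D \<gamma> w w1" and t: "real n * \<Delta>t \<in> {0..T}"
    and H: "holder_norm D \<gamma> (w1 (real n * \<Delta>t)) \<le> H"
  shows "L2_norm D (pw_const D h (sigma_v T w h \<Delta>t n))
    \<le> sqrt (measure lborel D) * (CARD('n) powr \<gamma> * H * h powr \<gamma>)"
proof (rule L2_pw_const_le[OF domain_borel D(2) h])
  let ?z = "w1 (real n * \<Delta>t)"
  have H0: "0 \<le> H" using H holder_norm_nonneg[OF D(1,3)] w(2)[OF t] by (fastforce simp: holder0_space_def)
  show "0 \<le> CARD('n) powr \<gamma> * H * h powr \<gamma>" using H0 by simp
  fix i
  have "sigma_v T w h \<Delta>t n i = ?z (grid h i) - cell_avg h ?z i"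
    using cell_avg_time_deriv[OF T h w d t] point_time_deriv[OF T w d t] by (simp add: sigma_v_def)
  then have "norm (sigma_v T w h \<Delta>t n i) \<le> CARD('n) powr \<gamma> * holder_norm D \<gamma> ?z * h powr \<gamma>"
    using holder0_cell_avg[OF h w(2)[OF t] grid_mem_cell[OF h]] by (simp add: norm_minus_commute)
  also have "\<dots> \<le> CARD('n) powr \<gamma> * H * h powr \<gamma>"
    using H by (auto intro!: mult_right_mono mult_left_mono)
  finally show "norm (sigma_v T w h \<Delta>t n i) \<le> CARD('n) powr \<gamma> * H * h powr \<gamma>" .
qed

end

section \<open>The error of the scheme\<close>

text \<open>By induction the error is at most \<open>(1 + A * \<Delta>t) ^ k\<close> times the initial error plus the
  accumulated defects, and that factor is at most \<open>exp (A * k * \<Delta>t)\<close>.\<close>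

lemma discrete_gronwall:
  fixes E :: "nat \<Rightarrow> real"
  assumes A: "0 \<le> A" and Q: "0 \<le> Q" and dt: "0 \<le> \<Delta>t" and E0: "0 \<le> E 0"
    and step: "\<And>k. k < n \<Longrightarrow> E (Suc k) \<le> (1 + A * \<Delta>t) * E k + \<Delta>t * Q"
  shows "E n \<le> exp (A * (real n * \<Delta>t)) * (E 0 + real n * \<Delta>t * Q)"
proof -
  let ?q = "1 + A * \<Delta>t"
  have q: "1 \<le> ?q" using A dt by simp
  have "k \<le> n \<Longrightarrow> E k \<le> ?q ^ k * (E 0 + real k * \<Delta>t * Q)" for k
  proof (induction k)
    case (Suc k)
    then have "E (Suc k) \<le> ?q * E k + \<Delta>t * Q" using step by simp
    also have "\<dots> \<le> ?q * (?q ^ k * (E 0 + real k * \<Delta>t * Q)) + ?q ^ Suc k * (\<Delta>t * Q)"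
    proof (intro add_mono mult_left_mono)
      have "1 * (\<Delta>t * Q) \<le> ?q ^ Suc k * (\<Delta>t * Q)"
        using dt Q q by (intro mult_right_mono one_le_power) auto
      then show "\<Delta>t * Q \<le> ?q ^ Suc k * (\<Delta>t * Q)" by simp
    qed (use Suc q in auto)
    also have "\<dots> = ?q ^ Suc k * (E 0 + real (Suc k) * \<Delta>t * Q)"
      by (simp add: algebra_simps)
    finally show ?case .
  qed simp
  then have "E n \<le> ?q ^ n * (E 0 + real n * \<Delta>t * Q)" by simp
  also have "\<dots> \<le> exp (A * (real n * \<Delta>t)) * (E 0 + real n * \<Delta>t * Q)"
  proof (rule mult_right_mono)
    have "?q ^ n \<le> exp (A * \<Delta>t) ^ n" using q exp_ge_add_one_self[of "A * \<Delta>t"] by (intro power_mono) auto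
    also have "\<dots> = exp (A * (real n * \<Delta>t))" by (simp add: exp_of_nat_mult[symmetric] mult_ac)
    finally show "?q ^ n \<le> exp (A * (real n * \<Delta>t))" .
  qed (use E0 dt Q in auto)
  finally show ?thesis .
qed

context
  fixes D :: "(real^'n) set" and \<gamma> \<kappa> C T :: real
    and L :: "(real^'n \<Rightarrow> real^'n) \<Rightarrow> real^'n \<Rightarrow> real^'n"
  assumes D: "open D" "bounded D" "D \<noteq> {}" and gam: "0 < \<gamma>" and T: "0 < T"
    and k: "kernel_bound D \<kappa>" and L: "force_lipschitz D C L"
begin

lemmas dom = domain[OF D gam]

abbreviation pw_norm :: "real \<Rightarrow> (int^'n \<Rightarrow> real^'n) \<Rightarrow> real"
  where "pw_norm h a \<equiv> L2_norm D (pw_const D h a)"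

lemma pw_norm_nonneg: "0 \<le> pw_norm h a"
  by (rule L2_norm_nonneg[OF dom])

lemma pw_norm_add:
  assumes "0 < h" shows "pw_norm h (\<lambda>i. a i + b i) \<le> pw_norm h a + pw_norm h b"
proof -
  have "pw_const D h (\<lambda>i. a i + b i) = (\<lambda>x. pw_const D h a x + pw_const D h b x)"
    by (rule ext) (rule pw_const_add)
  then show ?thesis
    using L2_norm_triangle[OF dom bounded_borel_pw_const[OF D(2) assms] bounded_borel_pw_const[OF D(2) assms]]
    by simp
qed

lemma pw_norm_scale: "pw_norm h (\<lambda>i. c *\<^sub>R a i) = \<bar>c\<bar> * pw_norm h a"
proof -
  have "pw_const D h (\<lambda>i. c *\<^sub>R a i) = (\<lambda>x. c *\<^sub>R pw_const D h a x)"
    by (rule ext) (rule pw_const_scale)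
  then show ?thesis by (simp add: L2_norm_scale[OF dom])
qed

definition grid_error :: "real \<Rightarrow> real \<Rightarrow> (real \<Rightarrow> real^'n \<Rightarrow> real^'n) \<Rightarrow> (nat \<Rightarrow> int^'n \<Rightarrow> real^'n) \<Rightarrow> nat \<Rightarrow> int^'n \<Rightarrow> real^'n"
  where "grid_error h \<Delta>t w wh n i = wh n i - cell_avg h (w (real n * \<Delta>t)) i"

lemma projection_L2:
  fixes w :: "real^'n \<Rightarrow> real^'n"
  assumes h: "0 < h" and w: "w \<in> holder0_space D \<gamma>" and H: "holder_norm D \<gamma> w \<le> H"
  shows "L2_norm D (\<lambda>x. pw_const D h (cell_avg h w) x - w x) \<le> sqrt (measure lborel D) * (CARD('n) powr \<gamma> * H * h powr \<gamma>)"
proof (rule L2_norm_le_const[OF dom])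
  have H0: "0 \<le> H" using H holder_norm_nonneg[OF D(1,3)] w by (fastforce simp: holder0_space_def)
  show "0 \<le> CARD('n) powr \<gamma> * H * h powr \<gamma>" using H0 by simp
  show "(\<lambda>x. pw_const D h (cell_avg h w) x - w x) \<in> borel_measurable borel"
    by (intro bounded_borel_measurable bounded_borel_diff bounded_borel_pw_const D(2) h
        bounded_borel_holder0[OF D(1,3) w])
  show "norm (pw_const D h (cell_avg h w) x - w x) \<le> CARD('n) powr \<gamma> * H * h powr \<gamma>" for x
    by (rule order_trans[OF projection_error[OF D gam h w]])
      (use H in \<open>auto intro!: mult_right_mono mult_left_mono\<close>)
qed

text \<open>Total error and grid error differ by the projection error of the solution.\<close>

lemma total_error_vs_grid_error:
  fixes w :: "real \<Rightarrow> real^'n \<Rightarrow> real^'n"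
  assumes h: "0 < h" and w: "w (real n * \<Delta>t) \<in> holder0_space D \<gamma>"
    and H: "holder_norm D \<gamma> (w (real n * \<Delta>t)) \<le> H"
  defines "P \<equiv> sqrt (measure lborel D) * (CARD('n) powr \<gamma> * H * h powr \<gamma>)"
  shows "L2_norm D (\<lambda>x. pw_const D h (wh n) x - w (real n * \<Delta>t) x) \<le> pw_norm h (grid_error h \<Delta>t w wh n) + P"
    and "pw_norm h (grid_error h \<Delta>t w wh n) \<le> L2_norm D (\<lambda>x. pw_const D h (wh n) x - w (real n * \<Delta>t) x) + P"
proof -
  let ?w = "w (real n * \<Delta>t)"
  let ?a = "\<lambda>x. pw_const D h (cell_avg h ?w) x - ?w x"
  let ?e = "\<lambda>x. pw_const D h (wh n) x - ?w x"
  note bp = bounded_borel_pw_const[OF D(2) h]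
  have wb: "bounded_borel ?w" by (rule bounded_borel_holder0[OF D(1,3) w])
  have ab: "bounded_borel ?a" "bounded_borel ?e" by (intro bounded_borel_diff bp wb)+
  have a: "L2_norm D ?a \<le> P" unfolding P_def by (rule projection_L2[OF h w H])
  have g: "pw_const D h (grid_error h \<Delta>t w wh n) = (\<lambda>x. pw_const D h (wh n) x - pw_const D h (cell_avg h ?w) x)"
    unfolding grid_error_def by (rule ext) (rule pw_const_diff)
  have "?e = (\<lambda>x. pw_const D h (grid_error h \<Delta>t w wh n) x + ?a x)" by (simp add: g)
  then have "L2_norm D ?e \<le> pw_norm h (grid_error h \<Delta>t w wh n) + L2_norm D ?a"
    using L2_norm_triangle[OF dom bp ab(1), of "grid_error h \<Delta>t w wh n"] by simp
  then show "L2_norm D ?e \<le> pw_norm h (grid_error h \<Delta>t w wh n) + P" using a by linarith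
  have "pw_const D h (grid_error h \<Delta>t w wh n) = (\<lambda>x. ?e x + (-1) *\<^sub>R ?a x)" by (simp add: g)
  then have "pw_norm h (grid_error h \<Delta>t w wh n) \<le> L2_norm D ?e + L2_norm D (\<lambda>x. (-1) *\<^sub>R ?a x)"
    using L2_norm_triangle[OF dom ab(2) bounded_borel_scale[OF ab(1)], of "-1"] by simp
  then show "pw_norm h (grid_error h \<Delta>t w wh n) \<le> L2_norm D ?e + P"
    using a by (subst (asm) L2_norm_scale[OF dom]) linarith
qed

definition stability_const :: real where
  "stability_const = C * ((1 + \<kappa>) + measure lborel D + (1 + real CARD('n)) * \<kappa>)"

definition spatial_const :: real where
  "spatial_const = sqrt (measure lborel D) * CARD('n) powr \<gamma> * (C * (1 + measure lborel D + \<kappa>) + 1)"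

lemma consts_nonneg: "0 \<le> stability_const" "0 \<le> spatial_const"
  using force_lipschitz_nonneg[OF D gam k L] by (auto simp: stability_const_def spatial_const_def)

text \<open>The exponential comes from the Gronwall argument, the last summand from the projection errors of
  displacement and velocity.\<close>

definition error_const :: real where
  "error_const = exp ((1 + 2 * stability_const) * T) * (1 + 3 * T * (1 + spatial_const)) +
     2 * (sqrt (measure lborel D) * CARD('n) powr \<gamma>)"

lemma error_const_nonneg: "0 \<le> error_const"
  using consts_nonneg T by (simp add: error_const_def)

lemma powr_tendsto_zero: "((\<lambda>h::real. c * h powr \<gamma>) \<longlongrightarrow> 0) (at_right 0)"
proof -
  have "((\<lambda>h::real. h powr \<gamma>) \<longlongrightarrow> 0 powr \<gamma>) (at_right 0)"
    using gam by (intro tendsto_powr') (auto simp: eventually_at_filter)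
  then show ?thesis using tendsto_mult_left[of _ 0 _ c] by simp
qed

lemma fd_error_nonneg: "0 \<le> fd_error D u v h \<Delta>t uh vh n"
  unfolding fd_error_def by (intro add_nonneg_nonneg L2_norm_nonneg[OF dom])

context
  fixes b u u1 u2 v v1 v2 :: "real \<Rightarrow> real^'n \<Rightarrow> real^'n"
  assumes sol: "peri_solution T D \<gamma> L b u u1 u2 v v1 v2"
begin

abbreviation S :: real where "S \<equiv> solution_L2_deriv_norm T D u2 v2"

abbreviation H :: real where "H \<equiv> solution_holder_norm T D \<gamma> u v v1"

lemma solution_bounds:
  assumes t: "t \<in> {0..T}"
  shows "L2_norm D (u2 t) \<le> S"
    and "L2_norm D (v2 t) \<le> S"
    and "holder_norm D \<gamma> (u t) \<le> H"
    and "holder_norm D \<gamma> (v t) \<le> H"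
    and "holder_norm D \<gamma> (v1 t) \<le> H"
proof -
  have u: "C2_holder0 T D \<gamma> u u1 u2" and v: "C2_holder0 T D \<gamma> v v1 v2" using sol by (auto simp: peri_solution_def)
  have L2_bounded: "\<exists>B. \<forall>t\<in>{0..T}. L2_norm D (w2 t) \<le> B" if w: "C2_holder0 T D \<gamma> w w1 w2" for w w1 w2 :: "real \<Rightarrow> real^'n \<Rightarrow> real^'n"
  proof -
    have w2: "\<And>t. t \<in> {0..T} \<Longrightarrow> w2 t \<in> holder0_space D \<gamma>" using w by (auto simp: C2_holder0_def)
    have "\<exists>B. \<forall>t\<in>{0..T}. holder_norm D \<gamma> (w2 t) \<le> B"
      using w by (intro holder_norm_bounded_on_interval[OF D(1,3)]) (auto simp: C2_holder0_def holder0_space_def)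
    then obtain B where B: "\<And>t. t \<in> {0..T} \<Longrightarrow> holder_norm D \<gamma> (w2 t) \<le> B" by blast
    have "L2_norm D (w2 t) \<le> sqrt (measure lborel D) * B" if t: "t \<in> {0..T}" for t
      using holder0_norm_le[OF D(1,3) w2[OF t]] B[OF t] holder0_measurable[OF w2[OF t]]
      by (intro L2_norm_le_const[OF dom]) (auto intro: order_trans order_trans[OF norm_ge_zero])
    then show ?thesis by blast
  qed
  have hn0: "0 \<le> holder_norm D \<gamma> w" if "w \<in> holder0_space D \<gamma>" for w :: "real^'n \<Rightarrow> real^'n"
    using that holder_norm_nonneg[OF D(1,3)] by (auto simp: holder0_space_def)
  have holder_bounded: "\<exists>B. \<forall>t\<in>{0..T}. holder_norm D \<gamma> (w t) \<le> B"
    if w: "\<And>t. t \<in> {0..T} \<Longrightarrow> w t \<in> holder0_space D \<gamma>" "\<And>t. t \<in> {0..T} \<Longrightarrow> w1 t \<in> holder0_space D \<gamma>"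
      "has_holder_time_deriv T D \<gamma> w w1" for w w1 :: "real \<Rightarrow> real^'n \<Rightarrow> real^'n"
  proof (rule holder_norm_bounded_on_interval[OF D(1,3)])
    show "w t \<in> holder_space D \<gamma>" if "t \<in> {0..T}" for t using w(1)[OF that] by (simp add: holder0_space_def)
    then show "((\<lambda>s. holder_norm D \<gamma> (\<lambda>x. w s x - w t x)) \<longlongrightarrow> 0) (at t within {0..T})" if "t \<in> {0..T}" for t
      using w by (intro holder_time_deriv_continuous[OF D(1,3) _ _ w(3) that]) (auto simp: holder0_space_def)
  qed
  have m: "\<And>t. t \<in> {0..T} \<Longrightarrow> u t \<in> holder0_space D \<gamma>" "\<And>t. t \<in> {0..T} \<Longrightarrow> u1 t \<in> holder0_space D \<gamma>"
    "\<And>t. t \<in> {0..T} \<Longrightarrow> v t \<in> holder0_space D \<gamma>" "\<And>t. t \<in> {0..T} \<Longrightarrow> v1 t \<in> holder0_space D \<gamma>"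
    "\<And>t. t \<in> {0..T} \<Longrightarrow> v2 t \<in> holder0_space D \<gamma>"
    and d: "has_holder_time_deriv T D \<gamma> u u1" "has_holder_time_deriv T D \<gamma> v v1" "has_holder_time_deriv T D \<gamma> v1 v2"
    using u v by (auto simp: C2_holder0_def)
  obtain A where A: "\<And>t. t \<in> {0..T} \<Longrightarrow> L2_norm D (u2 t) \<le> A" using L2_bounded[OF u] by blast
  obtain B where B: "\<And>t. t \<in> {0..T} \<Longrightarrow> L2_norm D (v2 t) \<le> B" using L2_bounded[OF v] by blast
  obtain a where a: "\<And>t. t \<in> {0..T} \<Longrightarrow> holder_norm D \<gamma> (u t) \<le> a" using holder_bounded[OF m(1,2) d(1)] by blast
  obtain a' where a': "\<And>t. t \<in> {0..T} \<Longrightarrow> holder_norm D \<gamma> (v t) \<le> a'" using holder_bounded[OF m(3,4) d(2)] by blast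
  obtain c where c: "\<And>t. t \<in> {0..T} \<Longrightarrow> holder_norm D \<gamma> (v1 t) \<le> c" using holder_bounded[OF m(4,5) d(3)] by blast
  have "L2_norm D (u2 t) + L2_norm D (v2 t) \<le> S"
    unfolding solution_L2_deriv_norm_def using A B t
    by (intro cSUP_upper bdd_aboveI2[of _ _ "A + B"] add_mono) auto
  then show "L2_norm D (u2 t) \<le> S" "L2_norm D (v2 t) \<le> S"
    using L2_norm_nonneg[OF dom, of "u2 t"] L2_norm_nonneg[OF dom, of "v2 t"] by linarith+
  have "holder_norm D \<gamma> (u t) + holder_norm D \<gamma> (v t) + holder_norm D \<gamma> (v1 t) \<le> H"
    unfolding solution_holder_norm_def using a a' c t
    by (intro cSUP_upper bdd_aboveI2[of _ _ "a + a' + c"] add_mono) auto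
  then show "holder_norm D \<gamma> (u t) \<le> H"
    "holder_norm D \<gamma> (v t) \<le> H"
    "holder_norm D \<gamma> (v1 t) \<le> H"
    using hn0[OF m(1)[OF t]] hn0[OF m(3)[OF t]] hn0[OF m(4)[OF t]] by linarith+
qed

lemma spatial_truncation_bound:
  assumes h: "0 < h" and t: "real n * \<Delta>t \<in> {0..T}"
  shows "pw_norm h (sigma_u D L u h \<Delta>t n) + pw_norm h (sigma_v T v h \<Delta>t n) \<le> spatial_const * H * h powr \<gamma>"
proof -
  have m: "\<And>t. t \<in> {0..T} \<Longrightarrow> u t \<in> holder0_space D \<gamma>" "\<And>t. t \<in> {0..T} \<Longrightarrow> v t \<in> holder0_space D \<gamma>"
    "\<And>t. t \<in> {0..T} \<Longrightarrow> v1 t \<in> holder0_space D \<gamma>" and d: "has_holder_time_deriv T D \<gamma> v v1"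
    using sol by (auto simp: peri_solution_def C2_holder0_def)
  have "pw_norm h (sigma_u D L u h \<Delta>t n) + pw_norm h (sigma_v T v h \<Delta>t n) \<le>
     sqrt (measure lborel D) * (C * (1 + measure lborel D + \<kappa>) * (CARD('n) powr \<gamma> * H * h powr \<gamma>)) +
     sqrt (measure lborel D) * (CARD('n) powr \<gamma> * H * h powr \<gamma>)"

    by (intro add_mono sigma_u_bound[OF D gam k L h] sigma_v_bound[OF D gam T h m(2,3) d t] m t
        solution_bounds(3,5))
  also have "\<dots> = spatial_const * H * h powr \<gamma>" by (simp add: spatial_const_def algebra_simps)
  finally show ?thesis .
qed

lemma time_truncation_bound:
  assumes h: "0 < h" and dt: "0 < \<Delta>t"
    and n: "real (Suc n) * \<Delta>t \<le> T"
  shows "pw_norm h (tau_u T u h \<Delta>t n) \<le> \<Delta>t * S" "pw_norm h (tau_v T v h \<Delta>t n) \<le> \<Delta>t * S"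
proof -
  have u: "C2_holder0 T D \<gamma> u u1 u2" and v: "C2_holder0 T D \<gamma> v v1 v2" using sol by (auto simp: peri_solution_def)
  show "pw_norm h (tau_u T u h \<Delta>t n) \<le> \<Delta>t * S"
    by (rule tau_bound(1)[OF D gam T u h dt n solution_bounds(1)])
  show "pw_norm h (tau_v T v h \<Delta>t n) \<le> \<Delta>t * S"
    by (rule tau_bound(2)[OF D gam T v h dt n solution_bounds(2)])
qed

text \<open>The velocity is advanced first and the new velocity advances the displacement, so the velocity
  defect enters twice and the displacement defect once, which explains the factor 3. The terms with
  \<open>\<Delta>t\<^sup>2\<close> are absorbed by \<open>\<Delta>t \<le> 1\<close>.\<close>

lemma grid_error_step:
  assumes h: "0 < h" and dt: "0 < \<Delta>t" "\<Delta>t \<le> 1"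
    and fd: "fd_scheme T D L b h \<Delta>t uh vh" and n: "real (Suc n) * \<Delta>t \<le> T"
  defines "E \<equiv> \<lambda>n. pw_norm h (grid_error h \<Delta>t u uh n) + pw_norm h (grid_error h \<Delta>t v vh n)"
  shows "E (Suc n) \<le> (1 + (1 + 2 * stability_const) * \<Delta>t) * E n + \<Delta>t * (3 * (\<Delta>t * S + spatial_const * H * h powr \<gamma>))"
proof -
  let ?t = "real n * \<Delta>t" and ?s = "real (Suc n) * \<Delta>t"
  let ?eu = "grid_error h \<Delta>t u uh" and ?ev = "grid_error h \<Delta>t v vh"
  let ?\<tau>u = "tau_u T u h \<Delta>t n" and ?\<tau>v = "tau_v T v h \<Delta>t n"
  let ?\<sigma>u = "sigma_u D L u h \<Delta>t n" and ?\<sigma>v = "sigma_v T v h \<Delta>t n"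
  let ?G = "\<lambda>i. L (pw_const D h (uh n)) (grid h i) - L (pw_const D h (cell_avg h (u ?t))) (grid h i)"
  let ?Q = "\<Delta>t * S + spatial_const * H * h powr \<gamma>"
  have m: "\<And>t. t \<in> {0..T} \<Longrightarrow> u t \<in> holder0_space D \<gamma>" "\<And>t. t \<in> {0..T} \<Longrightarrow> u1 t \<in> holder0_space D \<gamma>"
    "\<And>t. t \<in> {0..T} \<Longrightarrow> v t \<in> holder0_space D \<gamma>" "\<And>t. t \<in> {0..T} \<Longrightarrow> v1 t \<in> holder0_space D \<gamma>"
    and d: "has_holder_time_deriv T D \<gamma> u u1" "has_holder_time_deriv T D \<gamma> v v1"
    and eq: "\<And>t x. t \<in> {0..T} \<Longrightarrow> x \<in> D \<Longrightarrow> u1 t x = v t x" "\<And>t x. t \<in> {0..T} \<Longrightarrow> x \<in> D \<Longrightarrow> v1 t x = L (u t) x + b t x"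
    using sol by (auto simp: peri_solution_def C2_holder0_def)
  have "?t \<le> ?s" using dt by (simp add: algebra_simps)
  moreover have "0 \<le> ?t" using dt by simp
  ultimately have t: "?t \<in> {0..T}" and s: "?s \<in> {0..T}" using n by auto
  \<comment> \<open>The equation holds on \<open>D\<close>, and both sides vanish elsewhere.\<close>
  have u1v: "u1 ?s = v ?s"
  proof
    fix x show "u1 ?s x = v ?s x"
      using eq(1)[OF s] m(2)[OF s] m(3)[OF s] by (cases "x \<in> D") (auto simp: holder0_space_def C0_space_zero)
  qed
  have ev: "?ev (Suc n) i = ?ev n i + \<Delta>t *\<^sub>R (?G i + (?\<tau>v i + (?\<sigma>u i + ?\<sigma>v i)))" if i: "grid h i \<in> D" for i
  proof -
    have "(vh (Suc n) i - vh n i) /\<^sub>R \<Delta>t = L (pw_const D h (uh n)) (grid h i) + b ?t (grid h i)"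
      using fd n i unfolding fd_scheme_def by blast
    then have "\<Delta>t *\<^sub>R ((vh (Suc n) i - vh n i) /\<^sub>R \<Delta>t) = \<Delta>t *\<^sub>R (L (pw_const D h (uh n)) (grid h i) + b ?t (grid h i))"
      by (rule arg_cong)
    then have 1: "vh (Suc n) i - vh n i = \<Delta>t *\<^sub>R (L (pw_const D h (uh n)) (grid h i) + b ?t (grid h i))"
      using dt by simp
    have pd: "vector_derivative (\<lambda>s. v s (grid h i)) (at ?t within {0..T}) = L (u ?t) (grid h i) + b ?t (grid h i)"
      using point_time_deriv[where w = v and ?w1.0 = v1 and x = "grid h i", OF D gam T m(3,4) d(2) t] eq(2)[OF t i]
      by (rule trans)
    \<comment> \<open>The cell-average time derivatives in \<open>tau_v\<close> and \<open>sigma_v\<close> cancel; the equation of motion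
      at the grid point then cancels the exact forces.\<close>
    have GE: "?G i + (?\<tau>v i + (?\<sigma>u i + ?\<sigma>v i)) = (L (pw_const D h (uh n)) (grid h i) + b ?t (grid h i))
        - (cell_avg h (v ?s) i - cell_avg h (v ?t) i) /\<^sub>R \<Delta>t"
      unfolding tau_v_def sigma_u_def sigma_v_def pd by simp
    have "\<Delta>t *\<^sub>R ((cell_avg h (v ?s) i - cell_avg h (v ?t) i) /\<^sub>R \<Delta>t) = cell_avg h (v ?s) i - cell_avg h (v ?t) i"
      using dt by simp
    then have "\<Delta>t *\<^sub>R (?G i + (?\<tau>v i + (?\<sigma>u i + ?\<sigma>v i))) = (vh (Suc n) i - vh n i) - (cell_avg h (v ?s) i - cell_avg h (v ?t) i)"
      by (simp only: GE 1 scaleR_diff_right[of \<Delta>t "_ + _"])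
    then show ?thesis by (simp add: grid_error_def)
  qed
  have eu: "?eu (Suc n) i = ?eu n i + \<Delta>t *\<^sub>R (?ev (Suc n) i + ?\<tau>u i)" if i: "grid h i \<in> D" for i
  proof -
    have "(uh (Suc n) i - uh n i) /\<^sub>R \<Delta>t = vh (Suc n) i"
      using fd n i unfolding fd_scheme_def by blast
    then have "\<Delta>t *\<^sub>R ((uh (Suc n) i - uh n i) /\<^sub>R \<Delta>t) = \<Delta>t *\<^sub>R vh (Suc n) i"
      by (rule arg_cong)
    then have 1: "uh (Suc n) i - uh n i = \<Delta>t *\<^sub>R vh (Suc n) i"
      using dt by simp
    have pd: "vector_derivative (\<lambda>s. cell_avg h (u s) i) (at ?s within {0..T}) = cell_avg h (v ?s) i"
      using cell_avg_time_deriv[where w = u and ?w1.0 = u1 and i = i, OF D gam T h m(1,2) d(1) s] unfolding u1v .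
    have "?ev (Suc n) i + ?\<tau>u i = vh (Suc n) i - (cell_avg h (u ?s) i - cell_avg h (u ?t) i) /\<^sub>R \<Delta>t"
      unfolding tau_u_def grid_error_def pd by simp
    then have "\<Delta>t *\<^sub>R (?ev (Suc n) i + ?\<tau>u i) = (uh (Suc n) i - uh n i) - (cell_avg h (u ?s) i - cell_avg h (u ?t) i)"
      unfolding 1 using dt by (simp add: scaleR_diff_right)
    then show ?thesis by (simp add: grid_error_def)
  qed
  have G: "pw_norm h ?G \<le> stability_const * pw_norm h (?eu n)"
    using force_pw_const_stable[OF D gam k L h, of "uh n" "cell_avg h (u ?t)"]
    by (simp add: stability_const_def grid_error_def[abs_def])
  have tau: "pw_norm h ?\<tau>u \<le> \<Delta>t * S" "pw_norm h ?\<tau>v \<le> \<Delta>t * S"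
    by (rule time_truncation_bound[OF h dt(1) n])+
  have sig: "pw_norm h ?\<sigma>u + pw_norm h ?\<sigma>v \<le> spatial_const * H * h powr \<gamma>"
    by (rule spatial_truncation_bound[OF h t])
  have sig0: "0 \<le> spatial_const * H * h powr \<gamma>"
    using sig pw_norm_nonneg[of h ?\<sigma>u] pw_norm_nonneg[of h ?\<sigma>v] by linarith
  have tau0: "0 \<le> \<Delta>t * S" using tau(1) pw_norm_nonneg[of h ?\<tau>u] by linarith
  note st0 = consts_nonneg(1)
  let ?a = "pw_norm h (?eu n)" and ?c = "pw_norm h (?ev n)"
  let ?a' = "pw_norm h (?eu (Suc n))" and ?c' = "pw_norm h (?ev (Suc n))"
  have "?c' = pw_norm h (\<lambda>i. ?ev n i + \<Delta>t *\<^sub>R (?G i + (?\<tau>v i + (?\<sigma>u i + ?\<sigma>v i))))"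
    by (intro arg_cong[where f = "L2_norm D"] pw_const_cong ev)
  also have "\<dots> \<le> ?c + \<bar>\<Delta>t\<bar> * (pw_norm h ?G + (pw_norm h ?\<tau>v + (pw_norm h ?\<sigma>u + pw_norm h ?\<sigma>v)))"
    by (intro order_trans[OF pw_norm_add[OF h]] add_left_mono order_trans[OF eq_refl[OF pw_norm_scale]] mult_left_mono abs_ge_zero order_refl)
  also have "\<dots> \<le> ?c + \<Delta>t * (stability_const * ?a + ?Q)"
    using dt G tau sig by (intro add_left_mono) (simp add: mult_left_mono)
  finally have c: "?c' \<le> ?c + \<Delta>t * (stability_const * ?a + ?Q)" .
  have "?a' = pw_norm h (\<lambda>i. ?eu n i + \<Delta>t *\<^sub>R (?ev (Suc n) i + ?\<tau>u i))"
    by (intro arg_cong[where f = "L2_norm D"] pw_const_cong eu)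
  also have "\<dots> \<le> ?a + \<bar>\<Delta>t\<bar> * (?c' + pw_norm h ?\<tau>u)"
    by (intro order_trans[OF pw_norm_add[OF h]] add_left_mono order_trans[OF eq_refl[OF pw_norm_scale]] mult_left_mono abs_ge_zero order_refl)
  also have "\<dots> \<le> ?a + \<Delta>t * (?c' + ?Q)"
    using dt tau sig0 by (intro add_left_mono) (simp add: mult_left_mono)
  finally have a: "?a' \<le> ?a + \<Delta>t * (?c' + ?Q)" .
  let ?X = "stability_const * ?a + ?Q"
  have X0: "0 \<le> ?X" using st0 pw_norm_nonneg[of h "?eu n"] tau0 sig0 by simp
  have "\<Delta>t * ?c' \<le> \<Delta>t * (?c + \<Delta>t * ?X)" using c dt by (intro mult_left_mono) auto
  also have "\<dots> \<le> \<Delta>t * (?c + 1 * ?X)" using dt X0 by (intro mult_left_mono add_left_mono mult_right_mono) auto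
  finally have dc: "\<Delta>t * ?c' \<le> \<Delta>t * ?c + \<Delta>t * ?X" by (simp add: distrib_left)
  have "E (Suc n) \<le> ?a + \<Delta>t * ?Q + \<Delta>t * ?c' + ?c'"
    using a by (simp add: E_def distrib_left)
  also have "\<dots> \<le> ?a + \<Delta>t * ?Q + (\<Delta>t * ?c + \<Delta>t * ?X) + (?c + \<Delta>t * ?X)"
    using dc c by linarith
  also have "\<dots> = E n + \<Delta>t * (?c + 2 * stability_const * ?a) + \<Delta>t * (3 * ?Q)"
    by (simp add: E_def algebra_simps)
  also have "\<dots> \<le> E n + \<Delta>t * ((1 + 2 * stability_const) * E n) + \<Delta>t * (3 * ?Q)"
  proof -
    have "0 \<le> ?a + 2 * stability_const * ?c"
      using st0 pw_norm_nonneg[of h "?eu n"] pw_norm_nonneg[of h "?ev n"] by simp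
    then have "?c + 2 * stability_const * ?a \<le> (1 + 2 * stability_const) * E n"
      by (simp add: E_def algebra_simps)
    then show ?thesis using dt by (simp add: mult_left_mono)
  qed
  finally show ?thesis by (simp add: algebra_simps)
qed

lemma fd_error_estimate:
  assumes h: "0 < h" and dt: "0 < \<Delta>t" "\<Delta>t \<le> 1"
    and fd: "fd_scheme T D L b h \<Delta>t uh vh" and n: "real n * \<Delta>t \<le> T"
  defines "E \<equiv> \<lambda>n. pw_norm h (grid_error h \<Delta>t u uh n) + pw_norm h (grid_error h \<Delta>t v vh n)"
  shows "fd_error D u v h \<Delta>t uh vh n \<le> error_const * (E 0 + S * \<Delta>t + H * h powr \<gamma>)"
proof -
  let ?A = "1 + 2 * stability_const" and ?Q = "\<Delta>t * S + spatial_const * H * h powr \<gamma>"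
  let ?P = "sqrt (measure lborel D) * CARD('n) powr \<gamma>"
  have t: "real n * \<Delta>t \<in> {0..T}" using n dt by simp
  have m: "\<And>t. t \<in> {0..T} \<Longrightarrow> u t \<in> holder0_space D \<gamma>" "\<And>t. t \<in> {0..T} \<Longrightarrow> v t \<in> holder0_space D \<gamma>"
    using sol by (auto simp: peri_solution_def C2_holder0_def)
  have z: "0 \<in> {0..T}" using T by simp
  have S0: "0 \<le> S"
    using solution_bounds(1)[OF z] L2_norm_nonneg[OF dom, of "u2 0"] by linarith
  have H0: "0 \<le> H"
    using solution_bounds(3)[OF z] holder_norm_nonneg[OF D(1,3)] m(1)[OF z] by (fastforce simp: holder0_space_def)
  have E0: "0 \<le> E k" for k unfolding E_def by (intro add_nonneg_nonneg pw_norm_nonneg)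
  have Q0: "0 \<le> ?Q" using S0 H0 dt consts_nonneg by simp
  have "E n \<le> exp (?A * (real n * \<Delta>t)) * (E 0 + real n * \<Delta>t * (3 * ?Q))"
  proof (rule discrete_gronwall)
    fix j assume j: "j < n"
    then have "real (Suc j) * \<Delta>t \<le> real n * \<Delta>t" using dt by (intro mult_right_mono) auto
    then have "real (Suc j) * \<Delta>t \<le> T" using n by linarith
    then show "E (Suc j) \<le> (1 + ?A * \<Delta>t) * E j + \<Delta>t * (3 * ?Q)"
      unfolding E_def by (rule grid_error_step[OF h dt fd])
  qed (use consts_nonneg Q0 dt E0 in auto)
  also have "\<dots> \<le> exp (?A * T) * (E 0 + T * (3 * ?Q))"
    using n dt consts_nonneg Q0 E0[of 0]
    by (intro mult_mono add_left_mono mult_right_mono) (auto intro!: mult_left_mono add_nonneg_nonneg mult_nonneg_nonneg)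
  finally have En: "E n \<le> exp (?A * T) * (E 0 + T * (3 * ?Q))" .
  have "fd_error D u v h \<Delta>t uh vh n \<le> E n + 2 * (?P * (H * h powr \<gamma>))"
    using total_error_vs_grid_error(1)[where w = u and wh = uh, OF h m(1)[OF t] solution_bounds(3)[OF t]]
      total_error_vs_grid_error(1)[where w = v and wh = vh, OF h m(2)[OF t] solution_bounds(4)[OF t]]
    by (simp add: fd_error_def E_def mult.assoc)
  also have "\<dots> \<le> exp (?A * T) * (E 0 + T * (3 * ?Q)) + 2 * (?P * (H * h powr \<gamma>))" using En by simp
  also have "\<dots> \<le> error_const * (E 0 + S * \<Delta>t + H * h powr \<gamma>)"
  proof -
    let ?Y = "E 0 + S * \<Delta>t + H * h powr \<gamma>"
    have nn: "0 \<le> S * \<Delta>t" "0 \<le> H * h powr \<gamma>" using S0 H0 dt by auto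
    have "?Q \<le> (1 + spatial_const) * (S * \<Delta>t + H * h powr \<gamma>)"
      using nn mult_nonneg_nonneg[OF nn(1) consts_nonneg(2)] by (simp add: algebra_simps)
    also have "\<dots> \<le> (1 + spatial_const) * ?Y"
      using E0[of 0] consts_nonneg(2) by (intro mult_left_mono) auto
    finally have "3 * T * ?Q \<le> 3 * T * ((1 + spatial_const) * ?Y)" using T by (intro mult_left_mono) auto
    moreover have "E 0 \<le> ?Y" using nn by simp
    ultimately have "E 0 + T * (3 * ?Q) \<le> (1 + 3 * T * (1 + spatial_const)) * ?Y"
      by (simp add: algebra_simps)
    then have "exp (?A * T) * (E 0 + T * (3 * ?Q)) \<le> exp (?A * T) * ((1 + 3 * T * (1 + spatial_const)) * ?Y)"
      by (intro mult_left_mono) auto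
    moreover have "2 * (?P * (H * h powr \<gamma>)) \<le> 2 * (?P * ?Y)"
      using nn E0[of 0] by (intro mult_left_mono) auto
    moreover have "error_const * y = exp (?A * T) * ((1 + 3 * T * (1 + spatial_const)) * y) + 2 * (?P * y)" for y
      by (simp only: error_const_def distrib_right[of _ _ y] mult.assoc)
    ultimately show ?thesis by (simp only:)
  qed
  finally show ?thesis .
qed

lemma consistency_in_time:
  shows "consistent_in_time T D \<epsilon> u v"
  unfolding consistent_in_time_def
proof (intro allI impI)
  fix \<eta> :: real assume eta: "0 < \<eta>"
  have "((\<lambda>t. t * S) \<longlongrightarrow> 0 * S) (at_right 0)" by (intro tendsto_intros)
  then have "\<forall>\<^sub>F \<Delta>t in at_right 0. \<Delta>t * S < \<eta>" using eta by (auto dest: order_tendstoD(2))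
  moreover have "\<forall>\<^sub>F \<Delta>t in at_right (0::real). 0 < \<Delta>t" by (rule eventually_at_right_less)
  ultimately show "\<forall>\<^sub>F \<Delta>t in at_right 0. \<forall>h\<in>{0<..<\<epsilon>}. \<forall>n. real (Suc n) * \<Delta>t \<le> T \<longrightarrow>
       pw_norm h (tau_u T u h \<Delta>t n) < \<eta> \<and> pw_norm h (tau_v T v h \<Delta>t n) < \<eta>"
  proof eventually_elim
    case (elim \<Delta>t)
    show ?case
    proof (intro ballI allI impI)
      fix h :: real and n :: nat assume "h \<in> {0<..<\<epsilon>}" and n: "real (Suc n) * \<Delta>t \<le> T"
      then have h: "0 < h" by simp
      show "pw_norm h (tau_u T u h \<Delta>t n) < \<eta> \<and> pw_norm h (tau_v T v h \<Delta>t n) < \<eta>"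
        using time_truncation_bound[OF h elim(2) n] elim(1) by linarith
    qed
  qed
qed

lemma consistency_in_space:
  shows "consistent_in_space T D L u v"
  unfolding consistent_in_space_def
proof (intro allI impI)
  fix \<eta> :: real assume eta: "0 < \<eta>"
  have "\<forall>\<^sub>F h in at_right 0. spatial_const * H * h powr \<gamma> < \<eta>"
    using powr_tendsto_zero eta by (rule order_tendstoD(2))
  moreover have "\<forall>\<^sub>F h in at_right (0::real). 0 < h" by (rule eventually_at_right_less)
  ultimately show "\<forall>\<^sub>F h in at_right 0. \<forall>\<Delta>t>0. \<forall>n. real n * \<Delta>t \<le> T \<longrightarrow>
       pw_norm h (sigma_u D L u h \<Delta>t n) < \<eta> \<and> pw_norm h (sigma_v T v h \<Delta>t n) < \<eta>"
  proof eventually_elim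
    case (elim h)
    show ?case
    proof (intro allI impI)
      fix \<Delta>t :: real and n :: nat assume "0 < \<Delta>t" "real n * \<Delta>t \<le> T"
      then have "real n * \<Delta>t \<in> {0..T}" by simp
      from spatial_truncation_bound[OF elim(2) this]
      show "pw_norm h (sigma_u D L u h \<Delta>t n) < \<eta> \<and> pw_norm h (sigma_v T v h \<Delta>t n) < \<eta>"
        using elim(1) pw_norm_nonneg[of h "sigma_u D L u h \<Delta>t n"] pw_norm_nonneg[of h "sigma_v T v h \<Delta>t n"]
        by linarith
    qed
  qed
qed

text \<open>The grid error at time zero is at most the given initial error plus the projection error of the
  initial data, so the error estimate tends to zero along every family whose initial error does.\<close>

lemma convergence:
  assumes eps: "0 < \<epsilon>"
  shows "scheme_converges T D \<epsilon> L b u v"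
  unfolding scheme_converges_def
proof (intro allI impI, elim conjE)
  fix uh vh
  let ?F = "at_right (0::real) \<times>\<^sub>F at_right (0::real)"
  let ?e0 = "\<lambda>(h, \<Delta>t). fd_error D u v h \<Delta>t (uh h \<Delta>t) (vh h \<Delta>t) 0"
  let ?sup = "\<lambda>(h, \<Delta>t). SUP n\<in>{n. real n * \<Delta>t \<le> T}. fd_error D u v h \<Delta>t (uh h \<Delta>t) (vh h \<Delta>t) n"
  let ?P = "2 * (sqrt (measure lborel D) * CARD('n) powr \<gamma>) * H"
  assume fd: "\<forall>h\<in>{0<..<\<epsilon>}. \<forall>\<Delta>t>0. fd_scheme T D L b h \<Delta>t (uh h \<Delta>t) (vh h \<Delta>t)"
    and init: "(?e0 \<longlongrightarrow> 0) ?F"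
  have z: "0 \<in> {0..T}" using T by simp
  have m: "\<And>t. t \<in> {0..T} \<Longrightarrow> u t \<in> holder0_space D \<gamma>" "\<And>t. t \<in> {0..T} \<Longrightarrow> v t \<in> holder0_space D \<gamma>"
    using sol by (auto simp: peri_solution_def C2_holder0_def)
  define bnd where "bnd p = error_const * ((?e0 p + ?P * fst p powr \<gamma>) + snd p * S + H * fst p powr \<gamma>)" for p
  have pw: "((\<lambda>p. c * fst p powr \<gamma>) \<longlongrightarrow> 0) ?F" for c
    using filterlim_compose[OF powr_tendsto_zero filterlim_fst] .
  have sn: "((\<lambda>p. snd p) \<longlongrightarrow> 0) ?F"
    using filterlim_compose[OF tendsto_ident_at[of 0 "{0<..}"] filterlim_snd] .
  have "(bnd \<longlongrightarrow> error_const * ((0 + 0) + 0 * S + 0)) ?F"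
    unfolding bnd_def by (intro tendsto_intros init pw sn)
  then have bnd: "(bnd \<longlongrightarrow> 0) ?F" by simp
  have "\<forall>\<^sub>F h in at_right (0::real). 0 < h \<and> h < \<epsilon>" using eps by (intro eventually_at_rightI[of 0 \<epsilon>]) auto
  moreover have "\<forall>\<^sub>F h in at_right (0::real). 0 < h \<and> h < 1" by (intro eventually_at_rightI[of 0 1]) auto
  ultimately have ev: "\<forall>\<^sub>F p in ?F. (0 < fst p \<and> fst p < \<epsilon>) \<and> (0 < snd p \<and> snd p < 1)"
    by (rule eventually_prodI)
  have "\<forall>\<^sub>F p in ?F. norm (?sup p) \<le> bnd p"
    using ev
  proof eventually_elim
    case (elim p)
    obtain h \<Delta>t where p: "p = (h, \<Delta>t)" by (cases p)
    have h: "0 < h" "h < \<epsilon>" and dt: "0 < \<Delta>t" "\<Delta>t \<le> 1" using elim p by auto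
    let ?U = "uh h \<Delta>t" and ?V = "vh h \<Delta>t"
    have fd': "fd_scheme T D L b h \<Delta>t ?U ?V" using fd h dt by simp
    let ?E0 = "pw_norm h (grid_error h \<Delta>t u ?U 0) + pw_norm h (grid_error h \<Delta>t v ?V 0)"
    have z': "real 0 * \<Delta>t \<in> {0..T}" using z by simp
    have E0: "?E0 \<le> fd_error D u v h \<Delta>t ?U ?V 0 + ?P * h powr \<gamma>"
      using total_error_vs_grid_error(2)[where w = u and wh = ?U, OF h(1) m(1)[OF z'] solution_bounds(3)[OF z']]
        total_error_vs_grid_error(2)[where w = v and wh = ?V, OF h(1) m(2)[OF z'] solution_bounds(4)[OF z']]
      by (simp add: fd_error_def mult.assoc)
    have le: "fd_error D u v h \<Delta>t ?U ?V n \<le> bnd p" if "real n * \<Delta>t \<le> T" for n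
    proof -
      have "fd_error D u v h \<Delta>t ?U ?V n \<le> error_const * (?E0 + S * \<Delta>t + H * h powr \<gamma>)"
        by (rule fd_error_estimate[OF h(1) dt fd' that])
      also have "\<dots> \<le> bnd p"
        unfolding bnd_def p using E0 by (intro mult_left_mono error_const_nonneg) (simp add: mult.commute)
      finally show ?thesis .
    qed
    have mem: "0 \<in> {n. real n * \<Delta>t \<le> T}" using T by simp
    have "?sup p \<le> bnd p" unfolding p prod.case
      by (rule cSUP_least) (use mem le[unfolded p] in blast)+
    moreover have "0 \<le> ?sup p"
    proof -
      have "bdd_above (fd_error D u v h \<Delta>t ?U ?V ` {n. real n * \<Delta>t \<le> T})"
        using le by (auto intro!: bdd_aboveI2)
      from cSUP_upper[OF mem this] show ?thesis
        using fd_error_nonneg[of u v h \<Delta>t ?U ?V 0] unfolding p by simp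
    qed
    ultimately show ?case by simp
  qed
  then show "(?sup \<longlongrightarrow> 0) ?F" using bnd by (rule Lim_null_comparison)
qed

lemma error_bound_exact_initial_data:
  assumes h: "0 < h" and dt: "0 < \<Delta>t" "\<Delta>t \<le> 1"
    and fd: "fd_scheme T D L b h \<Delta>t uh vh"
    and init: "\<And>i. grid h i \<in> D \<Longrightarrow> uh 0 i = cell_avg h (u 0) i \<and> vh 0 i = cell_avg h (v 0) i"
    and n: "real n * \<Delta>t \<le> T" and eps: "0 < \<epsilon>" "\<epsilon> < 1"
  shows "fd_error D u v h \<Delta>t uh vh n \<le> error_const * (S * \<Delta>t
     + H * h powr \<gamma> / \<epsilon>\<^sup>2)"
proof -
  have z: "0 \<in> {0..T}" using T by simp
  have "u 0 \<in> holder0_space D \<gamma>" using sol z by (auto simp: peri_solution_def C2_holder0_def)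
  then have "0 \<le> holder_norm D \<gamma> (u 0)" using holder_norm_nonneg[OF D(1,3)] by (auto simp: holder0_space_def)
  then have H0: "0 \<le> H" using solution_bounds(3)[OF z] by linarith
  have zero: "pw_norm h (grid_error h \<Delta>t w wh 0) = 0"
    if "\<And>i. grid h i \<in> D \<Longrightarrow> wh 0 i = cell_avg h (w 0) i" for w wh
  proof -
    have "pw_const D h (grid_error h \<Delta>t w wh 0) = pw_const D h (\<lambda>i. 0 *\<^sub>R (0::real^'n))"
      using that by (intro pw_const_cong) (simp add: grid_error_def)
    then show ?thesis using pw_norm_scale[of h 0 "\<lambda>_. 0"] by simp
  qed
  have "fd_error D u v h \<Delta>t uh vh n \<le> error_const * (0 + 0 + S * \<Delta>t + H * h powr \<gamma>)"
    using fd_error_estimate[OF h dt fd n] zero[of uh u] zero[of vh v] init by simp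
  also have "\<dots> \<le> error_const * (S * \<Delta>t + H * h powr \<gamma> / \<epsilon>\<^sup>2)"
  proof (intro mult_left_mono error_const_nonneg)
    \<comment> \<open>As the horizon is below one, dividing by its square only enlarges the bound.\<close>
    have e: "\<epsilon>\<^sup>2 \<le> 1" "0 < \<epsilon>\<^sup>2" using eps by (auto simp: power_le_one)
    have "H * h powr \<gamma> / 1 \<le> H * h powr \<gamma> / \<epsilon>\<^sup>2"
      using e H0 by (intro divide_left_mono) auto
    then show "0 + 0 + S * \<Delta>t + H * h powr \<gamma> \<le> S * \<Delta>t + H * h powr \<gamma> / \<epsilon>\<^sup>2" by simp
  qed
  finally show ?thesis .
qed

end

end

theorem theorem3:
  fixes D :: "(real^'n) set" and \<epsilon> \<gamma> T :: real
    and J f g :: "real \<Rightarrow> real" and \<omega> :: "real^'n \<Rightarrow> real"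
  assumes dim: "CARD('n) \<in> {2, 3}"
    and D: "open D" "bounded D" "D \<noteq> {}"
    and eps: "0 < \<epsilon>" "\<epsilon> < 1"
    and gam: "0 < \<gamma>" "\<gamma> \<le> 1"
    and T: "0 < T"
    and J: "influence_function J"
    and om: "boundary_function D \<gamma> \<epsilon> \<omega>"
    and f: "convex_concave f" "bounded_derivs3 f"
    and g: "quadratic_potential g \<or> (convex_concave g \<and> bounded_derivs3 g)"
  shows
    "(\<forall>b u u1 u2 v v1 v2. peri_solution T D \<gamma> (peri_force \<epsilon> J \<omega> f g) b u u1 u2 v v1 v2 \<longrightarrow>
        consistent_in_time T D \<epsilon> u v \<and>
        consistent_in_space T D (peri_force \<epsilon> J \<omega> f g) u v \<and>
        scheme_converges T D \<epsilon> (peri_force \<epsilon> J \<omega> f g) b u v) \<and>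
     (\<exists>(K::real) (Ct::real \<Rightarrow> real) (Cs::real \<Rightarrow> real) (\<delta>::real). \<delta> > 0 \<and>
        (\<forall>b u u1 u2 v v1 v2. peri_solution T D \<gamma> (peri_force \<epsilon> J \<omega> f g) b u u1 u2 v v1 v2 \<longrightarrow>
          (\<forall>h \<Delta>t uh vh. 0 < h \<and> h < \<epsilon> \<and> h < \<delta> \<and> 0 < \<Delta>t \<and> \<Delta>t < \<delta> \<and>
             fd_scheme T D (peri_force \<epsilon> J \<omega> f g) b h \<Delta>t uh vh \<and>
             (\<forall>i. grid h i \<in> D \<longrightarrow> uh 0 i = cell_avg h (u 0) i \<and> vh 0 i = cell_avg h (v 0) i) \<longrightarrow>
             bdd_above (fd_error D u v h \<Delta>t uh vh ` {k. real k * \<Delta>t \<le> T}) \<and>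
             (SUP k\<in>{k. real k * \<Delta>t \<le> T}. fd_error D u v h \<Delta>t uh vh k)
               \<le> K * (Ct (solution_L2_deriv_norm T D u2 v2) * \<Delta>t +
                      Cs (solution_holder_norm T D \<gamma> u v v1) * h powr \<gamma> / \<epsilon>\<^sup>2))))"
proof -
  let ?L = "peri_force \<epsilon> J \<omega> f g"
  have d2: "2 \<le> CARD('n)" using dim by auto
  obtain \<kappa> where k: "kernel_bound D \<kappa>"
    using kernel_bound_exists[of D] D d2 by auto
  have g': "quadratic_potential g \<or> bounded_derivs3 g" using g by blast
  obtain C where L: "force_lipschitz D C ?L"
    by (rule peri_force_lipschitz[OF d2 D eps(1) J om f(2) g' k])
  note ctx = D gam(1) T k L
  have error: "bdd_above (fd_error D u v h \<Delta>t uh vh ` {k. real k * \<Delta>t \<le> T}) \<and>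
      (SUP k\<in>{k. real k * \<Delta>t \<le> T}. fd_error D u v h \<Delta>t uh vh k)
        \<le> error_const D \<gamma> \<kappa> C T * (solution_L2_deriv_norm T D u2 v2 * \<Delta>t +
             solution_holder_norm T D \<gamma> u v v1 * h powr \<gamma> / \<epsilon>\<^sup>2)"
    if sol: "peri_solution T D \<gamma> ?L b u u1 u2 v v1 v2"
      and h: "0 < h" and dt: "0 < \<Delta>t" "\<Delta>t < 1" and fd: "fd_scheme T D ?L b h \<Delta>t uh vh"
      and init: "\<forall>i. grid h i \<in> D \<longrightarrow> uh 0 i = cell_avg h (u 0) i \<and> vh 0 i = cell_avg h (v 0) i"
    for b u u1 u2 v v1 v2 h \<Delta>t uh vh
  proof -
    let ?B = "error_const D \<gamma> \<kappa> C T * (solution_L2_deriv_norm T D u2 v2 * \<Delta>t +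
             solution_holder_norm T D \<gamma> u v v1 * h powr \<gamma> / \<epsilon>\<^sup>2)"
    have le: "fd_error D u v h \<Delta>t uh vh n \<le> ?B" if "n \<in> {k. real k * \<Delta>t \<le> T}" for n
      using that init by (intro error_bound_exact_initial_data[OF ctx sol h dt(1) less_imp_le[OF dt(2)] fd _ _ eps]) auto
    have "(0::nat) \<in> {k. real k * \<Delta>t \<le> T}" using T by simp
    then have "(SUP k\<in>{k. real k * \<Delta>t \<le> T}. fd_error D u v h \<Delta>t uh vh k) \<le> ?B"
      using le by (intro cSUP_least) blast+
    moreover have "bdd_above (fd_error D u v h \<Delta>t uh vh ` {k. real k * \<Delta>t \<le> T})"
      using le by (rule bdd_aboveI2)
    ultimately show ?thesis by blast
  qed
  show ?thesis
  proof (rule conjI, goal_cases)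
    case 1
    show ?case
      by (intro allI impI conjI consistency_in_time[OF ctx] consistency_in_space[OF ctx] convergence[OF ctx _ eps(1)])
  next
    case 2
    show ?case
      \<comment> \<open>The constant depends on the data only, both norms enter linearly, and \<open>\<Delta>t < 1\<close> suffices.\<close>
    proof (intro exI[of _ "error_const D \<gamma> \<kappa> C T"] exI[of _ "\<lambda>s::real. s"] exI[of _ "1::real"]
        conjI[OF zero_less_one] allI impI, elim conjE)
    qed (rule error)
  qed
qed

end
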